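(* Let $m,p\in\mathbb{N}_0$ and let the real parameters $A=((a_i,\alpha_i))_{1\le i\le p}$, $B=((b_j,\beta_j))_{1\le j\le m}$ satisfy the parameter assumptions (1)-(4) of the context. Let $\mathbb{H}\in(0,1)$, let $K=\prod_{j=1}^m\Gamma(b_j+\beta_j)\big/\prod_{i=1}^p\Gamma(a_i+\alpha_i)$, and let $\{X_t^{\mathbb{H},A,B},\,t\ge0\}$ be the generalized Fox-$H$ process on $(\mathcal{S}',\mathcal{C}_\sigma(\mathcal{S}'),\mu_\Psi)$ (see context). Then: 1. For all $t,s\ge0$, the characteristic function of the increment is $$\mathbb{E}\big[e^{\mathrm{i}\lambda(X_t^{\mathbb{H},A,B}-X_s^{\mathbb{H},A,B})}\big]=\frac1K\,{}_m\Psi_p\!\left(-\frac{\lambda^2}{2}|t-s|^{2\mathbb{H}}\right),\quad\lambda\in\mathbb{R}.$$ 2. The process $X^{\mathbb{H},A,B}$ is $\mathbb{H}$-self-similar with stationary increments. 3. For every $n\in\mathbb{N}$ there exists $C_1>0$ such that for all $t,s\ge0$ $$\mathbb{E}\big(|X_t^{\mathbb{H},A,B}-X_s^{\mathbb{H},A,B}|^{2n}\big)=C_1|t-s|^{2n\mathbb{H}}.$$ Hence, for every $n\in\mathbb{N}$ with $2n\mathbb{H}>1$ and every $0<\gamma<\mathbb{H}-\frac{1}{2n}$, there exists a version of the process with $\gamma$-Hölder continuous sample paths.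
   Context: **Parameter assumptions.** $m,p\in\mathbb{N}_0$ and: (1) $a_i\in\mathbb{R}$, $\alpha_i>0$, $a_i+\alpha_i>0$ for $i=1,\dots,p$; (2) $b_j\in\mathbb{R}$, $\beta_j>0$, $b_j+\beta_j>0$ for $j=1,\dots,m$; (3) with $a^*:=\sum_{j=1}^m\beta_j-\sum_{i=1}^p\alpha_i$ and $\mu:=\sum_{j=1}^m b_j-\sum_{i=1}^p a_i+(p-m)/2$, either $a^*>0$, or $a^*=0$ and $\mu<-1$; (4) the Fox-$H$ function $$H^{m,0}_{p,m}(\tau):=\frac{1}{2\pi \mathrm{i}}\int_{\gamma_0-\mathrm{i}\infty}^{\gamma_0+\mathrm{i}\infty}\frac{\prod_{j=1}^m\Gamma(b_j+\beta_js)}{\prod_{i=1}^p\Gamma(a_i+\alpha_is)}\,\tau^{-s}\,\mathrm{d}s,\quad \tau>0,$$ (with $\gamma_0>\max_j(-b_j/\beta_j)$, e.g. $\gamma_0=1$) is non-negative on $(0,\infty)$. Empty sums are $0$, empty products are $1$. Known fact: under these assumptions $\varrho_H:=\frac1K H^{m,0}_{p,m}$ is a probability density on $(0,\infty)$ with $\int_0^\infty\tau^l\varrho_H(\tau)\,\mathrm{d}\tau=\frac1K\prod_j\Gamma(b_j+\beta_j(l+1))/\prod_i\Gamma(a_i+\alpha_i(l+1))$, $l\in\mathbb{N}_0$, and Laplace transform $s\mapsto\frac1K\,{}_m\Psi_p(-s)$, $s\ge0$. **Generalized Wright function.** ${}_m\Psi_p(z):=\sum_{k\ge0}\frac{\prod_{j=1}^m\Gamma(b_j+\beta_j+\beta_jk)}{\prod_{i=1}^p\Gamma(a_i+\alpha_i+\alpha_ik)}\frac{z^k}{k!}$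 (entire if $a^*<1$). For $s>0$, in general, ${}_m\Psi_p(-s)$ is understood through its Fox-$H$ representation ${}_m\Psi_p(-s)=\frac{1}{2\pi \mathrm{i}}\int_{c-\mathrm{i}\infty}^{c+\mathrm{i}\infty}\Gamma(u)\frac{\prod_j\Gamma(b_j+\beta_j-\beta_ju)}{\prod_i\Gamma(a_i+\alpha_i-\alpha_iu)}s^{-u}\,\mathrm{d}u$ with $0<c<\min_j(b_j+\beta_j)/\beta_j$, and ${}_m\Psi_p(0)=K$. **The measure.** Let $\mathcal{S}=\mathcal{S}(\mathbb{R})$ be the real Schwartz space, $\mathcal{S}'$ its dual with pairing $\langle\cdot,\cdot\rangle$ extending the inner product of $L^2(\mathbb{R},\mathrm{d}x)$, and $\mathcal{C}_\sigma(\mathcal{S}')$ the cylinder $\sigma$-algebra. The generalized Fox-$H$ measure $\mu_\Psi$ is the unique probability measure on $(\mathcal{S}',\mathcal{C}_\sigma(\mathcal{S}'))$ with $\int_{\mathcal{S}'}e^{\mathrm{i}\langle\omega,\varphi\rangle}\,\mathrm{d}\mu_\Psi(\omega)=\frac1K\,{}_m\Psi_p\big(-\frac12\langle\varphi,\varphi\rangle\big)$, $\varphi\in\mathcal{S}$. One has $\|\langle\cdot,\varphi\rangle\|_{L^2(\mu_\Psi)}=c\,|\varphi|_{L^2(\mathbb{R})}$ for a constant $c$; hence $\langle\cdot,f\rangle\in L^2(\mu_\Psi)$ is defined for $f\in L^2(\mathbb{R})$ as the $L^2(\mu_\Psi)$-limit of $\langle\cdot,\varphi_n\rangle$, $\varphi_n\in\mathcal{S}$,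 $\varphi_n\to f$ in $L^2(\mathbb{R})$. $\mathbb{E}$ denotes expectation under $\mu_\Psi$. **Fractional operator.** $M_-^{\mathbb{H}}f=K_{\mathbb{H}}D_-^{1/2-\mathbb{H}}f$ if $\mathbb{H}<1/2$, $M_-^{1/2}f=f$, $M_-^{\mathbb{H}}f=K_{\mathbb{H}}I_-^{\mathbb{H}-1/2}f$ if $\mathbb{H}>1/2$, where for $\sigma\in(0,1)$ $(I_-^\sigma f)(x)=\frac{1}{\Gamma(\sigma)}\int_x^\infty f(t)(t-x)^{\sigma-1}\mathrm{d}t$, $(D_-^\sigma f)(x)=-\frac{1}{\Gamma(1-\sigma)}\frac{\mathrm{d}}{\mathrm{d}x}\int_x^\infty f(t)(t-x)^{-\sigma}\mathrm{d}t$, and $K_{\mathbb{H}}=\Gamma(\mathbb{H}+\tfrac12)\big(\int_0^\infty((1+s)^{\mathbb{H}-1/2}-s^{\mathbb{H}-1/2})^2\mathrm{d}s+\frac{1}{2\mathbb{H}}\big)^{-1/2}$. Known: $M_-^{\mathbb{H}}\mathbf{1}_{[0,t)}\in L^2(\mathbb{R})$ and $(M_-^{\mathbb{H}}\mathbf{1}_{[0,t)},M_-^{\mathbb{H}}\mathbf{1}_{[0,s)})_{L^2}=\frac12(t^{2\mathbb{H}}+s^{2\mathbb{H}}-|t-s|^{2\mathbb{H}})$. **Generalized Fox-$H$ process.** $X_t^{\mathbb{H},A,B}:=\langle\cdot,M_-^{\mathbb{H}}\mathbf{1}_{[0,t)}\rangle$, $t\ge0$. A process is $\mathbb{H}$-self-similar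 if for every $c>0$ the processes $\{X_{ct}\}_{t\ge0}$ and $\{c^{\mathbb{H}}X_t\}_{t\ge0}$ have the same finite-dimensional distributions; it has stationary increments if for every $h\ge0$ the processes $\{X_{t+h}-X_h\}_{t\ge0}$ and $\{X_t-X_0\}_{t\ge0}$ have the same finite-dimensional distributions. Hölder continuity of sample paths is meant on compact time intervals. *)

theory Defs
  imports "HOL-Probability.Probability"
begin

section \<open>Fox H-function and generalized Wright function\<close>

definition gamma_quot ::
  "nat \<Rightarrow> nat \<Rightarrow> (nat \<Rightarrow> real) \<Rightarrow> (nat \<Rightarrow> real) \<Rightarrow> (nat \<Rightarrow> real) \<Rightarrow> (nat \<Rightarrow> real) \<Rightarrow> complex \<Rightarrow> complex"
where
  "gamma_quot m p a \<alpha> b \<beta> s =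
     (\<Prod>j=1..m. Gamma (of_real (b j) + of_real (\<beta> j) * s)) /
     (\<Prod>i=1..p. Gamma (of_real (a i) + of_real (\<alpha> i) * s))"

text \<open>
  \<open>line_integral c f\<close> is the integral of \<open>f\<close> along the vertical line from \<open>c - \<i>\<infinity>\<close> to
  \<open>c + \<i>\<infinity>\<close>, parametrized by \<open>c + \<i>y\<close>. The integrals below converge absolutely under the
  parameter assumptions of the theorem, so the Lebesgue integral is the right notion.
\<close>

definition line_integral :: "real \<Rightarrow> (complex \<Rightarrow> complex) \<Rightarrow> complex" where
  "line_integral c f = (LINT y|lborel. f (Complex c y) * \<i>)"

text \<open>
  \<open>H\<^sup>m\<^sup>,\<^sup>0\<^sub>p\<^sub>,\<^sub>m\<close>; the abscissa \<open>g\<close> of the contour is an argument, any \<open>g > max (- b j / \<beta> j)\<close>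
  being admissible.
\<close>

definition fox_H ::
  "nat \<Rightarrow> nat \<Rightarrow> (nat \<Rightarrow> real) \<Rightarrow> (nat \<Rightarrow> real) \<Rightarrow> (nat \<Rightarrow> real) \<Rightarrow> (nat \<Rightarrow> real) \<Rightarrow>
   real \<Rightarrow> real \<Rightarrow> complex"
where
  "fox_H m p a \<alpha> b \<beta> g \<tau> =
     1 / (2 * of_real pi * \<i>) *
     line_integral g (\<lambda>s. gamma_quot m p a \<alpha> b \<beta> s * of_real \<tau> powr (- s))"

definition fox_K ::
  "nat \<Rightarrow> nat \<Rightarrow> (nat \<Rightarrow> real) \<Rightarrow> (nat \<Rightarrow> real) \<Rightarrow> (nat \<Rightarrow> real) \<Rightarrow> (nat \<Rightarrow> real) \<Rightarrow> real"
where
  "fox_K m p a \<alpha> b \<beta> =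
     (\<Prod>j=1..m. Gamma (b j + \<beta> j)) / (\<Prod>i=1..p. Gamma (a i + \<alpha> i))"

text \<open>
  The generalized Wright function on the real line. In general the defining series need not
  converge, so at \<open>z < 0\<close> the function is understood through its Fox-H (Mellin-Barnes)
  representation, with contour abscissa \<open>c\<close>, where \<open>0 < c < min ((b j + \<beta> j) / \<beta> j)\<close>.
  At \<open>z = 0\<close> the series has the value \<^term>\<open>fox_K m p a \<alpha> b \<beta>\<close>. Note that
  \<open>b j + \<beta> j - \<beta> j * u = b j + \<beta> j * (1 - u)\<close>. Only \<open>z \<le> 0\<close> is used.
\<close>

definition gen_wright ::
  "nat \<Rightarrow> nat \<Rightarrow> (nat \<Rightarrow> real) \<Rightarrow> (nat \<Rightarrow> real) \<Rightarrow> (nat \<Rightarrow> real) \<Rightarrow> (nat \<Rightarrow> real) \<Rightarrow>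
   real \<Rightarrow> real \<Rightarrow> complex"
where
  "gen_wright m p a \<alpha> b \<beta> c z =
     (if z < 0 then
        1 / (2 * of_real pi * \<i>) *
        line_integral c (\<lambda>u. Gamma u * gamma_quot m p a \<alpha> b \<beta> (1 - u) * of_real (- z) powr (- u))
      else
        of_real (\<Sum>k. (\<Prod>j=1..m. Gamma (b j + \<beta> j + \<beta> j * real k)) /
                     (\<Prod>i=1..p. Gamma (a i + \<alpha> i + \<alpha> i * real k)) * z ^ k / fact k))"


section \<open>Schwartz space and tempered distributions\<close>

definition schwartz :: "(real \<Rightarrow> real) set" where
  "schwartz = {f. (\<forall>j x. (deriv ^^ j) f field_differentiable at x) \<and>
                  (\<forall>k j. bounded (range (\<lambda>x. x ^ k * (deriv ^^ j) f x)))}"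

definition schwartz_seminorm :: "nat \<Rightarrow> nat \<Rightarrow> (real \<Rightarrow> real) \<Rightarrow> real" where
  "schwartz_seminorm k j f = (SUP x. \<bar>x ^ k * (deriv ^^ j) f x\<bar>)"

definition schwartz_topology :: "(real \<Rightarrow> real) topology" where
  "schwartz_topology = topology_generated_by
     {{g \<in> schwartz. schwartz_seminorm k j (\<lambda>x. g x - f x) < e} | k j f e. f \<in> schwartz \<and> e > 0}"

text \<open>
  The topological dual. A distribution is a function on \<^const>\<open>schwartz\<close>, extended by
  \<^const>\<open>undefined\<close> so that distinct elements are distinct functionals; the pairing of \<open>\<omega>\<close>
  with a test function \<open>\<phi>\<close> is the application \<open>\<omega> \<phi>\<close>.
\<close>

definition tempered :: "((real \<Rightarrow> real) \<Rightarrow> real) set" where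
  "tempered = {\<omega> \<in> extensional schwartz.
     (\<forall>\<phi>\<in>schwartz. \<forall>\<psi>\<in>schwartz. \<omega> (\<lambda>x. \<phi> x + \<psi> x) = \<omega> \<phi> + \<omega> \<psi>) \<and>
     (\<forall>r. \<forall>\<phi>\<in>schwartz. \<omega> (\<lambda>x. r * \<phi> x) = r * \<omega> \<phi>) \<and>
     continuous_map schwartz_topology euclideanreal \<omega>}"

definition cylinder_space :: "((real \<Rightarrow> real) \<Rightarrow> real) measure" where
  "cylinder_space = sigma tempered
     {{\<omega> \<in> tempered. (\<lambda>i\<in>{1..n}. \<omega> (\<phi> i)) \<in> B} | (n::nat) \<phi> B.
        \<phi> \<in> {1..n} \<rightarrow> schwartz \<and> B \<in> sets (PiM {1..n} (\<lambda>_. borel))}"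


section \<open>The generalized Fox-H measure\<close>

definition is_fox_H_measure ::
  "nat \<Rightarrow> nat \<Rightarrow> (nat \<Rightarrow> real) \<Rightarrow> (nat \<Rightarrow> real) \<Rightarrow> (nat \<Rightarrow> real) \<Rightarrow> (nat \<Rightarrow> real) \<Rightarrow>
   real \<Rightarrow> ((real \<Rightarrow> real) \<Rightarrow> real) measure \<Rightarrow> bool"
where
  "is_fox_H_measure m p a \<alpha> b \<beta> c M \<longleftrightarrow>
     prob_space M \<and> sets M = sets cylinder_space \<and>
     (\<forall>\<phi>\<in>schwartz. (LINT \<omega>|M. iexp (\<omega> \<phi>)) =
        gen_wright m p a \<alpha> b \<beta> c (- (1/2) * (LINT x|lborel. \<phi> x * \<phi> x)) /
        of_real (fox_K m p a \<alpha> b \<beta>))"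

definition L2_tendsto :: "'a measure \<Rightarrow> (nat \<Rightarrow> 'a \<Rightarrow> real) \<Rightarrow> ('a \<Rightarrow> real) \<Rightarrow> bool" where
  "L2_tendsto M f g \<longleftrightarrow>
     (\<forall>n. f n \<in> borel_measurable M \<and> integrable M (\<lambda>x. (f n x)\<^sup>2)) \<and>
     g \<in> borel_measurable M \<and> integrable M (\<lambda>x. (g x)\<^sup>2) \<and>
     (\<lambda>n. LINT x|M. (f n x - g x)\<^sup>2) \<longlonglongrightarrow> 0"

text \<open>
  \<open>is_pairing M f Y\<close>: the random variable \<open>Y\<close> is a representative of the class of
  \<open>\<langle>\<cdot>, f\<rangle>\<close> in \<open>L\<^sup>2(M)\<close>, for \<open>f\<close> in \<open>L\<^sup>2\<close> of the real line.
\<close>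

definition is_pairing ::
  "((real \<Rightarrow> real) \<Rightarrow> real) measure \<Rightarrow> (real \<Rightarrow> real) \<Rightarrow> (((real \<Rightarrow> real) \<Rightarrow> real) \<Rightarrow> real) \<Rightarrow> bool"
where
  "is_pairing M f Y \<longleftrightarrow>
     (\<exists>\<phi>. (\<forall>n. \<phi> n \<in> schwartz) \<and> L2_tendsto lborel \<phi> f \<and> L2_tendsto M (\<lambda>n \<omega>. \<omega> (\<phi> n)) Y)"


section \<open>Fractional operators and the generalized Fox-H process\<close>

definition frac_I :: "real \<Rightarrow> (real \<Rightarrow> real) \<Rightarrow> real \<Rightarrow> real" where
  "frac_I \<sigma> f x = 1 / Gamma \<sigma> * (LINT t:{x<..}|lborel. f t * (t - x) powr (\<sigma> - 1))"

text \<open>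
  For an indicator of \<open>[0,t)\<close> the derivative exists except at \<open>0\<close> and \<open>t\<close>, where \<^const>\<open>deriv\<close>
  has an unspecified value; this does not affect the class in \<open>L\<^sup>2\<close>.
\<close>

definition frac_D :: "real \<Rightarrow> (real \<Rightarrow> real) \<Rightarrow> real \<Rightarrow> real" where
  "frac_D \<sigma> f x =
     - 1 / Gamma (1 - \<sigma>) * deriv (\<lambda>y. LINT t:{y<..}|lborel. f t * (t - y) powr (- \<sigma>)) x"

definition frac_K :: "real \<Rightarrow> real" where
  "frac_K H = Gamma (H + 1/2) *
     ((LINT s:{0<..}|lborel. ((1 + s) powr (H - 1/2) - s powr (H - 1/2))\<^sup>2) + 1 / (2 * H)) powr (- 1/2)"

definition frac_M :: "real \<Rightarrow> (real \<Rightarrow> real) \<Rightarrow> real \<Rightarrow> real" where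
  "frac_M H f =
     (if H < 1/2 then (\<lambda>x. frac_K H * frac_D (1/2 - H) f x)
      else if H = 1/2 then f
      else (\<lambda>x. frac_K H * frac_I (H - 1/2) f x))"

definition is_fox_H_process ::
  "((real \<Rightarrow> real) \<Rightarrow> real) measure \<Rightarrow> real \<Rightarrow> (real \<Rightarrow> ((real \<Rightarrow> real) \<Rightarrow> real) \<Rightarrow> real) \<Rightarrow> bool"
where
  "is_fox_H_process M H X \<longleftrightarrow> (\<forall>t\<ge>0. is_pairing M (frac_M H (indicat_real {0..<t})) (X t))"


section \<open>Processes indexed by the non-negative reals\<close>

definition same_fdd :: "'a measure \<Rightarrow> (real \<Rightarrow> 'a \<Rightarrow> real) \<Rightarrow> (real \<Rightarrow> 'a \<Rightarrow> real) \<Rightarrow> bool" where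
  "same_fdd M X Y \<longleftrightarrow> (\<forall>I. finite I \<and> I \<subseteq> {0..} \<longrightarrow>
     distr M (PiM I (\<lambda>_. borel)) (\<lambda>\<omega>. \<lambda>t\<in>I. X t \<omega>) =
     distr M (PiM I (\<lambda>_. borel)) (\<lambda>\<omega>. \<lambda>t\<in>I. Y t \<omega>))"

definition self_similar :: "'a measure \<Rightarrow> real \<Rightarrow> (real \<Rightarrow> 'a \<Rightarrow> real) \<Rightarrow> bool" where
  "self_similar M H X \<longleftrightarrow>
     (\<forall>c>0. same_fdd M (\<lambda>t. X (c * t)) (\<lambda>t \<omega>. c powr H * X t \<omega>))"

definition stationary_increments :: "'a measure \<Rightarrow> (real \<Rightarrow> 'a \<Rightarrow> real) \<Rightarrow> bool" where
  "stationary_increments M X \<longleftrightarrow>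
     (\<forall>h\<ge>0. same_fdd M (\<lambda>t \<omega>. X (t + h) \<omega> - X h \<omega>) (\<lambda>t \<omega>. X t \<omega> - X 0 \<omega>))"

definition is_version :: "'a measure \<Rightarrow> (real \<Rightarrow> 'a \<Rightarrow> real) \<Rightarrow> (real \<Rightarrow> 'a \<Rightarrow> real) \<Rightarrow> bool" where
  "is_version M X Y \<longleftrightarrow> (\<forall>t\<ge>0. Y t \<in> borel_measurable M \<and> (AE \<omega> in M. Y t \<omega> = X t \<omega>))"

definition holder_on_compacts :: "real \<Rightarrow> (real \<Rightarrow> real) \<Rightarrow> bool" where
  "holder_on_compacts \<gamma> x \<longleftrightarrow>
     (\<forall>T>0. \<exists>C. \<forall>s\<in>{0..T}. \<forall>t\<in>{0..T}. \<bar>x t - x s\<bar> \<le> C * \<bar>t - s\<bar> powr \<gamma>)"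

end

theory Submission
  imports
    Defs
    "HOL-Complex_Analysis.Complex_Analysis"
    "HOL-Real_Asymp.Real_Asymp"
begin

text \<open>
  Write \<open>\<Phi>(r) = \<Psi>(- r / 2) / K\<close>, so that the characteristic functional of the measure is
  \<open>\<Phi>(|\<phi>|\<^sup>2)\<close>. By \<open>L\<^sup>2\<close>-approximation every pairing \<open>\<langle>\<cdot>, f\<rangle>\<close> has the law of \<open>|f| Z\<close>, where \<open>Z\<close> has
  characteristic function \<open>\<Phi>(u\<^sup>2)\<close>, and the joint laws of pairings depend only on the norms of
  linear combinations. Up to null sets \<open>M\<^sub>-\<close> maps the indicator of \<open>[0,t)\<close> to the
  Mandelbrot--Van Ness kernel, whose scaling and translation behaviour gives the characteristic
  function of the increments, self-similarity and stationarity.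

  The moments of \<open>Z\<close> are finite because \<open>\<Phi>\<close> has a Taylor expansion of every order at \<open>0\<close>:
  in the Mellin--Barnes integral the contour is moved to the left across the poles of \<open>\<Gamma>(u)\<close>.
  The factor \<open>\<Gamma>(u)\<close> makes the integrand decay exponentially as soon as \<open>a\<^sup>* \<ge> 0\<close>. Finally, \<open>Z\<close> does
  not vanish almost surely because \<open>\<Phi>\<close> tends to \<open>0\<close> at infinity, and the moment identity feeds the
  Kolmogorov--Chentsov criterion, proved by dyadic chaining.
\<close>

section \<open>Vertical growth of the Gamma function\<close>

text \<open>For the contour shift, bounds up to polynomial factors are enough. On the line Re z =
  1/2 the modulus of Gamma is explicit by reflection, and monotonicity in x of |Gamma(x+iy)| /
  Gamma(x) carries the bound to other lines. The factors of the integrand have exponential rates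
  adding up to -(1 + \<open>astar\<close>) pi/2; the 1 comes from Gamma(u), which is why
  \<open>astar = 0\<close> is harmless here.

  An expansion of a characteristic function at 0 does not by itself give derivatives near 0, so the
  moments are not obtained by differentiation. Instead, iterated second differences at 0 are
  expectations of non-negative variables; the expansion bounds them by a multiple of u^(2n), and
  Fatou turns this into a moment bound.

  Equality of joint laws is reduced to the one-dimensional uniqueness theorem of Levy by an
  induction over coordinates with weights.

  Square-integrability of the kernel is read off from the assumption that \<open>X 1\<close> is a
  pairing; its norm is then computed, and this is where the normalisation \<open>frac_K\<close>
  enters. The constant \<open>C1\<close> is the moment E Z^(2n).\<close>

lemma Re_pos_not_nonpos_Ints: "Re z > 0 \<Longrightarrow> z \<notin> \<int>\<^sub>\<le>\<^sub>0"
  by (auto elim!: nonpos_Ints_cases)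

lemma Gamma_complex_pos_nonzero: "Re z > 0 \<Longrightarrow> Gamma z \<noteq> (0::complex)"
  by (simp add: Gamma_eq_zero_iff Re_pos_not_nonpos_Ints)

text \<open>In Euler's limit formula both sides become limits of the products of (x+k) / |x+k+iy|,
  and each factor increases with x.\<close>

lemma norm_Gamma_div_mono:
  fixes x x' y :: real
  assumes "0 < x" "x \<le> x'"
  shows "cmod (Gamma (Complex x y)) / Gamma x \<le> cmod (Gamma (Complex x' y)) / Gamma x'"
proof -
  \<comment> \<open>The factor n^z has modulus n^x and the factorial is common, so only the
    Pochhammer products survive in the quotient.\<close>
  have eq: "cmod (Gamma_series (Complex x y) n) / Gamma_series x n = (\<Prod>k\<le>n. (x + real k) / cmod (Complex (x + real k) y))"
    if "n > 0" "x > 0" for n and x :: real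
  proof -
    have "cmod (pochhammer (Complex x y) (Suc n)) = (\<Prod>k\<le>n. cmod (Complex (x + k) y))"
      unfolding pochhammer_prod prod_norm[symmetric] atLeast0LessThan lessThan_Suc_atMost
      by (intro prod.cong arg_cong[of _ _ cmod]) (auto simp: complex_eq_iff)
    moreover have "pochhammer x (Suc n) = (\<Prod>k\<le>n. x + k)"
      unfolding pochhammer_prod by (simp add: atLeast0LessThan lessThan_Suc_atMost)
    moreover have "cmod (exp (Complex x y * of_real (ln (real n)))) = exp (x * ln (real n))"
      by simp
    ultimately show ?thesis using that
      unfolding Gamma_series_def
      by (simp add: norm_divide norm_mult prod_dividef)
  qed
  have le: "cmod (Gamma_series (Complex x y) n) / Gamma_series x n \<le> cmod (Gamma_series (Complex x' y) n) / Gamma_series x' n" if "n > 0" for n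
  proof -
    have "(x + k) / cmod (Complex (x + k) y) \<le> (x' + k) / cmod (Complex (x' + k) y)" for k :: nat
    proof -
      have p: "0 < x + k" "x + k \<le> x' + k" using assms by auto
      have "((x + k) * cmod (Complex (x' + k) y))\<^sup>2 \<le> ((x' + k) * cmod (Complex (x + k) y))\<^sup>2"
      proof -
        have "(x+k)\<^sup>2 * y\<^sup>2 \<le> (x'+k)\<^sup>2 * y\<^sup>2" using p by (intro mult_right_mono power_mono) auto
        then show ?thesis unfolding power_mult_distrib cmod_power2 by (simp add: distrib_left mult_ac)
      qed
      then have "(x + k) * cmod (Complex (x' + k) y) \<le> (x' + k) * cmod (Complex (x + k) y)"
        by (rule power2_le_imp_le) (use p in auto)
      moreover have "cmod (Complex (x + k) y) > 0" "cmod (Complex (x' + k) y) > 0"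
        using p by (auto simp: complex_eq_iff)
      ultimately show ?thesis by (simp add: divide_simps mult.commute)
    qed
    then show ?thesis using that assms by (auto simp: eq intro!: prod_mono)
  qed
  have G: "Gamma x > 0" "Gamma x' > 0" using assms by (auto intro: Gamma_real_pos)
  show ?thesis
  proof (rule LIMSEQ_le)
    show "(\<lambda>n. cmod (Gamma_series (Complex x y) n) / Gamma_series x n) \<longlonglongrightarrow> cmod (Gamma (Complex x y)) / Gamma x"
      by (intro tendsto_intros) (use G in auto)
    show "(\<lambda>n. cmod (Gamma_series (Complex x' y) n) / Gamma_series x' n) \<longlonglongrightarrow> cmod (Gamma (Complex x' y)) / Gamma x'"
      by (intro tendsto_intros) (use G in auto)
  qed (use le in \<open>auto intro!: exI[of _ 1]\<close>)
qed

text \<open>On this line conj z = 1 - z, so |Gamma(z)|^2 = Gamma(z) Gamma(1-z) and the reflection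
  formula applies.\<close>

lemma norm_Gamma_half_sq: "(cmod (Gamma (Complex (1/2) y)))\<^sup>2 = pi / cosh (pi * y)"
proof -
  have "Gamma (cnj (Complex (1/2) y)) = cnj (Gamma (Complex (1/2) y))"
    by (simp add: cnj_Gamma) 
  moreover have "cnj (Complex (1/2) y) = 1 - Complex (1/2) y" by (simp add: complex_eq_iff)
  ultimately have "of_real ((cmod (Gamma (Complex (1/2) y)))\<^sup>2) = Gamma (Complex (1/2) y) * Gamma (1 - Complex (1/2) y)"
    using complex_norm_square by metis
  also have "\<dots> = of_real pi / sin (of_real pi * Complex (1/2) y)"
    by (rule Gamma_reflection_complex)
  also have "of_real pi * Complex (1/2) y = \<i> * of_real (pi * y) + of_real (pi / 2)" 
    by (simp add: complex_eq_iff)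
  also have "sin \<dots> = of_real (cosh (pi * y))"
    by (simp add: sin_add cos_i_times cosh_field_def exp_minus flip: exp_of_real)
  finally show ?thesis by (metis of_real_divide of_real_eq_iff)
qed

text \<open>Both come from exp(t)/2 <= cosh t <= exp t at t = pi |y|; the 3 is a round upper bound
  for sqrt(2 pi).\<close>

lemma norm_Gamma_half_bounds:
  "cmod (Gamma (Complex (1/2) y)) \<le> 3 * exp (- pi / 2 * \<bar>y\<bar>)"
  "cmod (Gamma (Complex (1/2) y)) \<ge> exp (- pi / 2 * \<bar>y\<bar>)"
proof -
  define E where "E = exp (- pi / 2 * \<bar>y\<bar>)"
  have e: "exp (- pi * \<bar>y\<bar>) = E\<^sup>2" and E0: "E > 0" by (simp_all add: E_def flip: exp_double)
  have c: "cosh (pi * y) = cosh (pi * \<bar>y\<bar>)" by (simp add: abs_if)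
  have c1: "cosh (pi * y) \<ge> exp (pi * \<bar>y\<bar>) / 2" unfolding c unfolding cosh_def by simp
  have c2: "cosh (pi * y) \<le> exp (pi * \<bar>y\<bar>)" unfolding c unfolding cosh_def by simp
  have c0: "cosh (pi * y) > 0" by simp
  have "pi / cosh (pi * y) \<le> pi / (exp (pi * \<bar>y\<bar>) / 2)"
    using c1 c0 by (intro divide_left_mono mult_pos_pos) auto
  also have "\<dots> = 2 * pi * exp (- pi * \<bar>y\<bar>)" by (simp add: exp_minus divide_simps)
  also have "\<dots> \<le> 9 * exp (- pi * \<bar>y\<bar>)" using pi_less_4 by (intro mult_right_mono) auto
  finally have "(cmod (Gamma (Complex (1/2) y)))\<^sup>2 \<le> (3 * E)\<^sup>2"
    unfolding norm_Gamma_half_sq e by (simp add: power_mult_distrib)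
  then have "cmod (Gamma (Complex (1/2) y)) \<le> 3 * E" by (rule power2_le_imp_le) (use E0 in auto)
  then show "cmod (Gamma (Complex (1/2) y)) \<le> 3 * exp (- pi / 2 * \<bar>y\<bar>)" unfolding E_def .
  have "exp (- pi * \<bar>y\<bar>) = 1 / exp (pi * \<bar>y\<bar>)" by (simp add: exp_minus divide_simps)
  also have "\<dots> \<le> pi / cosh (pi * y)"
    using c2 c0 pi_gt3 by (intro frac_le) auto
  finally have "E\<^sup>2 \<le> (cmod (Gamma (Complex (1/2) y)))\<^sup>2"
    unfolding norm_Gamma_half_sq e .
  then have "E \<le> cmod (Gamma (Complex (1/2) y))" by (rule power2_le_imp_le) auto
  then show "cmod (Gamma (Complex (1/2) y)) \<ge> exp (- pi / 2 * \<bar>y\<bar>)" unfolding E_def .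
qed


text \<open>Only the exponential rate \<open>\<kappa>\<close> is recorded. Polynomial factors are
  left unspecified because a negative total rate absorbs them; thus rates simply add under
  products.\<close>

definition growth_on :: "complex set \<Rightarrow> real \<Rightarrow> (complex \<Rightarrow> complex) \<Rightarrow> bool" where
  "growth_on S \<kappa> f \<longleftrightarrow> (\<exists>C N. C \<ge> 0 \<and> (\<forall>z\<in>S. cmod (f z) \<le> C * (1 + \<bar>Im z\<bar>) ^ N * exp (\<kappa> * \<bar>Im z\<bar>)))"

lemma growth_onI:
  assumes "C \<ge> 0" "\<And>z. z \<in> S \<Longrightarrow> cmod (f z) \<le> C * (1 + \<bar>Im z\<bar>) ^ N * exp (\<kappa> * \<bar>Im z\<bar>)"
  shows "growth_on S \<kappa> f"
  using assms unfolding growth_on_def by blast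

lemma growth_on_mult:
  assumes "growth_on S \<kappa> f" "growth_on S \<kappa>' g"
  shows "growth_on S (\<kappa> + \<kappa>') (\<lambda>z. f z * g z)"
proof -
  obtain C N where C: "C \<ge> 0"
    and f: "\<And>z. z \<in> S \<Longrightarrow> cmod (f z) \<le> C * (1 + \<bar>Im z\<bar>) ^ N * exp (\<kappa> * \<bar>Im z\<bar>)"
    using assms(1) unfolding growth_on_def by metis
  obtain C' N' where C': "C' \<ge> 0"
    and g: "\<And>z. z \<in> S \<Longrightarrow> cmod (g z) \<le> C' * (1 + \<bar>Im z\<bar>) ^ N' * exp (\<kappa>' * \<bar>Im z\<bar>)"
    using assms(2) unfolding growth_on_def by metis
  show ?thesis
  proof (rule growth_onI[of "C * C'" _ _ "N + N'"])
    fix z assume a: "z \<in> S"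
    have "cmod (f z * g z) \<le> (C * (1 + \<bar>Im z\<bar>) ^ N * exp (\<kappa> * \<bar>Im z\<bar>)) * (C' * (1 + \<bar>Im z\<bar>) ^ N' * exp (\<kappa>' * \<bar>Im z\<bar>))"
      unfolding norm_mult using a C by (intro mult_mono f g) auto
    also have "\<dots> = C * C' * (1 + \<bar>Im z\<bar>) ^ (N + N') * exp ((\<kappa> + \<kappa>') * \<bar>Im z\<bar>)"
      by (simp add: power_add distrib_right exp_add)
    finally show "cmod (f z * g z) \<le> \<dots>" .
  qed (use C C' in auto)
qed

lemma growth_on_const: "growth_on S 0 (\<lambda>z. c)"
  by (rule growth_onI[of "cmod c" _ _ 0]) auto

lemma growth_on_prod:
  assumes "finite I" "\<And>i. i \<in> I \<Longrightarrow> growth_on S (\<kappa> i) (f i)"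
  shows "growth_on S (\<Sum>i\<in>I. \<kappa> i) (\<lambda>z. \<Prod>i\<in>I. f i z)"
  using assms by (induction I) (auto simp: growth_on_const intro!: growth_on_mult)

lemma growth_on_cong:
  assumes "growth_on S \<kappa> f" "\<And>z. z \<in> S \<Longrightarrow> f z = g z" "\<kappa> = \<kappa>'"
  shows "growth_on S \<kappa>' g"
  using assms unfolding growth_on_def by metis

lemma growth_on_subset:
  assumes "growth_on S \<kappa> f" "T \<subseteq> S"
  shows "growth_on T \<kappa> f"
  using assms unfolding growth_on_def by blast

text \<open>The arguments b + \<beta>(1-z) are those of \<open>gamma_quot\<close> at 1 - u. Their
  imaginary part is -\<beta> Im z, so the rate is multiplied by \<beta>.\<close>

lemma growth_on_affine:
  assumes "growth_on S \<kappa> f" "\<And>z. z \<in> T \<Longrightarrow> of_real b + of_real \<beta> * (1 - z) \<in> S" "\<beta> > 0"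
  shows "growth_on T (\<beta> * \<kappa>) (\<lambda>z. f (of_real b + of_real \<beta> * (1 - z)))"
proof -
  obtain C N where C: "C \<ge> 0"
    and f: "\<And>z. z \<in> S \<Longrightarrow> cmod (f z) \<le> C * (1 + \<bar>Im z\<bar>) ^ N * exp (\<kappa> * \<bar>Im z\<bar>)"
    using assms(1) unfolding growth_on_def by metis
  show ?thesis
  proof (rule growth_onI[of "C * (1 + \<beta>) ^ N" _ _ N])
    fix z assume "z \<in> T"
    then have "cmod (f (of_real b + of_real \<beta> * (1 - z))) \<le> C * (1 + \<beta> * \<bar>Im z\<bar>) ^ N * exp (\<kappa> * (\<beta> * \<bar>Im z\<bar>))"
      using f[OF assms(2)] \<open>\<beta> > 0\<close> by (simp add: abs_mult)
    also have "\<dots> \<le> C * ((1 + \<beta>) * (1 + \<bar>Im z\<bar>)) ^ N * exp (\<kappa> * (\<beta> * \<bar>Im z\<bar>))"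
      using C \<open>\<beta> > 0\<close> by (intro mult_right_mono mult_left_mono power_mono) (auto simp: algebra_simps)
    finally show "cmod (f (of_real b + of_real \<beta> * (1 - z))) \<le> C * (1 + \<beta>) ^ N * (1 + \<bar>Im z\<bar>) ^ N * exp (\<beta> * \<kappa> * \<bar>Im z\<bar>)"
      by (simp add: power_mult_distrib mult_ac)
  qed (use C \<open>\<beta> > 0\<close> in auto)
qed

lemma growth_on_shift:
  assumes "growth_on S \<kappa> f" "\<And>z. z \<in> T \<Longrightarrow> z + of_real b \<in> S"
  shows "growth_on T \<kappa> (\<lambda>z. f (z + of_real b))"
  using assms unfolding growth_on_def by fastforce

lemma growth_on_pochhammer: "growth_on {z. \<bar>Re z\<bar> \<le> R} 0 (\<lambda>z. pochhammer z n)"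
proof -
  have 1: "growth_on {z. \<bar>Re z\<bar> \<le> R} 0 (\<lambda>z. z + of_nat i)" for i
  proof (rule growth_onI[of "\<bar>R\<bar> + 1 + real i" _ _ 1])
    fix z :: complex assume "z \<in> {z. \<bar>Re z\<bar> \<le> R}"
    then have z: "\<bar>Re z\<bar> \<le> \<bar>R\<bar>" by auto
    have "cmod (z + of_nat i) \<le> cmod z + real i" by (metis norm_of_nat norm_triangle_ineq)
    also have "\<dots> \<le> \<bar>R\<bar> + \<bar>Im z\<bar> + real i" using cmod_le[of z] z by linarith
    also have "\<dots> \<le> (\<bar>R\<bar> + 1 + real i) * (1 + \<bar>Im z\<bar>)" by (simp add: algebra_simps)
    finally show "cmod (z + of_nat i) \<le> (\<bar>R\<bar> + 1 + real i) * (1 + \<bar>Im z\<bar>) ^ 1 * exp (0 * \<bar>Im z\<bar>)" by simp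
  qed auto
  have "growth_on {z. \<bar>Re z\<bar> \<le> R} (\<Sum>i\<in>{0..<n}. 0) (\<lambda>z. \<Prod>i\<in>{0..<n}. z + of_nat i)"
    by (rule growth_on_prod) (use 1 in auto)
  then show ?thesis unfolding pochhammer_prod by simp
qed

text \<open>By \<open>norm_Gamma_div_mono\<close> every line of the strip is dominated by the line
  Re z = 1/2 + N with N >= R, up to values of the real Gamma function, which is bounded on
  [\<delta>, R]. The functional equation brings that line back to Re z = 1/2 at the price of a
  polynomial.\<close>

lemma growth_on_Gamma:
  assumes "\<delta> > 0"
  shows "growth_on {z. \<delta> \<le> Re z \<and> Re z \<le> R} (- pi / 2) Gamma"
proof -
  obtain N :: nat where N: "R \<le> real N" using real_arch_simple by blast
  have half: "growth_on UNIV (- pi / 2) (\<lambda>z. Gamma (Complex (1/2) (Im z)))"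
    by (rule growth_onI[of 3 _ _ 0]) (use norm_Gamma_half_bounds(1) in auto)
  have poch: "growth_on UNIV 0 (\<lambda>z. pochhammer (Complex (1/2) (Im z)) N)"
  proof -
    obtain C M where "C \<ge> 0" and C: "\<And>z. z \<in> {z. \<bar>Re z\<bar> \<le> 1} \<Longrightarrow> cmod (pochhammer z N) \<le> C * (1 + \<bar>Im z\<bar>) ^ M * exp (0 * \<bar>Im z\<bar>)"
      using growth_on_pochhammer[of 1 N] unfolding growth_on_def by blast
    show ?thesis using C[of "Complex (1/2) y" for y] \<open>C \<ge> 0\<close> by (intro growth_onI[of C _ _ M]) auto
  qed
  have "continuous_on {\<delta>..R} (Gamma :: real \<Rightarrow> real)"
    using assms by (intro continuous_intros) (auto elim!: nonpos_Ints_cases)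
  then have "compact (Gamma ` {\<delta>..R})" by (intro compact_continuous_image) auto
  then obtain C where C: "\<And>x. \<delta> \<le> x \<Longrightarrow> x \<le> R \<Longrightarrow> \<bar>Gamma x\<bar> \<le> C"
    using compact_imp_bounded bounded_real by (metis (no_types, lifting) atLeastAtMost_iff image_eqI)
  \<comment> \<open>\<open>max C 0\<close> is used because \<open>C\<close> may be negative when the
    interval \<open>{\<delta>..R}\<close> is empty.\<close>
  define C' where "C' = max C 0 / Gamma (1/2 + real N)"
  have GN: "Gamma (1/2 + real N) > 0" by (intro Gamma_real_pos) auto
  obtain D M where D: "D \<ge> 0" "\<And>y. cmod (pochhammer (Complex (1/2) y) N * Gamma (Complex (1/2) y)) \<le> D * (1 + \<bar>y\<bar>) ^ M * exp (- pi / 2 * \<bar>y\<bar>)"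
  proof -
    have "growth_on UNIV (- pi / 2) (\<lambda>z. pochhammer (Complex (1/2) (Im z)) N * Gamma (Complex (1/2) (Im z)))"
      using growth_on_mult[OF poch half] by simp
    then obtain D M where "D \<ge> 0" "\<And>z. cmod (pochhammer (Complex (1/2) (Im z)) N * Gamma (Complex (1/2) (Im z))) \<le> D * (1 + \<bar>Im z\<bar>) ^ M * exp (- pi / 2 * \<bar>Im z\<bar>)"
      unfolding growth_on_def by blast
    from this(1) this(2)[of "Complex 0 y" for y] show ?thesis by (intro that) auto
  qed
  show ?thesis
  proof (rule growth_onI[of "C' * D" _ _ M])
    fix z assume "z \<in> {z. \<delta> \<le> Re z \<and> Re z \<le> R}"
    then have z: "\<delta> \<le> Re z" "Re z \<le> R" by auto
    define x y where "x = Re z" "y = Im z"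
    have zxy: "z = Complex x y" by (simp add: x_y_def)
    have x: "x > 0" "x \<le> 1/2 + real N" using z N assms by (auto simp: x_y_def)
    have "cmod (Gamma (Complex x y)) / Gamma x \<le> cmod (Gamma (Complex (1/2 + real N) y)) / Gamma (1/2 + real N)"
      by (rule norm_Gamma_div_mono) (use x in auto)
    then have "cmod (Gamma z) \<le> Gamma x * (cmod (Gamma (Complex (1/2 + real N) y)) / Gamma (1/2 + real N))"
      using Gamma_real_pos[OF x(1)] by (simp add: zxy pos_divide_le_eq mult.commute)
    also have "\<dots> \<le> max C 0 * (cmod (Gamma (Complex (1/2 + real N) y)) / Gamma (1/2 + real N))"
      using C[of x] z GN by (intro mult_right_mono) (auto simp: x_y_def)
    also have "Gamma (Complex (1/2 + real N) y) = pochhammer (Complex (1/2) y) N * Gamma (Complex (1/2) y)"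
    proof -
      have "Complex (1/2) y \<notin> \<int>\<^sub>\<le>\<^sub>0" by (auto simp: complex_eq_iff elim!: nonpos_Ints_cases)
      moreover have "Complex (1/2) y + of_nat N = Complex (1/2 + real N) y" by (simp add: complex_eq_iff)
      ultimately show ?thesis using pochhammer_Gamma[of "Complex (1/2) y" N]
        by (auto simp: Gamma_eq_zero_iff divide_simps simp del: Complex_eq)
    qed
    also have "max C 0 * (cmod (pochhammer (Complex (1/2) y) N * Gamma (Complex (1/2) y)) / Gamma (1/2 + real N)) \<le>
       max C 0 * ((D * (1 + \<bar>y\<bar>) ^ M * exp (- pi / 2 * \<bar>y\<bar>)) / Gamma (1/2 + real N))"
      using GN by (intro mult_left_mono divide_right_mono D) auto
    finally show "cmod (Gamma z) \<le> C' * D * (1 + \<bar>Im z\<bar>) ^ M * exp (- pi / 2 * \<bar>Im z\<bar>)"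
      by (simp add: C'_def x_y_def)
  qed (use D GN in \<open>auto simp: C'_def\<close>)
qed

text \<open>To the right of Re z = 1/2 the monotone quotient is bounded below by its value on that
  line, which bounds the reciprocal above. The rest of the strip follows from rGamma(z) = pochhammer
  z N * rGamma(z+N); since rGamma is entire, no point has to be excluded.\<close>

lemma growth_on_rGamma: "growth_on {z. \<bar>Re z\<bar> \<le> R} (pi / 2) rGamma"
proof -
  obtain N :: nat where N: "R + 1/2 \<le> real N" using real_arch_simple by blast
  have base: "growth_on {z. 1/2 \<le> Re z \<and> Re z \<le> R + real N} (pi / 2) rGamma"
  proof -
    have "continuous_on {1/2..R + real N} (rGamma :: real \<Rightarrow> real)"
      by (intro continuous_intros)
    then have "compact (rGamma ` {1/2..R + real N})" by (intro compact_continuous_image) auto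
    then obtain C where C: "\<And>x. 1/2 \<le> x \<Longrightarrow> x \<le> R + real N \<Longrightarrow> \<bar>rGamma x\<bar> \<le> C"
      using compact_imp_bounded bounded_real by (metis (no_types, lifting) atLeastAtMost_iff image_eqI)
    show ?thesis
    proof (rule growth_onI[of "Gamma (1/2) * max C 0" _ _ 0])
      fix z assume "z \<in> {z. 1/2 \<le> Re z \<and> Re z \<le> R + real N}"
      then have z: "1/2 \<le> Re z" "Re z \<le> R + real N" by auto
      define x y where "x = Re z" "y = Im z"
      have zxy: "z = Complex x y" by (simp add: x_y_def)
      have G: "Gamma x > 0" "Gamma (1/2 :: real) > 0" using z by (auto simp: x_y_def intro!: Gamma_real_pos)
      have Gz: "cmod (Gamma z) > 0" using Gamma_complex_pos_nonzero[of z] z by auto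
      have H: "cmod (Gamma (Complex (1/2) y)) > 0" using Gamma_complex_pos_nonzero[of "Complex (1/2) y"] by auto
      have "cmod (Gamma (Complex (1/2) y)) / Gamma (1/2) \<le> cmod (Gamma (Complex x y)) / Gamma x"
        by (rule norm_Gamma_div_mono) (use z in \<open>auto simp: x_y_def\<close>)
      then have "inverse (cmod (Gamma (Complex x y)) / Gamma x) \<le> inverse (cmod (Gamma (Complex (1/2) y)) / Gamma (1/2))"
        using H G by (intro le_imp_inverse_le divide_pos_pos) auto
      then have "inverse (cmod (Gamma z)) \<le> Gamma (1/2) * inverse (Gamma x) * inverse (cmod (Gamma (Complex (1/2) y)))"
        using G Gz H by (simp add: zxy field_simps)
      also have "\<dots> \<le> Gamma (1/2) * max C 0 * inverse (exp (- pi / 2 * \<bar>y\<bar>))"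
        using G C[of x] z norm_Gamma_half_bounds(2)[of y]
        by (intro mult_mono le_imp_inverse_le) (auto simp: x_y_def rGamma_inverse_Gamma)
      finally show "cmod (rGamma z) \<le> Gamma (1/2) * max C 0 * (1 + \<bar>Im z\<bar>) ^ 0 * exp (pi / 2 * \<bar>Im z\<bar>)"
        by (simp add: rGamma_inverse_Gamma norm_inverse x_y_def exp_minus)
    qed (auto intro!: mult_nonneg_nonneg less_imp_le Gamma_real_pos)
  qed
  have "growth_on {z. \<bar>Re z\<bar> \<le> R} (pi / 2) (\<lambda>z. rGamma (z + of_real (real N)))"
    by (rule growth_on_shift[OF base]) (use N in auto)
  from growth_on_mult[OF growth_on_pochhammer[of R N] this] show ?thesis
    by (rule growth_on_cong) (simp_all add: pochhammer_rGamma[symmetric])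
qed

text \<open>Gamma(z) = Gamma(z+N) / pochhammer z N, where z + N lies in the right half-plane and
  each factor of the Pochhammer product has modulus at least 1/2.\<close>

lemma growth_on_Gamma_away_poles:
  "growth_on {z. \<bar>Re z\<bar> \<le> R \<and> (\<forall>k. 1/2 \<le> cmod (z + of_nat k))} (- pi / 2) Gamma"
proof -
  let ?S = "{z. \<bar>Re z\<bar> \<le> R \<and> (\<forall>k. 1/2 \<le> cmod (z + of_nat k))}"
  obtain N :: nat where N: "R + 1/2 \<le> real N" using real_arch_simple by blast
  have "growth_on ?S (- pi / 2) (\<lambda>z. Gamma (z + of_real (real N)))"
    by (rule growth_on_shift[OF growth_on_Gamma[of "1/2" "R + real N"]]) (use N in auto)
  moreover have "growth_on ?S 0 (\<lambda>z. inverse (pochhammer z N))"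
  proof (rule growth_onI[of "2 ^ N" _ _ 0])
    fix z assume z: "z \<in> ?S"
    have "(1/2) ^ N = (\<Prod>i\<in>{0..<N}. 1/2::real)" by simp
    also have "\<dots> \<le> (\<Prod>i\<in>{0..<N}. cmod (z + of_nat i))" using z by (intro prod_mono) auto
    also have "\<dots> = cmod (pochhammer z N)" unfolding pochhammer_prod by (simp add: prod_norm)
    finally have "inverse (cmod (pochhammer z N)) \<le> inverse ((1/2) ^ N)" by (intro le_imp_inverse_le) auto
    then show "cmod (inverse (pochhammer z N)) \<le> 2 ^ N * (1 + \<bar>Im z\<bar>) ^ 0 * exp (0 * \<bar>Im z\<bar>)"
      by (simp add: norm_inverse power_one_over)
  qed auto
  ultimately have "growth_on ?S (- pi / 2 + 0) (\<lambda>z. Gamma (z + of_real (real N)) * inverse (pochhammer z N))"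
    by (rule growth_on_mult)
  then show ?thesis
  proof (rule growth_on_cong)
    fix z assume z: "z \<in> ?S"
    have "z + of_nat k \<noteq> 0" for k using z by (metis (mono_tags, lifting) mem_Collect_eq norm_zero half_gt_zero_iff not_le zero_less_one)
    then have z0: "z \<notin> \<int>\<^sub>\<le>\<^sub>0" by (metis add.left_inverse nonpos_Ints_cases')
    have p: "pochhammer z N \<noteq> 0" using \<open>\<And>k. z + of_nat k \<noteq> 0\<close> by (auto simp: pochhammer_prod)
    have "pochhammer z N = Gamma (z + of_nat N) / Gamma z" by (rule pochhammer_Gamma[OF z0])
    with p show "Gamma (z + of_real (real N)) * inverse (pochhammer z N) = Gamma z"
      by (simp add: divide_inverse)
  qed auto
qed

section \<open>Shifting the contour of the Mellin--Barnes integral\<close>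

text \<open>The bound exp x >= (1 + x/n)^n makes the exponential beat the polynomial, with explicit
  constants.\<close>

lemma growth_on_decay:
  assumes "growth_on S \<kappa> f" "\<kappa> < 0"
  shows "\<exists>C\<ge>0. \<forall>z\<in>S. cmod (f z) \<le> C * inverse (1 + (Im z)\<^sup>2)"
proof -
  obtain C N where C: "C \<ge> 0" and f: "\<And>z. z \<in> S \<Longrightarrow> cmod (f z) \<le> C * (1 + \<bar>Im z\<bar>) ^ N * exp (\<kappa> * \<bar>Im z\<bar>)"
    using assms(1) unfolding growth_on_def by metis
  \<comment> \<open>Two powers beyond N pay for the factor 1 + t^2.\<close>
  define n where "n = N + 2"
  \<comment> \<open>Chosen so that 1 + t <= d (1 + (-\<kappa>) t / n) for t >= 0: d >= 1 handles the
    constant term and d (-\<kappa>) >= n the slope.\<close>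
  define d where "d = max 1 (real n / (- \<kappa>))"
  have n: "real n > 0" by (simp add: n_def)
  have d: "d \<ge> 1" "d * (- \<kappa>) \<ge> real n"
    using assms(2) by (auto simp: d_def max_def divide_simps split: if_splits)
  have key: "(1 + t) ^ N * exp (\<kappa> * t) \<le> d ^ n * inverse (1 + t\<^sup>2)" if "t \<ge> 0" for t
  proof -
    have "d * (1 + (- \<kappa> * t) / real n) \<ge> 1 + t"
    proof -
      have "t * real n \<le> t * (d * (- \<kappa>))" using d that by (intro mult_left_mono) auto
      then have "t \<le> d * (- \<kappa> * t) / real n" unfolding pos_le_divide_eq[OF n] by (simp add: mult_ac)
      moreover have "d * (1 + (- \<kappa> * t) / real n) = d + d * (- \<kappa> * t) / real n" by (simp only: distrib_left mult_1_right times_divide_eq_right)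
      ultimately show ?thesis using d by linarith
    qed
    then have "(1 + t) ^ n \<le> (d * (1 + (- \<kappa> * t) / real n)) ^ n" using that by (intro power_mono) auto
    also have "\<dots> = d ^ n * (1 + (- \<kappa> * t) / real n) ^ n" by (rule power_mult_distrib)
    also have "\<dots> \<le> d ^ n * exp (- \<kappa> * t)"
    proof (intro mult_left_mono exp_ge_one_plus_x_over_n_power_n)
      have "0 \<le> - \<kappa> * t" using that assms(2) by (simp add: mult_nonpos_nonneg)
      then show "- real n \<le> - \<kappa> * t" using n by linarith
    qed (use n d in auto)
    finally have 1: "(1 + t) ^ n * exp (\<kappa> * t) \<le> d ^ n"
      by (simp add: exp_minus field_simps)
    have "(1 + t\<^sup>2) * ((1 + t) ^ N * exp (\<kappa> * t)) \<le> (1 + t)\<^sup>2 * ((1 + t) ^ N * exp (\<kappa> * t))"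
      using that by (intro mult_right_mono) (auto simp: power2_eq_square algebra_simps)
    also have "\<dots> = (1 + t) ^ n * exp (\<kappa> * t)" by (simp add: n_def power_add power2_eq_square)
    also note 1
    finally have "(1 + t\<^sup>2) * ((1 + t) ^ N * exp (\<kappa> * t)) \<le> d ^ n" .
    moreover have "1 + t\<^sup>2 > 0" by (simp add: add_pos_nonneg)
    ultimately show ?thesis by (simp add: field_simps)
  qed
  show ?thesis
  proof (intro exI[of _ "C * d ^ n"] conjI ballI)
    fix z assume "z \<in> S"
    then have "cmod (f z) \<le> C * ((1 + \<bar>Im z\<bar>) ^ N * exp (\<kappa> * \<bar>Im z\<bar>))" using f by (simp add: mult.assoc)
    also have "\<dots> \<le> C * (d ^ n * inverse (1 + \<bar>Im z\<bar>\<^sup>2))" using C by (intro mult_left_mono key) auto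
    finally show "cmod (f z) \<le> C * d ^ n * inverse (1 + (Im z)\<^sup>2)" by simp
  qed (use C d in auto)
qed

lemma integrable_lborel_inverse_1_plus_square: "integrable lborel (\<lambda>x::real. inverse (1 + x\<^sup>2))"
  using integrable_inverse_1_plus_square unfolding set_integrable_def by simp

text \<open>Decay is assumed only for |y| >= 1, because the contour shift bounds its integrand only
  there; the middle piece is bounded by continuity.\<close>

lemma integrable_of_decay:
  fixes f :: "real \<Rightarrow> complex"
  assumes "continuous_on UNIV f" and "\<And>y. \<bar>y\<bar> \<ge> 1 \<Longrightarrow> cmod (f y) \<le> C * inverse (1 + y\<^sup>2)"
  shows "integrable lborel f"
proof -
  have "compact (f ` {-1..1})"
    by (intro compact_continuous_image continuous_on_subset[OF assms(1)]) auto
  from compact_imp_bounded[OF this] obtain D where D': "\<forall>z\<in>f ` {-1..1}. cmod z \<le> D"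
    unfolding bounded_iff by blast
  have D: "cmod (f y) \<le> D" if "\<bar>y\<bar> \<le> 1" for y
  proof -
    have "y \<in> {-1..1}" using that unfolding atLeastAtMost_iff by linarith
    with D' show ?thesis by blast
  qed
  \<comment> \<open>The factor 2 compensates for inverse (1 + y^2) >= 1/2 on |y| <= 1.\<close>
  define E where "E = \<bar>C\<bar> + 2 * \<bar>D\<bar>"
  have "cmod (f y) \<le> E * inverse (1 + y\<^sup>2)" for y
  proof (cases "\<bar>y\<bar> \<ge> 1")
    case True
    have "cmod (f y) \<le> C * inverse (1 + y\<^sup>2)" by (rule assms(2)[OF True])
    also have "\<dots> \<le> E * inverse (1 + y\<^sup>2)" by (rule mult_right_mono) (simp_all add: E_def)
    finally show ?thesis .
  next
    case False
    then have y: "y\<^sup>2 \<le> 1" by (simp add: abs_square_le_1)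
    have p: "0 < 1 + y\<^sup>2" by (simp add: add_pos_nonneg)
    have "cmod (f y) \<le> D" using D[of y] False by linarith
    also have "D \<le> 2 * \<bar>D\<bar> * inverse (1 + 1)" by simp
    also have "2 * \<bar>D\<bar> * inverse (1 + 1) \<le> E * inverse (1 + y\<^sup>2)"
    proof (rule mult_mono)
      show "inverse (1 + 1) \<le> inverse (1 + y\<^sup>2)" using y p by (intro le_imp_inverse_le) auto
    qed (simp_all add: E_def)
    finally show ?thesis .
  qed
  then have bd: "norm (f y) \<le> norm (E * inverse (1 + y\<^sup>2))" for y
    using abs_ge_self[of "E * inverse (1 + y\<^sup>2)"] order_trans unfolding real_norm_def by blast
  show ?thesis
  proof (rule Bochner_Integration.integrable_bound)
    show "integrable lborel (\<lambda>y. E * inverse (1 + y\<^sup>2))"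
      by (intro integrable_mult_right integrable_lborel_inverse_1_plus_square)
    show "f \<in> borel_measurable lborel"
      using borel_measurable_continuous_onI[OF assms(1)] by simp
  qed (use bd in simp)
qed

lemma tendsto_integral_symmetric:
  fixes f :: "real \<Rightarrow> complex"
  assumes "integrable lborel f"
  shows "(\<lambda>n. LINT y:{- real n..real n}|lborel. f y) \<longlonglongrightarrow> (LINT y|lborel. f y)"
  unfolding set_lebesgue_integral_def
proof (rule integral_dominated_convergence)
  show "AE x in lborel. (\<lambda>n. indicat_real {- real n..real n} x *\<^sub>R f x) \<longlonglongrightarrow> f x"
  proof (rule AE_I2)
    fix x :: real
    obtain N :: nat where N: "\<bar>x\<bar> \<le> real N" using real_arch_simple by blast
    have "\<forall>\<^sub>F n in sequentially. indicat_real {- real n..real n} x *\<^sub>R f x = f x"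
      using eventually_ge_at_top[of N] by eventually_elim (use N in \<open>auto simp: indicator_def\<close>)
    then show "(\<lambda>n. indicat_real {- real n..real n} x *\<^sub>R f x) \<longlonglongrightarrow> f x" by (rule tendsto_eventually)
  qed
  show "AE x in lborel. norm (indicat_real {- real n..real n} x *\<^sub>R f x) \<le> norm (f x)" for n
    by (auto simp: indicator_def)
qed (use assms in auto)

text \<open>Residue theorem on the rectangles with corners l - in and r + in. For n >= 1 they
  enclose all of \<open>pts\<close>, and the integral over the horizontal sides tends to 0.\<close>

lemma line_integral_shift:
  assumes lr: "l < r" and S: "open S" "convex S" and pts: "finite pts" and holo: "f holomorphic_on S - pts"
    and strip: "\<And>z. l \<le> Re z \<Longrightarrow> Re z \<le> r \<Longrightarrow> z \<in> S"
    and inside: "\<And>p. p \<in> pts \<Longrightarrow> l < Re p \<and> Re p < r \<and> \<bar>Im p\<bar> < 1"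
    and decay: "\<And>z. l \<le> Re z \<Longrightarrow> Re z \<le> r \<Longrightarrow> \<bar>Im z\<bar> \<ge> 1 \<Longrightarrow> cmod (f z) \<le> C * inverse (1 + (Im z)\<^sup>2)"
  shows "line_integral r f - line_integral l f = 2 * of_real pi * \<i> * (\<Sum>p\<in>pts. residue f p)"
proof -
  have cont: "continuous_on (S - pts) f" by (rule holomorphic_on_imp_continuous_on[OF holo])
  define U where "U = S - pts"
  have ok: "z \<in> U" if "l \<le> Re z" "Re z \<le> r" "Re z = l \<or> Re z = r \<or> \<bar>Im z\<bar> \<ge> 1" for z
    using strip[OF that(1,2)] inside[of z] that(3) by (auto simp: U_def)
  have contv: "continuous_on UNIV (\<lambda>y. f (Complex x y))" if "x = l \<or> x = r" for x
  proof (rule continuous_on_compose2[OF cont])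
    show "continuous_on UNIV (Complex x)" 
    proof -
      have "continuous_on UNIV (\<lambda>y. of_real x + \<i> * of_real y)" by (intro continuous_intros)
      then show ?thesis by (rule continuous_on_eq) (simp add: complex_eq_iff)
    qed
    have "Complex x y \<in> S - pts" for y
      using ok[of "Complex x y"] that lr by (auto simp: U_def)
    then show "range (Complex x) \<subseteq> S - pts" by auto
  qed
  have int: "integrable lborel (\<lambda>y. f (Complex x y))" if "x = l \<or> x = r" for x
  proof (rule integrable_of_decay[OF contv[OF that]])
    fix y :: real assume "\<bar>y\<bar> \<ge> 1"
    have "l \<le> x" "x \<le> r" using that lr by auto
    then show "cmod (f (Complex x y)) \<le> C * inverse (1 + y\<^sup>2)"
      using decay[of "Complex x y"] \<open>\<bar>y\<bar> \<ge> 1\<close> by (simp del: inverse_eq_divide)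
  qed
  define V where "V x n = (LINT y:{- real n..real n}|lborel. f (Complex x y))" for x n
  have Vlim: "V x \<longlonglongrightarrow> (LINT y|lborel. f (Complex x y))" if "x = l \<or> x = r" for x
    unfolding V_def by (rule tendsto_integral_symmetric[OF int[OF that]])
  \<comment> \<open>By the residue theorem \<open>E n\<close> is the contribution of the two
    horizontal sides, at heights -n and n, which is O(1/n^2).\<close>
  define E where "E n = 2 * of_real pi * \<i> * (\<Sum>p\<in>pts. residue f p) - \<i> * (V r n - V l n)" for n
  have bound: "cmod (E n) \<le> 2 * (\<bar>C\<bar> * inverse (1 + (real n)\<^sup>2) * (r - l))" if n: "n \<ge> 1" for n
  proof -
    define a1 a2 a3 a4 where "a1 = Complex l (- real n)" and "a2 = Complex r (- real n)"
      and "a3 = Complex r (real n)" and "a4 = Complex l (real n)"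
    have sub: "closed_segment a1 a2 \<subseteq> U" "closed_segment a2 a3 \<subseteq> U"
      "closed_segment a3 a4 \<subseteq> U" "closed_segment a4 a1 \<subseteq> U"
      using n lr by (auto simp: a1_def a2_def a3_def a4_def closed_segment_same_Re closed_segment_same_Im
        closed_segment_eq_real_ivl intro!: ok)
    have contU: "continuous_on U f" using cont by (simp add: U_def)
    from sub have ci: "f contour_integrable_on linepath a1 a2" "f contour_integrable_on linepath a2 a3"
      "f contour_integrable_on linepath a3 a4" "f contour_integrable_on linepath a4 a1"
      by (auto intro!: contour_integrable_continuous_linepath continuous_on_subset[OF contU])
    have wn: "winding_number (rectpath a1 a3) p = 1" if "p \<in> pts" for p
      by (rule winding_number_rectpath) (use inside[OF that] n in \<open>auto simp: a1_def a3_def in_box_complex_iff\<close>)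
    have "contour_integral (rectpath a1 a3) f = 2 * pi * \<i> * (\<Sum>p\<in>pts. winding_number (rectpath a1 a3) p * residue f p)"
    proof (rule Residue_theorem[OF S(1) convex_connected[OF S(2)] pts holo])
      have "path_image (rectpath a1 a3) \<subseteq> U"
        using n lr by (subst path_image_rectpath) (auto simp: a1_def a3_def intro!: ok)
      then show pi: "path_image (rectpath a1 a3) \<subseteq> S - pts" by (simp add: U_def)
      show "\<forall>z. z \<notin> S \<longrightarrow> winding_number (rectpath a1 a3) z = 0"
        using pi by (intro allI impI winding_number_zero_outside[OF _ S(2)]) auto
    qed auto
    also have "\<dots> = 2 * of_real pi * \<i> * (\<Sum>p\<in>pts. residue f p)" using wn by simp
    finally have res: "contour_integral (rectpath a1 a3) f = \<dots>" .
    have "contour_integral (rectpath a1 a3) f = contour_integral (linepath a1 a2) f + contour_integral (linepath a2 a3) f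
      + contour_integral (linepath a3 a4) f + contour_integral (linepath a4 a1) f"
    proof -
      have *: "rectpath a1 a3 = linepath a1 a2 +++ linepath a2 a3 +++ linepath a3 a4 +++ linepath a4 a1"
        by (simp add: rectpath_def Let_def a1_def a2_def a3_def a4_def)
      show ?thesis unfolding * using ci
        by (simp add: contour_integrable_joinI valid_path_join)
    qed
    moreover have "contour_integral (linepath a2 a3) f = \<i> * V r n"
    proof -
      have "set_integrable lborel {- real n..real n} (\<lambda>y. f (Complex r y))"
        using integrable_mult_indicator[OF _ int[of r]] unfolding set_integrable_def by auto
      from set_borel_integral_eq_integral(2)[OF this] show ?thesis unfolding V_def
        by (subst contour_integral_linepath_same_Re[of _ r _ "- real n" "real n"]) (use n in \<open>auto simp: a2_def a3_def\<close>)
    qed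
    moreover have "contour_integral (linepath a4 a1) f = - (\<i> * V l n)"
    proof -
      have "set_integrable lborel {- real n..real n} (\<lambda>y. f (Complex l y))"
        using integrable_mult_indicator[OF _ int[of l]] unfolding set_integrable_def by auto
      from set_borel_integral_eq_integral(2)[OF this] have "contour_integral (linepath a1 a4) f = \<i> * V l n" unfolding V_def
        by (subst contour_integral_linepath_same_Re[of _ l _ "- real n" "real n"]) (use n in \<open>auto simp: a1_def a4_def\<close>)
      moreover have "contour_integral (linepath a4 a1) f = - contour_integral (linepath a1 a4) f"
        using contour_integral_reversepath[of "linepath a1 a4" f] by simp
      ultimately show ?thesis by simp
    qed
    ultimately have En: "E n = contour_integral (linepath a1 a2) f + contour_integral (linepath a3 a4) f"
      unfolding E_def res[symmetric] by (simp add: right_diff_distrib)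
    have b1: "cmod (contour_integral (linepath a1 a2) f) \<le> \<bar>C\<bar> * inverse (1 + (real n)\<^sup>2) * cmod (a2 - a1)"
    proof (rule contour_integral_bound_linepath[OF ci(1)])
      fix z assume "z \<in> closed_segment a1 a2"
      then have "l \<le> Re z" "Re z \<le> r" "Im z = - real n" using lr
        by (auto simp: a1_def a2_def closed_segment_same_Im closed_segment_eq_real_ivl)
      then have "cmod (f z) \<le> C * inverse (1 + (real n)\<^sup>2)" using decay[of z] n by simp
      also have "\<dots> \<le> \<bar>C\<bar> * inverse (1 + (real n)\<^sup>2)" by (intro mult_right_mono) auto
      finally show "cmod (f z) \<le> \<bar>C\<bar> * inverse (1 + (real n)\<^sup>2)" .
    qed auto
    have b3: "cmod (contour_integral (linepath a3 a4) f) \<le> \<bar>C\<bar> * inverse (1 + (real n)\<^sup>2) * cmod (a4 - a3)"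
    proof (rule contour_integral_bound_linepath[OF ci(3)])
      fix z assume "z \<in> closed_segment a3 a4"
      then have "l \<le> Re z" "Re z \<le> r" "Im z = real n" using lr
        by (auto simp: a3_def a4_def closed_segment_same_Im closed_segment_eq_real_ivl)
      then have "cmod (f z) \<le> C * inverse (1 + (real n)\<^sup>2)" using decay[of z] n by simp
      also have "\<dots> \<le> \<bar>C\<bar> * inverse (1 + (real n)\<^sup>2)" by (intro mult_right_mono) auto
      finally show "cmod (f z) \<le> \<bar>C\<bar> * inverse (1 + (real n)\<^sup>2)" .
    qed auto
    have "a2 - a1 = of_real (r - l)" "a4 - a3 = - of_real (r - l)"
      by (auto simp: a1_def a2_def a3_def a4_def complex_eq_iff)
    then have d: "cmod (a2 - a1) = r - l" "cmod (a4 - a3) = r - l"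
      using lr by (simp_all only: norm_minus_cancel norm_of_real abs_of_pos diff_gt_0_iff_gt)
    have "cmod (E n) \<le> cmod (contour_integral (linepath a1 a2) f) + cmod (contour_integral (linepath a3 a4) f)"
      unfolding En by (rule norm_triangle_ineq)
    also have "\<dots> \<le> \<bar>C\<bar> * inverse (1 + (real n)\<^sup>2) * (r - l) + \<bar>C\<bar> * inverse (1 + (real n)\<^sup>2) * (r - l)"
      using b1 b3 unfolding d by (rule add_mono)
    finally show ?thesis by (simp only: mult_2)
  qed
  have "(\<lambda>n. inverse (1 + (real n)\<^sup>2)) \<longlonglongrightarrow> 0" by real_asymp
  then have "(\<lambda>n. 2 * (\<bar>C\<bar> * inverse (1 + (real n)\<^sup>2) * (r - l))) \<longlonglongrightarrow> 2 * (\<bar>C\<bar> * 0 * (r - l))"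
    by (intro tendsto_intros)
  then have "(\<lambda>n. 2 * (\<bar>C\<bar> * inverse (1 + (real n)\<^sup>2) * (r - l))) \<longlonglongrightarrow> 0" by simp
  then have "E \<longlonglongrightarrow> 0"
    by (rule Lim_null_comparison[rotated]) (use bound in \<open>auto intro!: eventually_sequentiallyI[of 1]\<close>)
  moreover have "E \<longlonglongrightarrow> 2 * of_real pi * \<i> * (\<Sum>p\<in>pts. residue f p)
      - \<i> * ((LINT y|lborel. f (Complex r y)) - (LINT y|lborel. f (Complex l y)))"
    unfolding E_def by (intro tendsto_intros Vlim) auto
  ultimately have "2 * of_real pi * \<i> * (\<Sum>p\<in>pts. residue f p)
      - \<i> * ((LINT y|lborel. f (Complex r y)) - (LINT y|lborel. f (Complex l y))) = 0"
    using LIMSEQ_unique by blast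
  moreover have "line_integral x f = \<i> * (LINT y|lborel. f (Complex x y))" for x
    unfolding line_integral_def by (simp add: mult.commute)
  ultimately show ?thesis by (simp add: algebra_simps)
qed

text \<open>Replaces the denominators by entire functions. The identity also holds where a
  denominator factor has a pole, since there Gamma is 0 by convention, its inverse is again 0, and
  rGamma vanishes.\<close>

lemma gamma_quot_rGamma:
  "gamma_quot m p a \<alpha> b \<beta> s =
     (\<Prod>j=1..m. Gamma (of_real (b j) + of_real (\<beta> j) * s)) * (\<Prod>i=1..p. rGamma (of_real (a i) + of_real (\<alpha> i) * s))"
  unfolding gamma_quot_def rGamma_inverse_Gamma by (simp only: divide_inverse prod_inversef[symmetric] o_def)

lemma norm_of_real_powr: "x > 0 \<Longrightarrow> cmod (of_real x powr s) = x powr Re s"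
  by (simp add: norm_powr_real_powr)

text \<open>On the line Re u = l the factor x^(-u) has constant modulus x^(-l), so the abscissa of
  the contour becomes the order in x.\<close>

lemma line_integral_powr_bound:
  assumes "x > 0"
  shows "cmod (line_integral l (\<lambda>u. f u * of_real x powr (- u))) \<le> (LINT y|lborel. cmod (f (Complex l y))) * x powr (- l)"
proof -
  have "cmod (line_integral l (\<lambda>u. f u * of_real x powr (- u))) \<le>
      (LINT y|lborel. cmod (f (Complex l y) * of_real x powr (- Complex l y) * \<i>))"
    unfolding line_integral_def by (rule integral_norm_bound)
  also have "\<dots> = (LINT y|lborel. cmod (f (Complex l y)) * x powr (- l))"
    using assms by (intro Bochner_Integration.integral_cong) (simp_all add: norm_mult norm_of_real_powr)
  finally show ?thesis by simp
qed

text \<open>For c > 0 this makes the Wright function vanish at minus infinity, which later shows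
  that the radial variable is not almost surely 0.\<close>

lemma gen_wright_bound:
  "\<exists>D. \<forall>x>0. cmod (gen_wright m p a \<alpha> b \<beta> c (- x)) \<le> D * x powr (- c)"
proof (intro exI allI impI)
  let ?F = "\<lambda>u. Gamma u * gamma_quot m p a \<alpha> b \<beta> (1 - u)"
  fix x :: real assume x: "x > 0"
  have "cmod (gen_wright m p a \<alpha> b \<beta> c (- x)) = 1 / (2 * pi) * cmod (line_integral c (\<lambda>u. ?F u * of_real x powr (- u)))"
    using x by (simp add: gen_wright_def norm_mult norm_divide)
  also have "\<dots> \<le> 1 / (2 * pi) * ((LINT y|lborel. cmod (?F (Complex c y))) * x powr (- c))"
    by (intro mult_left_mono line_integral_powr_bound x) auto
  finally show "cmod (gen_wright m p a \<alpha> b \<beta> c (- x)) \<le> (1 / (2 * pi) * (LINT y|lborel. cmod (?F (Complex c y)))) * x powr (- c)"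
    by simp
qed

text \<open>Moving the contour to the left across the poles \<open>0, -1, \<dots>, -n\<close> of \<open>\<Gamma>\<close>.\<close>
lemma gen_wright_expansion:
  fixes m p :: nat and a \<alpha> b \<beta> :: "nat \<Rightarrow> real" and c :: real
  assumes A: "\<And>i. i \<in> {1..p} \<Longrightarrow> \<alpha> i > 0"
    and B: "\<And>j. j \<in> {1..m} \<Longrightarrow> \<beta> j > 0"
    and le: "(\<Sum>i=1..p. \<alpha> i) \<le> (\<Sum>j=1..m. \<beta> j)"
    and c: "c > 0" "\<And>j. j \<in> {1..m} \<Longrightarrow> c < (b j + \<beta> j) / \<beta> j"
  shows "\<exists>q D. \<forall>x>0. cmod (gen_wright m p a \<alpha> b \<beta> c (- x) - (\<Sum>k\<le>n. q k * of_real x ^ k)) \<le> D * x powr (real n + 1/2)"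
proof -
  define Q where "Q u = gamma_quot m p a \<alpha> b \<beta> (1 - u)" for u
  define F where "F u = Gamma u * Q u" for u
  \<comment> \<open>Halfway between the poles -n and -(n+1): the new contour keeps distance at least
    1/2 from every pole, and the remainder has order x^(n + 1/2).\<close>
  define l where "l = - (real n + 1/2)"
  define R where "R = \<bar>l\<bar> + \<bar>c\<bar>"
  \<comment> \<open>A convex open neighbourhood of the closed strip. The left bound keeps out the
    pole -(n+1); the right bounds keep out the poles of the numerator factors Gamma(b_j + \<beta>_j
    (1-u)).\<close>
  define S where "S = {u. Re u > - real n - 1} \<inter> (\<Inter>j\<in>{1..m}. {u. Re u < (b j + \<beta> j) / \<beta> j})"
  define pts where "pts = (\<lambda>k. - of_nat k :: complex) ` {..n}"
  have l0: "l < 0" by (simp add: l_def)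
  have num: "Re (of_real (b j) + of_real (\<beta> j) * (1 - u)) > 0" if "j \<in> {1..m}" "Re u < (b j + \<beta> j) / \<beta> j" for j u
    using that(2) B[OF that(1)] by (simp add: pos_less_divide_eq algebra_simps)
  have S: "open S" "convex S"
    unfolding S_def by (auto intro!: open_Int open_INT open_halfspace_Re_gt open_halfspace_Re_lt convex_Int convex_INT
      convex_halfspace_Re_gt convex_halfspace_Re_lt)
  have strip: "z \<in> S" if "l \<le> Re z" "Re z \<le> c" for z
    using that c(2) by (force simp: S_def l_def)
  have Qholo: "Q holomorphic_on S"
    unfolding Q_def gamma_quot_rGamma
  proof (intro holomorphic_on_mult holomorphic_on_prod)
    fix j assume j: "j \<in> {1..m}"
    have "of_real (b j) + of_real (\<beta> j) * (1 - u) \<notin> \<int>\<^sub>\<le>\<^sub>0" if "u \<in> S" for u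
    proof -
      have "Re u < (b j + \<beta> j) / \<beta> j" using that j by (simp add: S_def)
      from num[OF j this] show ?thesis by (rule Re_pos_not_nonpos_Ints)
    qed
    then show "(\<lambda>u. Gamma (of_real (b j) + of_real (\<beta> j) * (1 - u))) holomorphic_on S"
      by (intro holomorphic_intros) auto
  qed (intro holomorphic_intros)
  have Xholo: "(\<lambda>u. of_real x powr (- u)) holomorphic_on U" if "x > 0" for x and U :: "complex set"
    using that by (intro holomorphic_intros) auto
  have nonpole: "u \<notin> \<int>\<^sub>\<le>\<^sub>0" if "u \<in> S - pts" for u
  proof
    assume "u \<in> \<int>\<^sub>\<le>\<^sub>0"
    then obtain k where k: "u = - of_nat k" by (auto elim!: nonpos_Ints_cases')
    moreover have "k \<le> n" using that k by (simp add: S_def)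
    ultimately show False using that by (auto simp: pts_def)
  qed
  have growth: "growth_on {z. l \<le> Re z \<and> Re z \<le> c \<and> (\<forall>k. 1/2 \<le> cmod (z + of_nat k))}
     (- pi / 2 + ((\<Sum>j=1..m. \<beta> j * (- pi / 2)) + (\<Sum>i=1..p. \<alpha> i * (pi / 2)))) F" (is "growth_on ?T _ _")
    unfolding F_def Q_def gamma_quot_rGamma
  proof (intro growth_on_mult growth_on_prod)
    show "growth_on ?T (- pi / 2) Gamma"
      by (rule growth_on_subset[OF growth_on_Gamma_away_poles[of R]]) (auto simp: R_def)
    fix j assume j: "j \<in> {1..m}"
    show "growth_on ?T (\<beta> j * (- pi / 2)) (\<lambda>z. Gamma (of_real (b j) + of_real (\<beta> j) * (1 - z)))"
    proof (rule growth_on_affine[OF growth_on_Gamma])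
      show "b j + \<beta> j * (1 - c) > 0" using num[OF j, of "of_real c"] c(2)[OF j] by simp
      show "of_real (b j) + of_real (\<beta> j) * (1 - z) \<in> {z. b j + \<beta> j * (1 - c) \<le> Re z \<and> Re z \<le> b j + \<beta> j * (1 - l)}" if "z \<in> ?T" for z
        using that B[OF j] by (auto intro!: mult_left_mono)
    qed (use B[OF j] in auto)
  next
    fix i assume i: "i \<in> {1..p}"
    show "growth_on ?T (\<alpha> i * (pi / 2)) (\<lambda>z. rGamma (of_real (a i) + of_real (\<alpha> i) * (1 - z)))"
    proof (rule growth_on_affine[OF growth_on_rGamma])
      fix z assume z: "z \<in> ?T"
      have "\<bar>a i + \<alpha> i * (1 - Re z)\<bar> \<le> \<bar>a i\<bar> + \<alpha> i * \<bar>1 - Re z\<bar>"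
        using A[OF i] abs_triangle_ineq[of "a i" "\<alpha> i * (1 - Re z)"] by (simp add: abs_mult)
      also have "\<dots> \<le> \<bar>a i\<bar> + \<alpha> i * (1 + R)"
        using A[OF i] z by (intro add_left_mono mult_left_mono) (auto simp: R_def)
      finally show "of_real (a i) + of_real (\<alpha> i) * (1 - z) \<in> {z. \<bar>Re z\<bar> \<le> \<bar>a i\<bar> + \<alpha> i * (1 + R)}" by simp
    qed (use A[OF i] in auto)
  qed auto
  \<comment> \<open>The rate is -(1 + A) pi/2, where A >= 0 is the difference of the two sums in
    \<open>le\<close>; the summand 1 is due to Gamma(u).\<close>
  have neg: "- pi / 2 + ((\<Sum>j=1..m. \<beta> j * (- pi / 2)) + (\<Sum>i=1..p. \<alpha> i * (pi / 2))) < 0"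
  proof -
    have "(\<Sum>j=1..m. \<beta> j * (- pi / 2)) + (\<Sum>i=1..p. \<alpha> i * (pi / 2)) = ((\<Sum>i=1..p. \<alpha> i) - (\<Sum>j=1..m. \<beta> j)) * (pi / 2)"
      by (simp add: sum_distrib_right left_diff_distrib sum_negf)
    also have "\<dots> \<le> 0" using le by (intro mult_nonpos_nonneg) auto
    finally show ?thesis using pi_gt_zero by linarith
  qed
  obtain C where "C \<ge> 0" and C: "\<And>z. z \<in> ?T \<Longrightarrow> cmod (F z) \<le> C * inverse (1 + (Im z)\<^sup>2)"
    using growth_on_decay[OF growth neg] by blast
  \<comment> \<open>(-1)^k / k! is the residue of Gamma at -k, so \<open>q k * of_real x ^ k\<close>
    is the k-th term of the Wright series at -x.\<close>
  define q where "q k = (-1) ^ k / fact k * Q (- of_nat k)" for k :: nat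
  have shift: "line_integral c (\<lambda>u. F u * of_real x powr (- u)) - line_integral l (\<lambda>u. F u * of_real x powr (- u))
      = 2 * of_real pi * \<i> * (\<Sum>k\<le>n. q k * of_real x ^ k)" if x: "x > 0" for x
  proof -
    let ?f = "\<lambda>u. F u * of_real x powr (- u)"
    have holo: "?f holomorphic_on S - pts"
      unfolding F_def using nonpole
      by (intro holomorphic_on_mult Xholo x holomorphic_Gamma holomorphic_on_subset[OF Qholo]) auto
    have "line_integral c ?f - line_integral l ?f = 2 * of_real pi * \<i> * (\<Sum>z\<in>pts. residue ?f z)"
    proof (rule line_integral_shift[OF _ S _ holo strip])
      define D where "D = max (x powr - l) (x powr - c)"
      show "cmod (?f z) \<le> (C * D) * inverse (1 + (Im z)\<^sup>2)" if z: "l \<le> Re z" "Re z \<le> c" "\<bar>Im z\<bar> \<ge> 1" for z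
      proof -
        \<comment> \<open>The poles are real, so |Im z| >= 1 already keeps z away from them.\<close>
        have "1/2 \<le> cmod (z + of_nat k)" for k
          using abs_Im_le_cmod[of "z + of_nat k"] z(3) by simp
        then have T: "z \<in> ?T" using z by auto
        have "x powr - Re z \<le> D"
        proof (cases "x \<ge> 1")
          case True
          then have "x powr - Re z \<le> x powr - l" using z by (intro powr_mono) auto
          then show ?thesis by (simp add: D_def)
        next
          case False
          then have "x powr - Re z \<le> x powr - c" using z x by (intro powr_mono') auto
          then show ?thesis by (simp add: D_def)
        qed
        then have "cmod (?f z) \<le> (C * inverse (1 + (Im z)\<^sup>2)) * D"
          unfolding norm_mult using x C[OF T] \<open>C \<ge> 0\<close> by (intro mult_mono) (auto simp: norm_of_real_powr)
        then show ?thesis by (simp add: mult_ac)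
      qed
      show "l < Re z \<and> Re z < c \<and> \<bar>Im z\<bar> < 1" if "z \<in> pts" for z
        using that c(1) by (auto simp: pts_def l_def)
    qed (use l0 c(1) in \<open>auto simp: pts_def\<close>)
    also have "(\<Sum>z\<in>pts. residue ?f z) = (\<Sum>k\<le>n. residue ?f (- of_nat k))"
      unfolding pts_def by (subst sum.reindex) (auto simp: inj_on_def)
    also have "\<dots> = (\<Sum>k\<le>n. q k * of_real x ^ k)"
    proof (intro sum.cong refl)
      fix k assume "k \<in> {..n}"
      then have k: "k \<le> n" by simp
      have inS: "- of_nat k \<in> S" by (rule strip) (use k c(1) in \<open>auto simp: l_def\<close>)
      show "residue ?f (- of_nat k) = q k * of_real x ^ k"
      proof (rule residue_simple')
        show "open (S - (pts - {- of_nat k}))" by (intro open_Diff S finite_imp_closed) (auto simp: pts_def)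
        show "- of_nat k \<in> S - (pts - {- of_nat k})" using inS by auto
        show "?f holomorphic_on S - (pts - {- of_nat k}) - {- of_nat k}"
          by (rule holomorphic_on_subset[OF holo]) auto
        have "isCont Q (- of_nat k)" "isCont (\<lambda>u. complex_of_real x powr (- u)) (- of_nat k)"
          using Qholo Xholo[OF x, of S] inS S(1)
          by (auto dest!: holomorphic_on_imp_continuous_on simp: continuous_on_eq_continuous_at)
        then have "((\<lambda>u. Gamma u * (u - (- of_nat k)) * (Q u * of_real x powr (- u))) \<longlongrightarrow>
            (-1) ^ k / fact k * (Q (- of_nat k) * of_real x powr (- (- of_nat k)))) (at (- of_nat k))"
          using Gamma_residues[of k, where 'a = complex] unfolding isCont_def by (intro tendsto_mult) (auto simp: mult.commute)
        then show "((\<lambda>u. ?f u * (u - (- of_nat k))) \<longlongrightarrow> q k * of_real x ^ k) (at (- of_nat k))"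
          using x by (simp add: F_def q_def mult_ac powr_nat' flip: of_nat_power)
      qed
    qed
    finally show ?thesis .
  qed
  define D where "D = 1 / (2 * pi) * (LINT y|lborel. cmod (F (Complex l y)))"
  show ?thesis
  proof (intro exI[of _ q] exI[of _ D] allI impI)
    fix x :: real assume x: "x > 0"
    have "gen_wright m p a \<alpha> b \<beta> c (- x) = 1 / (2 * of_real pi * \<i>) * line_integral c (\<lambda>u. F u * of_real x powr (- u))"
      using x by (simp add: gen_wright_def F_def Q_def)
    also have "line_integral c (\<lambda>u. F u * of_real x powr (- u)) = 2 * of_real pi * \<i> * (\<Sum>k\<le>n. q k * of_real x ^ k) + line_integral l (\<lambda>u. F u * of_real x powr (- u))"
      using shift[OF x] by (simp add: algebra_simps)
    finally have "gen_wright m p a \<alpha> b \<beta> c (- x) - (\<Sum>k\<le>n. q k * of_real x ^ k) = 1 / (2 * of_real pi * \<i>) * line_integral l (\<lambda>u. F u * of_real x powr (- u))"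
      by (simp add: distrib_left)
    then have "cmod (gen_wright m p a \<alpha> b \<beta> c (- x) - (\<Sum>k\<le>n. q k * of_real x ^ k)) = 1 / (2 * pi) * cmod (line_integral l (\<lambda>u. F u * of_real x powr (- u)))"
      by (simp add: norm_mult norm_divide)
    also have "\<dots> \<le> 1 / (2 * pi) * ((LINT y|lborel. cmod (F (Complex l y))) * x powr (- l))"
      by (intro mult_left_mono line_integral_powr_bound x) auto
    also have "\<dots> = D * x powr (real n + 1/2)" by (simp add: D_def l_def add.commute)
    finally show "cmod (gen_wright m p a \<alpha> b \<beta> c (- x) - (\<Sum>k\<le>n. q k * of_real x ^ k)) \<le> D * x powr (real n + 1/2)" .
  qed
qed

section \<open>Even moments from the characteristic function\<close>

text \<open>The negative of the usual central second difference; with this sign, applying it to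
  cos(x z) produces the non-negative factor 2 - 2 cos(u z).\<close>

definition second_diff :: "real \<Rightarrow> (real \<Rightarrow> real) \<Rightarrow> real \<Rightarrow> real" where
  "second_diff u g x = 2 * g x - g (x + u) - g (x - u)"

lemma second_diff_funpow_minus:
  "(second_diff u ^^ n) (\<lambda>x. g x - h x) x = (second_diff u ^^ n) g x - (second_diff u ^^ n) h x"
  by (induction n arbitrary: x) (simp_all add: second_diff_def)

lemma second_diff_funpow_bound:
  assumes "\<And>y. \<bar>y - x\<bar> \<le> real n * u \<Longrightarrow> \<bar>g y\<bar> \<le> B" "u > 0"
  shows "\<bar>(second_diff u ^^ n) g x\<bar> \<le> 4 ^ n * B"
  using assms(1)
proof (induction n arbitrary: g B)
  case (Suc n)
  have "\<bar>second_diff u g y\<bar> \<le> 4 * B" if "\<bar>y - x\<bar> \<le> real n * u" for y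
  proof -
    have "\<bar>g y\<bar> \<le> B" "\<bar>g (y + u)\<bar> \<le> B" "\<bar>g (y - u)\<bar> \<le> B"
      using that \<open>u > 0\<close> by (intro Suc.prems; simp add: algebra_simps; linarith)+
    then show ?thesis unfolding second_diff_def by linarith
  qed
  then have "\<bar>(second_diff u ^^ n) (second_diff u g) x\<bar> \<le> 4 ^ n * (4 * B)" by (rule Suc.IH)
  then show ?case by (simp add: funpow_Suc_right del: funpow.simps)
qed simp

text \<open>The mean value theorem is applied to t -> h(x+t) + h(x-t) and then to h'. This gives 2
  \<xi> u |h''| with \<xi> < u, whence the (not sharp) constant 2.\<close>

lemma second_diff_bound:
  assumes h: "\<And>x. (h has_real_derivative h' x) (at x)" "\<And>x. (h' has_real_derivative h'' x) (at x)"
    and B: "\<And>y. \<bar>y - x\<bar> \<le> u \<Longrightarrow> \<bar>h'' y\<bar> \<le> B" and u: "u > 0"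
  shows "\<bar>second_diff u h x\<bar> \<le> 2 * u\<^sup>2 * B"
proof -
  have "((\<lambda>t. h (x + t) + h (x - t)) has_real_derivative (h' (x + t) - h' (x - t))) (at t)" for t
    by (auto intro!: derivative_eq_intros DERIV_chain2[OF h(1)])
  from MVT2[OF u this] obtain \<xi> where \<xi>: "0 < \<xi>" "\<xi> < u"
      "h (x + u) + h (x - u) - (h (x + 0) + h (x - 0)) = (u - 0) * (h' (x + \<xi>) - h' (x - \<xi>))"
    by blast
  have "x - \<xi> < x + \<xi>" using \<xi> by simp
  from MVT2[OF this h(2)] obtain \<eta> where \<eta>: "x - \<xi> < \<eta>" "\<eta> < x + \<xi>"
      "h' (x + \<xi>) - h' (x - \<xi>) = (x + \<xi> - (x - \<xi>)) * h'' \<eta>"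
    by blast
  have eq: "second_diff u h x = - (u * (2 * \<xi> * h'' \<eta>))"
    using \<xi>(3) \<eta>(3) by (simp add: second_diff_def)
  have "\<bar>h'' \<eta>\<bar> \<le> B" by (rule B) (use \<xi> \<eta> in auto)
  then have "u * (2 * \<xi> * \<bar>h'' \<eta>\<bar>) \<le> u * (2 * u * B)"
    using u \<xi> by (intro mult_left_mono mult_mono) auto
  then show ?thesis unfolding eq using u \<xi> by (simp add: abs_mult power2_eq_square mult_ac)
qed

text \<open>\<open>g i\<close> is the i-th derivative of \<open>g 0\<close>. The induction applies
  the difference to the whole family at once, since the differenced functions again form a chain of
  derivatives.\<close>

lemma second_diff_funpow_smooth_bound:
  assumes "\<And>i x. (g i has_real_derivative g (Suc i) x) (at x)"
    and "\<And>y. \<bar>y - x\<bar> \<le> real n * u \<Longrightarrow> \<bar>g (2 * n) y\<bar> \<le> B" and u: "u > 0"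
  shows "\<bar>(second_diff u ^^ n) (g 0) x\<bar> \<le> 2 ^ n * u ^ (2 * n) * B"
  using assms(1,2)
proof (induction n arbitrary: g B)
  case (Suc n)
  have "(second_diff u (g i) has_real_derivative second_diff u (g (Suc i)) x) (at x)" for i x
    unfolding second_diff_def[abs_def]
    by (auto intro!: derivative_eq_intros DERIV_chain2[OF Suc.prems(1)])
  moreover have "\<bar>second_diff u (g (2 * n)) y\<bar> \<le> 2 * u\<^sup>2 * B" if "\<bar>y - x\<bar> \<le> real n * u" for y
  proof (rule second_diff_bound[OF Suc.prems(1) Suc.prems(1) _ u])
    fix z assume "\<bar>z - y\<bar> \<le> u"
    then have "\<bar>z - x\<bar> \<le> real (Suc n) * u" using that by (simp add: algebra_simps)
    from Suc.prems(2)[OF this] show "\<bar>g (Suc (Suc (2 * n))) z\<bar> \<le> B" by simp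
  qed
  ultimately have "\<bar>(second_diff u ^^ n) (second_diff u (g 0)) x\<bar> \<le> 2 ^ n * u ^ (2 * n) * (2 * u\<^sup>2 * B)"
    by (rule Suc.IH)
  then show ?case by (simp add: funpow_Suc_right power2_eq_square mult_ac del: funpow.simps)
qed simp

context prob_space
begin

lemma integrable_bounded_fun:
  fixes f :: "'a \<Rightarrow> real"
  assumes "f \<in> borel_measurable M" "\<And>x. \<bar>f x\<bar> \<le> B"
  shows "integrable M f"
  by (rule integrable_const_bound[of _ B]) (use assms in auto)

text \<open>As a function of x, cos(x z) is an eigenfunction of the second difference with
  eigenvalue 2 - 2 cos(u z).\<close>

lemma second_diff_funpow_expectation_cos:
  assumes [measurable]: "Z \<in> borel_measurable M"
  shows "(second_diff u ^^ n) (\<lambda>x. expectation (\<lambda>\<omega>. cos (x * Z \<omega>))) x =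
    expectation (\<lambda>\<omega>. (2 - 2 * cos (u * Z \<omega>)) ^ n * cos (x * Z \<omega>))"
proof (induction n arbitrary: x)
  case (Suc n)
  have "\<bar>2 - 2 * cos y\<bar> \<le> 4" for y :: real using abs_cos_le_one[of y] by linarith
  then have "\<bar>(2 - 2 * cos y) ^ n * cos z\<bar> \<le> 4 ^ n * 1" for y z :: real
    unfolding abs_mult power_abs by (intro mult_mono power_mono) auto
  then have int: "integrable M (\<lambda>\<omega>. (2 - 2 * cos (u * Z \<omega>)) ^ n * cos (x * Z \<omega>))" for x
    by (intro integrable_bounded_fun[of _ "4 ^ n * 1"]) auto
  have "(second_diff u ^^ Suc n) (\<lambda>x. expectation (\<lambda>\<omega>. cos (x * Z \<omega>))) x =
     2 * expectation (\<lambda>\<omega>. (2 - 2 * cos (u * Z \<omega>)) ^ n * cos (x * Z \<omega>))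
     - expectation (\<lambda>\<omega>. (2 - 2 * cos (u * Z \<omega>)) ^ n * cos ((x + u) * Z \<omega>))
     - expectation (\<lambda>\<omega>. (2 - 2 * cos (u * Z \<omega>)) ^ n * cos ((x - u) * Z \<omega>))"
    by (simp add: second_diff_def Suc.IH)
  also have "\<dots> = expectation (\<lambda>\<omega>. 2 * ((2 - 2 * cos (u * Z \<omega>)) ^ n * cos (x * Z \<omega>))
     - (2 - 2 * cos (u * Z \<omega>)) ^ n * cos ((x + u) * Z \<omega>) - (2 - 2 * cos (u * Z \<omega>)) ^ n * cos ((x - u) * Z \<omega>))"
    using int by (subst Bochner_Integration.integral_diff Bochner_Integration.integral_diff[symmetric]; simp)+
  also have "\<dots> = expectation (\<lambda>\<omega>. (2 - 2 * cos (u * Z \<omega>)) ^ Suc n * cos (x * Z \<omega>))"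
    by (intro Bochner_Integration.integral_cong) (auto simp: algebra_simps cos_add cos_diff)
  finally show ?case .
qed simp

text \<open>Fatou's lemma applied to \<open>(2 - 2 cos (u Z))^n / u^(2n)\<close>, which tends to \<open>Z^(2n)\<close>.\<close>
lemma integrable_even_moment:
  fixes Z :: "'a \<Rightarrow> real" and q :: "nat \<Rightarrow> real" and D :: real
  assumes Z[measurable]: "Z \<in> borel_measurable M"
    and approx: "\<And>v. v > 0 \<Longrightarrow> \<bar>expectation (\<lambda>\<omega>. cos (v * Z \<omega>)) - (\<Sum>k\<le>n. q k * v ^ (2 * k))\<bar> \<le> D * v ^ (2 * n + 1)"
  shows "integrable M (\<lambda>\<omega>. Z \<omega> ^ (2 * n))"
proof -
  define g where "g v = expectation (\<lambda>\<omega>. cos (v * Z \<omega>))" for v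
  define P where "P = (\<Sum>k\<le>n. monom (q k) (2 * k))"
  have P: "poly P v = (\<Sum>k\<le>n. q k * v ^ (2 * k))" for v
    by (simp add: P_def poly_sum poly_monom)
  have D: "D \<ge> 0" using order_trans[OF abs_ge_zero approx[of 1]] by simp
  have gcont: "isCont g 0"
  proof -
    have "(\<lambda>k. g (X k)) \<longlonglongrightarrow> g 0" if "X \<longlonglongrightarrow> 0" for X :: "nat \<Rightarrow> real"
      unfolding g_def
    proof (rule integral_dominated_convergence[where w = "\<lambda>_. 1"])
      show "AE x in M. (\<lambda>k. cos (X k * Z x)) \<longlonglongrightarrow> cos (0 * Z x)"
        using that by (intro AE_I2 tendsto_intros)
    qed auto
    then show ?thesis unfolding continuous_at_sequentially by (auto simp: o_def)
  qed
  \<comment> \<open>\<open>approx\<close> covers v > 0 only. Both \<open>g\<close> and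
    \<open>P\<close> are even, and v = 0 follows by continuity; differences around 0 need all three
    cases.\<close>
  have all: "\<bar>g v - poly P v\<bar> \<le> D * \<bar>v\<bar> ^ (2 * n + 1)" for v
  proof -
    consider "v > 0" | "v < 0" | "v = 0" by linarith
    then show ?thesis
    proof cases
      case 1 then show ?thesis using approx[of v] by (simp add: g_def P)
    next
      case 2
      have "g v = g (- v)" by (simp add: g_def)
      moreover have "poly P v = poly P (- v)" by (simp add: P)
      ultimately show ?thesis using approx[of "- v"] 2 by (simp add: g_def P)
    next
      case 3
      have "((\<lambda>v. \<bar>g v - poly P v\<bar>) \<longlongrightarrow> \<bar>g 0 - poly P 0\<bar>) (at_right 0)"
        by (intro tendsto_intros tendsto_mono[OF at_le[OF subset_UNIV] gcont[unfolded isCont_def]])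
      moreover have "((\<lambda>v. D * v ^ (2 * n + 1)) \<longlongrightarrow> D * 0 ^ (2 * n + 1)) (at_right 0)"
        by (intro tendsto_intros)
      moreover have "\<forall>\<^sub>F v in at_right 0. \<bar>g v - poly P v\<bar> \<le> D * v ^ (2 * n + 1)"
        using approx by (auto simp: eventually_at_filter g_def P)
      ultimately have "\<bar>g 0 - poly P 0\<bar> \<le> D * 0 ^ (2 * n + 1)"
        by (intro tendsto_le[OF trivial_limit_at_right_real])
      then show ?thesis using 3 by simp
    qed
  qed
  have "compact (poly ((pderiv ^^ (2 * n)) P) ` {- real n..real n})"
    by (intro compact_continuous_image continuous_intros) auto
  from compact_imp_bounded[OF this] obtain B where B: "\<And>y. y \<in> {- real n..real n} \<Longrightarrow> \<bar>poly ((pderiv ^^ (2 * n)) P) y\<bar> \<le> B"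
    unfolding bounded_iff real_norm_def by blast
  \<comment> \<open>The first summand bounds the differences of the polynomial through its 2n-th
    derivative on [-n, n], which contains all nodes for u <= 1. The second bounds those of the
    remainder, where u^(2n+1) <= u^(2n).\<close>
  define E where "E = 2 ^ n * B + 4 ^ n * (D * real n ^ (2 * n + 1))"
  have main: "expectation (\<lambda>\<omega>. (2 - 2 * cos (u * Z \<omega>)) ^ n) \<le> E * u ^ (2 * n)" if u: "0 < u" "u \<le> 1" for u
  proof -
    have "expectation (\<lambda>\<omega>. (2 - 2 * cos (u * Z \<omega>)) ^ n) = (second_diff u ^^ n) g 0"
      unfolding g_def[abs_def] by (subst second_diff_funpow_expectation_cos) auto
    also have "\<dots> = (second_diff u ^^ n) (\<lambda>v. g v - poly P v) 0 + (second_diff u ^^ n) (poly P) 0"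
      by (simp add: second_diff_funpow_minus)
    also have "\<bar>(second_diff u ^^ n) (\<lambda>v. g v - poly P v) 0\<bar> \<le> 4 ^ n * (D * (real n * u) ^ (2 * n + 1))"
    proof (rule second_diff_funpow_bound[OF _ u(1)])
      fix y assume "\<bar>y - 0\<bar> \<le> real n * u"
      then have "D * \<bar>y\<bar> ^ (2 * n + 1) \<le> D * (real n * u) ^ (2 * n + 1)"
        using D by (intro mult_left_mono power_mono) auto
      with all[of y] show "\<bar>g y - poly P y\<bar> \<le> D * (real n * u) ^ (2 * n + 1)" by linarith
    qed
    then have "(second_diff u ^^ n) (\<lambda>v. g v - poly P v) 0 \<le> 4 ^ n * (D * (real n * u) ^ (2 * n + 1))" by linarith
    also have "\<bar>(second_diff u ^^ n) (poly P) 0\<bar> \<le> 2 ^ n * u ^ (2 * n) * B"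
    proof -
      have "\<bar>(second_diff u ^^ n) (poly ((pderiv ^^ 0) P)) 0\<bar> \<le> 2 ^ n * u ^ (2 * n) * B"
      proof (rule second_diff_funpow_smooth_bound[where g = "\<lambda>i. poly ((pderiv ^^ i) P)", OF _ _ u(1)])
        fix y assume "\<bar>y - 0\<bar> \<le> real n * u"
        also have "real n * u \<le> real n" using u by (simp add: mult_left_le)
        finally show "\<bar>poly ((pderiv ^^ (2 * n)) P) y\<bar> \<le> B" by (intro B) auto
      qed (auto intro: poly_DERIV)
      then show ?thesis by simp
    qed
    then have "(second_diff u ^^ n) (poly P) 0 \<le> 2 ^ n * u ^ (2 * n) * B" by linarith
    also have "4 ^ n * (D * (real n * u) ^ (2 * n + 1)) + 2 ^ n * u ^ (2 * n) * B
       \<le> E * u ^ (2 * n)"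
    proof -
      have "u ^ (2 * n + 1) \<le> u ^ (2 * n)" using u by (intro power_decreasing) auto
      then have "4 ^ n * (D * (real n ^ (2 * n + 1) * u ^ (2 * n + 1))) \<le> 4 ^ n * (D * (real n ^ (2 * n + 1) * u ^ (2 * n)))"
        using D by (intro mult_left_mono) auto
      moreover have "E * u ^ (2 * n) = 2 ^ n * u ^ (2 * n) * B + 4 ^ n * (D * (real n ^ (2 * n + 1) * u ^ (2 * n)))"
        by (simp add: E_def algebra_simps)
      ultimately show ?thesis unfolding power_mult_distrib by linarith
    qed
    finally show ?thesis by simp
  qed
  \<comment> \<open>The n-th power of (2 - 2 cos(u Z)) / u^2 for u = 1 / (k+1).\<close>
  define h where "h k \<omega> = ((2 - 2 * cos (Z \<omega> / real (Suc k))) * real (Suc k) ^ 2) ^ n" for k \<omega>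
  have h0: "h k \<omega> \<ge> 0" for k \<omega> by (auto simp: h_def)
  have hm[measurable]: "h k \<in> borel_measurable M" for k unfolding h_def by measurable
  have h_lim: "(\<lambda>k. h k \<omega>) \<longlonglongrightarrow> Z \<omega> ^ (2 * n)" for \<omega>
  proof -
    define z where "z = Z \<omega>"
    have "(\<lambda>k. (2 - 2 * cos (z / real (Suc k))) * real (Suc k) ^ 2) \<longlonglongrightarrow> z * z"
      by real_asymp
    then have "(\<lambda>k. (2 - 2 * cos (z / real (Suc k))) * real (Suc k) ^ 2) \<longlonglongrightarrow> z\<^sup>2"
      by (simp only: power2_eq_square)
    from tendsto_power[OF this, of n] show ?thesis by (simp add: h_def z_def power_mult)
  qed
  have h_int: "(\<integral>\<^sup>+ \<omega>. ennreal (h k \<omega>) \<partial>M) \<le> ennreal E" for k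
  proof -
    define u where "u = 1 / real (Suc k)"
    have u: "0 < u" "u \<le> 1" by (auto simp: u_def)
    have h_eq: "h k \<omega> = (2 - 2 * cos (u * Z \<omega>)) ^ n * (1 / u ^ (2 * n))" for \<omega>
      by (simp add: h_def u_def power_mult_distrib power_mult power_divide)
    have "\<bar>2 - 2 * cos y\<bar> \<le> 4" for y :: real using abs_cos_le_one[of y] by linarith
    then have "\<bar>(2 - 2 * cos y) ^ n\<bar> \<le> 4 ^ n" for y :: real
      unfolding power_abs by (intro power_mono) auto
    then have int: "integrable M (\<lambda>\<omega>. (2 - 2 * cos (u * Z \<omega>)) ^ n)"
      by (intro integrable_bounded_fun[of _ "4 ^ n"]) auto
    have "(\<integral>\<^sup>+ \<omega>. ennreal (h k \<omega>) \<partial>M) = ennreal (expectation (h k))"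
      using int h0 unfolding h_eq[abs_def] by (intro nn_integral_eq_integral) (auto simp: h_eq[abs_def])
    also have "expectation (h k) = expectation (\<lambda>\<omega>. (2 - 2 * cos (u * Z \<omega>)) ^ n) * (1 / u ^ (2 * n))"
      unfolding h_eq[abs_def] by simp
    also have "\<dots> \<le> E * u ^ (2 * n) * (1 / u ^ (2 * n))"
      using main[OF u] u by (intro mult_right_mono) auto
    also have "\<dots> = E" using u by simp
    finally show ?thesis by (simp add: ennreal_leI)
  qed
  have "(\<integral>\<^sup>+ \<omega>. ennreal (Z \<omega> ^ (2 * n)) \<partial>M) = (\<integral>\<^sup>+ \<omega>. liminf (\<lambda>k. ennreal (h k \<omega>)) \<partial>M)"
  proof (rule nn_integral_cong)
    fix \<omega>
    have "(\<lambda>k. ennreal (h k \<omega>)) \<longlonglongrightarrow> ennreal (Z \<omega> ^ (2 * n))" by (intro tendsto_ennrealI h_lim)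
    then show "ennreal (Z \<omega> ^ (2 * n)) = liminf (\<lambda>k. ennreal (h k \<omega>))"
      using lim_imp_Liminf[OF sequentially_bot] by metis
  qed
  also have "\<dots> \<le> liminf (\<lambda>k. \<integral>\<^sup>+ \<omega>. ennreal (h k \<omega>) \<partial>M)" by (rule nn_integral_liminf) auto
  also have "\<dots> \<le> liminf (\<lambda>k::nat. ennreal E)"
    by (rule Liminf_mono, rule always_eventually, rule allI, rule h_int)
  also have "\<dots> = ennreal E" by (rule Liminf_const) simp
  also have "\<dots> < \<infinity>" by simp
  finally show ?thesis by (intro integrableI_nonneg) auto
qed

end

section \<open>Joint laws from characteristic functions\<close>

context prob_space
begin

text \<open>The weights have equal total mass (t = 0). If the mass is positive, both are normalised
  to probability densities and Levy's uniqueness theorem compares the laws of X and Y under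
  them.\<close>

lemma weighted_char_unique:
  fixes X Y w w' :: "'a \<Rightarrow> real"
  assumes [measurable]: "X \<in> borel_measurable M" "Y \<in> borel_measurable M"
      "w \<in> borel_measurable M" "w' \<in> borel_measurable M"
    and w: "\<And>\<omega>. 0 \<le> w \<omega>" "\<And>\<omega>. w \<omega> \<le> C" and w': "\<And>\<omega>. 0 \<le> w' \<omega>" "\<And>\<omega>. w' \<omega> \<le> C"
    and eq: "\<And>t. (LINT \<omega>|M. of_real (w \<omega>) * iexp (t * X \<omega>)) = (LINT \<omega>|M. of_real (w' \<omega>) * iexp (t * Y \<omega>))"
    and B[measurable]: "B \<in> sets borel"
  shows "(LINT \<omega>|M. w \<omega> * indicator B (X \<omega>)) = (LINT \<omega>|M. w' \<omega> * indicator B (Y \<omega>))"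
proof -
  define m where "m = (LINT \<omega>|M. w \<omega>)"
  have int: "integrable M w" "integrable M w'"
    by (intro integrable_const_bound[of _ C] AE_I2; use w w' in simp)+
  have "complex_of_real m = of_real (LINT \<omega>|M. w' \<omega>)"
    using eq[of 0] by (simp add: m_def)
  then have m': "m = (LINT \<omega>|M. w' \<omega>)" by (simp only: of_real_eq_iff)
  have "m \<ge> 0" unfolding m_def using w by (intro integral_nonneg_AE) auto
  have zero: "(LINT \<omega>|M. v \<omega> * indicator B (Z \<omega>)) = 0"
    if "(LINT \<omega>|M. v \<omega>) = 0" "\<And>\<omega>. 0 \<le> v \<omega>" "integrable M v" for v Z :: "'a \<Rightarrow> real"
  proof -
    have "AE \<omega> in M. v \<omega> = 0" using integral_nonneg_eq_0_iff_AE[OF that(3)] that(1,2) by simp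
    then show ?thesis by (intro integral_eq_zero_AE) auto
  qed
  show ?thesis
  \<comment> \<open>A weight of mass 0 cannot be normalised, but then it vanishes almost everywhere
    and both integrals are 0.\<close>
  proof (cases "m = 0")
    case True
    then show ?thesis using zero[of w X] zero[of w' Y] m' w w' int by (simp add: m_def)
  next
    case False
    then have m: "m > 0" using \<open>m \<ge> 0\<close> by simp
    define N where "N v Z = distr (density M (\<lambda>\<omega>. ennreal (v \<omega> / m))) borel Z" for v Z :: "'a \<Rightarrow> real"
    have N_int: "(LINT x|N v Z. f x) = (LINT \<omega>|M. (v \<omega> / m) *\<^sub>R f (Z \<omega>))"
      if [measurable]: "v \<in> borel_measurable M" "Z \<in> borel_measurable M" and "f \<in> borel_measurable borel" and "\<And>\<omega>. 0 \<le> v \<omega>"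
      for v Z and f :: "real \<Rightarrow> 'b::{banach, second_countable_topology}"
    proof -
      have "(LINT x|N v Z. f x) = (LINT \<omega>|density M (\<lambda>\<omega>. ennreal (v \<omega> / m)). f (Z \<omega>))"
        unfolding N_def by (rule integral_distr) (use that in auto)
      also have "\<dots> = (LINT \<omega>|M. (v \<omega> / m) *\<^sub>R f (Z \<omega>))"
        by (rule integral_density) (use that m in \<open>auto intro: measurable_compose\<close>)
      finally show ?thesis .
    qed
    have N_rd: "real_distribution (N v Z)"
      if [measurable]: "v \<in> borel_measurable M" "Z \<in> borel_measurable M" and "\<And>\<omega>. 0 \<le> v \<omega>" "integrable M v" "(LINT \<omega>|M. v \<omega>) = m" for v Z
    proof -
      have "prob_space (density M (\<lambda>\<omega>. ennreal (v \<omega> / m)))"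
      proof
        have "emeasure (density M (\<lambda>\<omega>. ennreal (v \<omega> / m))) (space M) = (\<integral>\<^sup>+ \<omega>. ennreal (v \<omega> / m) * indicator (space M) \<omega> \<partial>M)"
          by (rule emeasure_density) auto
        also have "\<dots> = (\<integral>\<^sup>+ \<omega>. ennreal (v \<omega> / m) \<partial>M)" by (intro nn_integral_cong) simp
        also have "\<dots> = ennreal (LINT \<omega>|M. v \<omega> / m)"
          using that m by (intro nn_integral_eq_integral) auto
        also have "\<dots> = 1" using that m by simp
        finally show "emeasure (density M (\<lambda>\<omega>. ennreal (v \<omega> / m))) (space (density M (\<lambda>\<omega>. ennreal (v \<omega> / m)))) = 1" by simp
      qed
      from prob_space.prob_space_distr[OF this, of Z borel] show ?thesis
        unfolding N_def real_distribution_def real_distribution_axioms_def by simp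
    qed
    have char_N: "char (N v Z) t = of_real (1 / m) * (LINT \<omega>|M. of_real (v \<omega>) * iexp (t * Z \<omega>))"
      if "v \<in> borel_measurable M" "Z \<in> borel_measurable M" and "\<And>\<omega>. 0 \<le> v \<omega>" for v Z t
    proof -
      have "char (N v Z) t = (LINT \<omega>|M. (v \<omega> / m) *\<^sub>R iexp (t * Z \<omega>))"
        unfolding char_def by (rule N_int) (use that in auto)
      also have "\<dots> = (LINT \<omega>|M. of_real (1 / m) * (of_real (v \<omega>) * iexp (t * Z \<omega>)))"
        by (intro Bochner_Integration.integral_cong) (auto simp: scaleR_conv_of_real)
      finally show ?thesis by (simp only: integral_mult_right_zero)
    qed
    have "N w X = N w' Y"
    proof (rule Levy_uniqueness)
      show "real_distribution (N w X)" "real_distribution (N w' Y)"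
        by (rule N_rd; use w w' int m' in \<open>simp add: m_def\<close>)+
      show "char (N w X) = char (N w' Y)"
        using eq w(1) w'(1) by (auto simp: char_N)
    qed
    then have "(LINT x|N w X. indicat_real B x) = (LINT x|N w' Y. indicat_real B x)" by simp
    then have "(LINT \<omega>|M. (w \<omega> / m) *\<^sub>R indicat_real B (X \<omega>)) = (LINT \<omega>|M. (w' \<omega> / m) *\<^sub>R indicat_real B (Y \<omega>))"
      using N_int[of w X "indicat_real B"] N_int[of w' Y "indicat_real B"] w(1) w'(1) by simp
    then show ?thesis using m by simp
  qed
qed

lemma integrable_weighted_iexp:
  assumes [measurable]: "w \<in> borel_measurable M" "f \<in> borel_measurable M"
    and w: "\<And>\<omega>. \<bar>w \<omega>\<bar> \<le> C"
  shows "integrable M (\<lambda>\<omega>. complex_of_real (w \<omega>) * iexp (f \<omega>))"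
  by (rule integrable_const_bound[of _ C]) (use w in \<open>auto simp: norm_mult\<close>)

text \<open>Multiplying the weight by \<open>1 + cos V\<close> or \<open>1 + sin V\<close>, with \<open>V\<close> a linear functional of the
  other coordinates, keeps it non-negative; this reduces the joint law to one-dimensional laws.\<close>
lemma weighted_joint_char_unique:
  fixes X Y :: "'i \<Rightarrow> 'a \<Rightarrow> real"
  assumes "finite I"
    and "\<And>i. i \<in> I \<Longrightarrow> X i \<in> borel_measurable M" "\<And>i. i \<in> I \<Longrightarrow> Y i \<in> borel_measurable M"
    and "w \<in> borel_measurable M" "w' \<in> borel_measurable M"
    and "\<And>\<omega>. 0 \<le> w \<omega>" "\<And>\<omega>. w \<omega> \<le> C" "\<And>\<omega>. 0 \<le> w' \<omega>" "\<And>\<omega>. w' \<omega> \<le> C"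
    and "\<And>u. (LINT \<omega>|M. of_real (w \<omega>) * iexp (\<Sum>i\<in>I. u i * X i \<omega>)) = (LINT \<omega>|M. of_real (w' \<omega>) * iexp (\<Sum>i\<in>I. u i * Y i \<omega>))"
    and "\<And>i. i \<in> I \<Longrightarrow> B i \<in> sets borel"
  shows "(LINT \<omega>|M. w \<omega> * (\<Prod>i\<in>I. indicator (B i) (X i \<omega>))) = (LINT \<omega>|M. w' \<omega> * (\<Prod>i\<in>I. indicator (B i) (Y i \<omega>)))"
  using assms
proof (induction I arbitrary: w w')
  case empty
  have "complex_of_real (LINT \<omega>|M. w \<omega>) = of_real (LINT \<omega>|M. w' \<omega>)"
    using empty.prems(9) by simp
  then show ?case by simp
next
  case (insert k J)
  have [measurable]: "\<And>i. i \<in> J \<Longrightarrow> X i \<in> borel_measurable M" "\<And>i. i \<in> J \<Longrightarrow> Y i \<in> borel_measurable M"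
     "X k \<in> borel_measurable M" "Y k \<in> borel_measurable M" "w \<in> borel_measurable M" "w' \<in> borel_measurable M" "B k \<in> sets borel"
    using insert.prems by auto
  have mX: "\<forall>i\<in>J. X i \<in> borel_measurable M" "X k \<in> borel_measurable M" "w \<in> borel_measurable M"
    and mY: "\<forall>i\<in>J. Y i \<in> borel_measurable M" "Y k \<in> borel_measurable M" "w' \<in> borel_measurable M"
    using insert.prems by auto
  have w: "\<bar>w \<omega>\<bar> \<le> C" "\<bar>w' \<omega>\<bar> \<le> C" for \<omega>
    using insert.prems(5-8) by auto
  have C: "C \<ge> 0" using w(1)[of undefined] by linarith
  have eq: "(LINT \<omega>|M. of_real (w \<omega>) * iexp (t * X k \<omega> + (\<Sum>i\<in>J. u i * X i \<omega>))) =
    (LINT \<omega>|M. of_real (w' \<omega>) * iexp (t * Y k \<omega> + (\<Sum>i\<in>J. u i * Y i \<omega>)))" for t u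
  proof -
    have "(\<Sum>i\<in>insert k J. (u(k := t)) i * Z i) = t * Z k + (\<Sum>i\<in>J. u i * Z i)" for Z
      using insert.hyps by (subst sum.insert) (auto intro!: sum.cong arg_cong2[of _ _ _ _ "(+)"])
    then show ?thesis using insert.prems(9)[of "u(k := t)"] by simp
  qed
  \<comment> \<open>Writing the cosine by exponentials expresses the transform of the new weight
    through joint transforms with the old weight at the frequencies (t, 0), (t, u) and (t, -u),
    which agree by \<open>eq\<close>.\<close>
  have step: "(LINT \<omega>|M. w \<omega> * (1 + cos ((\<Sum>i\<in>J. u i * X i \<omega>) + \<theta>)) * indicator (B k) (X k \<omega>)) =
     (LINT \<omega>|M. w' \<omega> * (1 + cos ((\<Sum>i\<in>J. u i * Y i \<omega>) + \<theta>)) * indicator (B k) (Y k \<omega>))" for u \<theta>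
  proof (rule weighted_char_unique[where C = "2 * C"])
    have c: "0 \<le> 1 + cos x" "1 + cos x \<le> 2" for x :: real
      using cos_ge_minus_one[of x] by (simp_all, linarith)
    show "0 \<le> w \<omega> * (1 + cos ((\<Sum>i\<in>J. u i * X i \<omega>) + \<theta>))" "0 \<le> w' \<omega> * (1 + cos ((\<Sum>i\<in>J. u i * Y i \<omega>) + \<theta>))" for \<omega>
      using insert.prems(5,7) c by (auto intro!: mult_nonneg_nonneg)
    have "w \<omega> * (1 + cos x) \<le> C * 2" "w' \<omega> * (1 + cos x) \<le> C * 2" for \<omega> x
      using insert.prems(5-8) c C by (auto intro!: mult_mono)
    then show "w \<omega> * (1 + cos ((\<Sum>i\<in>J. u i * X i \<omega>) + \<theta>)) \<le> 2 * C" "w' \<omega> * (1 + cos ((\<Sum>i\<in>J. u i * Y i \<omega>) + \<theta>)) \<le> 2 * C" for \<omega>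
      by (simp_all add: mult.commute)
    fix t :: real
    have expand: "(LINT \<omega>|M. of_real (v \<omega> * (1 + cos ((\<Sum>i\<in>J. u i * Z i \<omega>) + \<theta>))) * iexp (t * Z k \<omega>)) =
       (LINT \<omega>|M. of_real (v \<omega>) * iexp (t * Z k \<omega> + (\<Sum>i\<in>J. 0 * Z i \<omega>)))
       + (iexp \<theta> / 2 * (LINT \<omega>|M. of_real (v \<omega>) * iexp (t * Z k \<omega> + (\<Sum>i\<in>J. u i * Z i \<omega>)))
       + iexp (- \<theta>) / 2 * (LINT \<omega>|M. of_real (v \<omega>) * iexp (t * Z k \<omega> + (\<Sum>i\<in>J. - u i * Z i \<omega>))))"
      if Z: "\<forall>i\<in>J. Z i \<in> borel_measurable M" and [measurable]: "Z k \<in> borel_measurable M" "v \<in> borel_measurable M"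
        and v: "\<And>\<omega>. \<bar>v \<omega>\<bar> \<le> C" for v Z
    proof -
      have [measurable]: "\<And>i. i \<in> J \<Longrightarrow> Z i \<in> borel_measurable M" using Z by blast
      have int: "integrable M (\<lambda>\<omega>. complex_of_real (v \<omega>) * iexp (t * Z k \<omega> + (\<Sum>i\<in>J. c i * Z i \<omega>)))" for c
        by (rule integrable_weighted_iexp[OF _ _ v]) measurable
      have *: "of_real (v \<omega> * (1 + cos ((\<Sum>i\<in>J. u i * Z i \<omega>) + \<theta>))) * iexp (t * Z k \<omega>) =
         of_real (v \<omega>) * iexp (t * Z k \<omega> + (\<Sum>i\<in>J. 0 * Z i \<omega>))
         + (iexp \<theta> / 2 * (of_real (v \<omega>) * iexp (t * Z k \<omega> + (\<Sum>i\<in>J. u i * Z i \<omega>)))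
         + iexp (- \<theta>) / 2 * (of_real (v \<omega>) * iexp (t * Z k \<omega> + (\<Sum>i\<in>J. - u i * Z i \<omega>))))" for \<omega>
      proof -
        define V where "V = (\<Sum>i\<in>J. u i * Z i \<omega>)"
        have "complex_of_real (cos (V + \<theta>)) = (iexp (V + \<theta>) + iexp (- V + - \<theta>)) / 2"
          by (simp add: cos_exp_eq algebra_simps flip: cos_of_real)
        moreover have add: "iexp (x + y) = iexp x * iexp y" for x y
          by (simp add: distrib_left exp_add)
        ultimately have "complex_of_real (cos (V + \<theta>)) = (iexp V * iexp \<theta> + iexp (- V) * iexp (- \<theta>)) / 2"
          by (simp only: add)
        then have "of_real (v \<omega> * (1 + cos (V + \<theta>))) * iexp (t * Z k \<omega>) =
           of_real (v \<omega>) * iexp (t * Z k \<omega>) + (iexp \<theta> / 2 * (of_real (v \<omega>) * (iexp (t * Z k \<omega>) * iexp V))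
           + iexp (- \<theta>) / 2 * (of_real (v \<omega>) * (iexp (t * Z k \<omega>) * iexp (- V))))"
          unfolding of_real_mult of_real_add of_real_1 by (simp only:) (simp add: field_simps)
        then show ?thesis
          unfolding add sum_negf mult_minus_left V_def[symmetric] by simp
      qed
      have lin: "(LINT \<omega>|M. f \<omega> + (a * g \<omega> + b * h \<omega>)) = (LINT \<omega>|M. f \<omega>) + (a * (LINT \<omega>|M. g \<omega>) + b * (LINT \<omega>|M. h \<omega>))"
        if "integrable M f" "integrable M g" "integrable M h" for f g h :: "'a \<Rightarrow> complex" and a b
        using that by simp
      show ?thesis unfolding * by (intro lin int)
    qed
    show "(LINT \<omega>|M. of_real (w \<omega> * (1 + cos ((\<Sum>i\<in>J. u i * X i \<omega>) + \<theta>))) * iexp (t * X k \<omega>)) =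
      (LINT \<omega>|M. of_real (w' \<omega> * (1 + cos ((\<Sum>i\<in>J. u i * Y i \<omega>) + \<theta>))) * iexp (t * Y k \<omega>))"
      unfolding expand[of X w, OF mX w(1)] expand[of Y w', OF mY w(2)] by (simp only: eq)
  qed measurable
  \<comment> \<open>Frequency 0 and phase 0 turn the weight w into 2w, so the plain indicator
    integrals agree; subtracting them from \<open>step\<close> removes the summand 1.\<close>
  have cos_eq: "(LINT \<omega>|M. (w \<omega> * indicator (B k) (X k \<omega>)) * cos ((\<Sum>i\<in>J. u i * X i \<omega>) + \<theta>)) =
     (LINT \<omega>|M. (w' \<omega> * indicator (B k) (Y k \<omega>)) * cos ((\<Sum>i\<in>J. u i * Y i \<omega>) + \<theta>))" for u \<theta>
  proof -
    have split: "(LINT \<omega>|M. v \<omega> * (1 + cos ((\<Sum>i\<in>J. c i * Z i \<omega>) + \<theta>)) * indicator (B k) (Z k \<omega>)) =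
        (LINT \<omega>|M. v \<omega> * indicator (B k) (Z k \<omega>)) + (LINT \<omega>|M. (v \<omega> * indicator (B k) (Z k \<omega>)) * cos ((\<Sum>i\<in>J. c i * Z i \<omega>) + \<theta>))"
      if Z: "\<forall>i\<in>J. Z i \<in> borel_measurable M" and [measurable]: "Z k \<in> borel_measurable M" "v \<in> borel_measurable M"
        and v: "\<And>\<omega>. \<bar>v \<omega>\<bar> \<le> C" for v Z \<theta> and c :: "'i \<Rightarrow> real"
    proof -
      have [measurable]: "\<And>i. i \<in> J \<Longrightarrow> Z i \<in> borel_measurable M" using Z by blast
      have "integrable M (\<lambda>\<omega>. v \<omega> * indicator (B k) (Z k \<omega>))"
        by (rule integrable_const_bound[of _ C]) (use v C in \<open>auto simp: indicator_def\<close>)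
      moreover have "integrable M (\<lambda>\<omega>. (v \<omega> * indicator (B k) (Z k \<omega>)) * cos ((\<Sum>i\<in>J. c i * Z i \<omega>) + \<theta>))"
      proof (rule integrable_const_bound[of _ C])
        have "\<bar>v \<omega> * indicator (B k) (Z k \<omega>)\<bar> * \<bar>cos x\<bar> \<le> C * 1" for \<omega> x
          using v C by (intro mult_mono) (auto simp: indicator_def)
        then show "AE \<omega> in M. norm ((v \<omega> * indicator (B k) (Z k \<omega>)) * cos ((\<Sum>i\<in>J. c i * Z i \<omega>) + \<theta>)) \<le> C"
          by (simp add: abs_mult)
      qed measurable
      ultimately show ?thesis
        by (subst Bochner_Integration.integral_add[symmetric]) (auto intro!: Bochner_Integration.integral_cong simp: algebra_simps)
    qed
    have "(LINT \<omega>|M. w \<omega> * indicator (B k) (X k \<omega>)) = (LINT \<omega>|M. w' \<omega> * indicator (B k) (Y k \<omega>))"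
      using step[of "\<lambda>_. 0" 0] unfolding split[of X w, OF mX w(1)] split[of Y w', OF mY w(2)] by simp
    then show ?thesis
      using step[of u \<theta>] unfolding split[of X w, OF mX w(1)] split[of Y w', OF mY w(2)] by simp
  qed
  \<comment> \<open>The indicator of coordinate k is absorbed into the weight, which stays between 0
    and C, and the induction hypothesis handles the other coordinates.\<close>
  have "(LINT \<omega>|M. (w \<omega> * indicator (B k) (X k \<omega>)) * (\<Prod>i\<in>J. indicator (B i) (X i \<omega>))) =
     (LINT \<omega>|M. (w' \<omega> * indicator (B k) (Y k \<omega>)) * (\<Prod>i\<in>J. indicator (B i) (Y i \<omega>)))"
  proof (rule insert.IH)
    show "0 \<le> w \<omega> * indicator (B k) (X k \<omega>)" "w \<omega> * indicator (B k) (X k \<omega>) \<le> C"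
      "0 \<le> w' \<omega> * indicator (B k) (Y k \<omega>)" "w' \<omega> * indicator (B k) (Y k \<omega>) \<le> C" for \<omega>
      using insert.prems(5-8) C by (auto simp: indicator_def)
    fix u :: "'i \<Rightarrow> real"
    \<comment> \<open>The phases 0 and -pi/2 give the real and the imaginary part of the
      transform.\<close>
    have split: "(LINT \<omega>|M. of_real (v \<omega> * indicator (B k) (Z k \<omega>)) * iexp (\<Sum>i\<in>J. u i * Z i \<omega>)) =
       of_real (LINT \<omega>|M. (v \<omega> * indicator (B k) (Z k \<omega>)) * cos ((\<Sum>i\<in>J. u i * Z i \<omega>) + 0))
       + \<i> * of_real (LINT \<omega>|M. (v \<omega> * indicator (B k) (Z k \<omega>)) * cos ((\<Sum>i\<in>J. u i * Z i \<omega>) + - (pi / 2)))"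
      if Z: "\<forall>i\<in>J. Z i \<in> borel_measurable M" and [measurable]: "Z k \<in> borel_measurable M" "v \<in> borel_measurable M"
        and v: "\<And>\<omega>. \<bar>v \<omega>\<bar> \<le> C" for v Z
    proof -
      have [measurable]: "\<And>i. i \<in> J \<Longrightarrow> Z i \<in> borel_measurable M" using Z by blast
      have vB: "\<bar>v \<omega> * indicator (B k) (Z k \<omega>)\<bar> \<le> C" for \<omega> using v C by (auto simp: indicator_def)
      have "integrable M (\<lambda>\<omega>. complex_of_real (v \<omega> * indicator (B k) (Z k \<omega>)) * iexp (\<Sum>i\<in>J. u i * Z i \<omega>))"
        by (rule integrable_weighted_iexp[OF _ _ vB]) measurable
      note Re = integral_Re[OF this] and Im = integral_Im[OF this]
      have s: "cos (x + - (pi / 2)) = sin x" for x by (simp add: cos_diff)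
      show ?thesis unfolding s complex_eq_iff using Re Im
        by (simp add: exp_eq_polar Re_exp Im_exp)
    qed
    show "(LINT \<omega>|M. of_real (w \<omega> * indicator (B k) (X k \<omega>)) * iexp (\<Sum>i\<in>J. u i * X i \<omega>)) =
      (LINT \<omega>|M. of_real (w' \<omega> * indicator (B k) (Y k \<omega>)) * iexp (\<Sum>i\<in>J. u i * Y i \<omega>))"
      unfolding split[of X w, OF mX w(1)] split[of Y w', OF mY w(2)] by (simp only: cos_eq)
  qed (use insert.prems in auto)
  then show ?case using insert.hyps by (simp add: mult.assoc)
qed

theorem distr_PiM_eq_of_char:
  fixes X Y :: "'i \<Rightarrow> 'a \<Rightarrow> real"
  assumes I: "finite I"
    and X[measurable]: "\<And>i. i \<in> I \<Longrightarrow> X i \<in> borel_measurable M"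
    and Y[measurable]: "\<And>i. i \<in> I \<Longrightarrow> Y i \<in> borel_measurable M"
    and eq: "\<And>u. (LINT \<omega>|M. iexp (\<Sum>i\<in>I. u i * X i \<omega>)) = (LINT \<omega>|M. iexp (\<Sum>i\<in>I. u i * Y i \<omega>))"
  shows "distr M (PiM I (\<lambda>_. borel)) (\<lambda>\<omega>. \<lambda>i\<in>I. X i \<omega>) = distr M (PiM I (\<lambda>_. borel)) (\<lambda>\<omega>. \<lambda>i\<in>I. Y i \<omega>)"
proof (rule measure_eqI_PiM_infinite[where M = "\<lambda>_. borel"])
  fix A :: "'i \<Rightarrow> real set" and J assume "finite J" and J: "J \<subseteq> I" and A: "\<And>i. i \<in> J \<Longrightarrow> A i \<in> sets borel"
  \<comment> \<open>Coordinates outside J are unrestricted, which makes the generating cylinder sets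
    rectangles over the whole finite index set.\<close>
  define B where "B i = (if i \<in> J then A i else UNIV)" for i
  have B: "B i \<in> sets borel" for i using A by (simp add: B_def)
  have emb: "prod_emb I (\<lambda>_. borel) J (Pi\<^sub>E J A) = Pi\<^sub>E I B"
    using J by (subst prod_emb_PiE) (auto simp: B_def space_PiM PiE_def Pi_def split: if_splits)
  have X': "\<forall>i\<in>I. X i \<in> borel_measurable M" and Y': "\<forall>i\<in>I. Y i \<in> borel_measurable M"
    using X Y by auto
  have E: "Pi\<^sub>E I B \<in> sets (PiM I (\<lambda>_. borel))" using I B by (intro sets_PiM_I_finite) auto
  have eval: "emeasure (distr M (PiM I (\<lambda>_. borel)) (\<lambda>\<omega>. \<lambda>i\<in>I. Z i \<omega>)) (Pi\<^sub>E I B) =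
      ennreal (LINT \<omega>|M. 1 * (\<Prod>i\<in>I. indicator (B i) (Z i \<omega>)))"
    if Z: "\<forall>i\<in>I. Z i \<in> borel_measurable M" for Z
  proof -
    have m: "(\<lambda>\<omega>. \<lambda>i\<in>I. Z i \<omega>) \<in> measurable M (PiM I (\<lambda>_. borel))"
      by (intro measurable_restrict) (use Z in auto)
    have "emeasure (distr M (PiM I (\<lambda>_. borel)) (\<lambda>\<omega>. \<lambda>i\<in>I. Z i \<omega>)) (Pi\<^sub>E I B) =
        emeasure M ((\<lambda>\<omega>. \<lambda>i\<in>I. Z i \<omega>) -` Pi\<^sub>E I B \<inter> space M)" (is "_ = emeasure M ?S")
      by (rule emeasure_distr[OF m E])
    also have "\<dots> = ennreal (LINT \<omega>|M. indicator ?S \<omega>)"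
      using measurable_sets[OF m E] by (simp add: emeasure_eq_measure)
    also have "(LINT \<omega>|M. indicator ?S \<omega>) = (LINT \<omega>|M. 1 * (\<Prod>i\<in>I. indicat_real (B i) (Z i \<omega>)))"
    proof -
      have "indicator ?S \<omega> = 1 * (\<Prod>i\<in>I. indicat_real (B i) (Z i \<omega>))" if "\<omega> \<in> space M" for \<omega>
        using I that by (cases "\<forall>i\<in>I. Z i \<omega> \<in> B i") (auto simp: indicator_def PiE_iff)
      then show ?thesis by (rule Bochner_Integration.integral_cong[OF refl])
    qed
    finally show ?thesis .
  qed
  show "emeasure (distr M (PiM I (\<lambda>_. borel)) (\<lambda>\<omega>. \<lambda>i\<in>I. X i \<omega>)) (prod_emb I (\<lambda>_. borel) J (Pi\<^sub>E J A)) =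
    emeasure (distr M (PiM I (\<lambda>_. borel)) (\<lambda>\<omega>. \<lambda>i\<in>I. Y i \<omega>)) (prod_emb I (\<lambda>_. borel) J (Pi\<^sub>E J A))"
    unfolding emb eval[OF X'] eval[OF Y']
    by (rule arg_cong[of _ _ ennreal], rule weighted_joint_char_unique[where C = 1]) (use I X Y eq B in auto)
next
  show "finite_measure (distr M (PiM I (\<lambda>_. borel)) (\<lambda>\<omega>. \<lambda>i\<in>I. X i \<omega>))"
    by (intro finite_measure_distr measurable_restrict X)
qed auto

end

section \<open>The Kolmogorov--Chentsov criterion\<close>

definition dyadic_floor :: "nat \<Rightarrow> real \<Rightarrow> real" where
  "dyadic_floor k t = real (nat \<lfloor>2 ^ k * t\<rfloor>) / 2 ^ k"

lemma dyadic_floor_bounds: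
  assumes "t \<ge> 0"
  shows "0 \<le> dyadic_floor k t" "dyadic_floor k t \<le> t" "t - dyadic_floor k t \<le> 1 / 2 ^ k"
proof -
  have e: "real (nat \<lfloor>2 ^ k * t\<rfloor>) = of_int \<lfloor>2 ^ k * t\<rfloor>" using assms by (subst of_nat_nat) auto
  have "of_int \<lfloor>2 ^ k * t\<rfloor> \<le> 2 ^ k * t" "2 ^ k * t \<le> of_int \<lfloor>2 ^ k * t\<rfloor> + 1" by linarith+
  then have "of_int \<lfloor>2 ^ k * t\<rfloor> / 2 ^ k \<le> (2 ^ k * t) / 2 ^ k" "(2 ^ k * t) / 2 ^ k \<le> (of_int \<lfloor>2 ^ k * t\<rfloor> + 1) / 2 ^ k"
    by (intro divide_right_mono; simp)+
  then show "dyadic_floor k t \<le> t" "t - dyadic_floor k t \<le> 1 / 2 ^ k"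
    unfolding dyadic_floor_def e by (simp_all add: add_divide_distrib)
  show "0 \<le> dyadic_floor k t" by (simp add: dyadic_floor_def)
qed

text \<open>The deterministic half of the chaining argument, for a single path: (2 powr -\<gamma>)^k
  is the \<gamma>-th power of the mesh 2^-k. Almost sure existence of a finite B is a separate
  question.\<close>

locale dyadic_increments =
  fixes x :: "real \<Rightarrow> real" and T :: nat and B \<gamma> :: real
  assumes B: "B \<ge> 0" and \<gamma>: "\<gamma> > 0"
    and inc: "\<And>k j. j < T * 2 ^ k \<Longrightarrow> \<bar>x (real (Suc j) / 2 ^ k) - x (real j / 2 ^ k)\<bar> \<le> B * (2 powr - \<gamma>) ^ k"
begin

abbreviation "q \<equiv> 2 powr - \<gamma>"

lemma q: "0 < q" "q < 1"
  using \<gamma> by (auto simp: powr_less_one)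

lemma floor_le: "0 \<le> t \<Longrightarrow> t \<le> real T \<Longrightarrow> nat \<lfloor>2 ^ k * t\<rfloor> \<le> T * 2 ^ k"
proof -
  assume "0 \<le> t" "t \<le> real T"
  then have "2 ^ k * t \<le> 2 ^ k * real T" by (intro mult_left_mono) auto
  then have "\<lfloor>2 ^ k * t\<rfloor> \<le> \<lfloor>2 ^ k * real T\<rfloor>" by (rule floor_mono)
  also have "2 ^ k * real T = real (T * 2 ^ k)" by simp
  also have "\<lfloor>real (T * 2 ^ k)\<rfloor> = int (T * 2 ^ k)" by (rule floor_of_nat)
  finally show ?thesis by (simp only: nat_le_iff)
qed

text \<open>Since floor(2v) is 2 floor(v) or 2 floor(v) + 1, the roundings of t at consecutive
  levels are equal or neighbours on the finer grid.\<close>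

lemma level_step:
  assumes t: "0 \<le> t" "t \<le> real T"
  shows "\<bar>x (dyadic_floor (Suc k) t) - x (dyadic_floor k t)\<bar> \<le> B * q ^ Suc k"
proof -
  define j where "j = nat \<lfloor>2 ^ k * t\<rfloor>"
  define j' where "j' = nat \<lfloor>2 ^ Suc k * t\<rfloor>"
  have "\<lfloor>2 ^ Suc k * t\<rfloor> = 2 * \<lfloor>2 ^ k * t\<rfloor> \<or> \<lfloor>2 ^ Suc k * t\<rfloor> = 2 * \<lfloor>2 ^ k * t\<rfloor> + 1"
  proof -
    define v where "v = 2 ^ k * t"
    have e: "2 ^ Suc k * t = 2 * v" by (simp add: v_def)
    show ?thesis unfolding e v_def[symmetric] by linarith
  qed
  moreover have "\<lfloor>2 ^ k * t\<rfloor> \<ge> 0" using t by simp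
  ultimately have "j' = 2 * j \<or> j' = Suc (2 * j)" unfolding j_def j'_def by linarith
  moreover have d: "dyadic_floor k t = real (2 * j) / 2 ^ Suc k" "dyadic_floor (Suc k) t = real j' / 2 ^ Suc k"
    by (simp_all add: dyadic_floor_def j_def j'_def)
  moreover have "j' \<le> T * 2 ^ Suc k" unfolding j'_def by (rule floor_le[OF t])
  ultimately show ?thesis
  proof (elim disjE)
    assume "j' = Suc (2 * j)"
    then show ?thesis using inc[of "2 * j" "Suc k"] \<open>j' \<le> T * 2 ^ Suc k\<close> unfolding d by simp
  qed (use B q in simp)
qed

text \<open>The steps between consecutive levels are bounded by a geometric series, whose tail gives
  the rate.\<close>

lemma level_converges:
  assumes t: "0 \<le> t" "t \<le> real T"
  shows "convergent (\<lambda>k. x (dyadic_floor k t))"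
    and "\<bar>lim (\<lambda>k. x (dyadic_floor k t)) - x (dyadic_floor k t)\<bar> \<le> B * q ^ k / (1 - q)"
proof -
  let ?X = "\<lambda>k. x (dyadic_floor k t)"
  have "summable (\<lambda>k. B * q ^ Suc k)" using q by (intro summable_mult) (simp add: summable_Suc_iff summable_geometric)
  then have sm: "summable (\<lambda>k. ?X (Suc k) - ?X k)"
    by (rule summable_comparison_test'[where N = 0]) (use level_step[OF t] in simp)
  have "(\<lambda>n. \<Sum>k<n. ?X (Suc k) - ?X k) = (\<lambda>n. ?X n - ?X 0)" using sum_lessThan_telescope[of ?X] by simp
  with summable_LIMSEQ[OF sm] have "(\<lambda>n. ?X n - ?X 0) \<longlonglongrightarrow> (\<Sum>k. ?X (Suc k) - ?X k)" by simp
  from tendsto_add[OF this tendsto_const[of "?X 0"]] show conv: "convergent ?X"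
    unfolding convergent_def by auto
  have bound: "\<bar>?X (k + m) - ?X k\<bar> \<le> B * q ^ k * (\<Sum>i<m. q ^ Suc i)" for m
  proof (induction m)
    case (Suc m)
    have "\<bar>?X (k + Suc m) - ?X k\<bar> \<le> \<bar>?X (Suc (k + m)) - ?X (k + m)\<bar> + \<bar>?X (k + m) - ?X k\<bar>" by simp
    also have "\<dots> \<le> B * q ^ Suc (k + m) + B * q ^ k * (\<Sum>i<m. q ^ Suc i)"
      by (intro add_mono level_step t Suc.IH)
    also have "\<dots> = B * q ^ k * (\<Sum>i<Suc m. q ^ Suc i)" by (simp add: power_add algebra_simps)
    finally show ?case .
  qed simp
  have "(\<Sum>i<m. q ^ Suc i) \<le> 1 / (1 - q)" for m
  proof -
    have "(\<Sum>i<m. q ^ Suc i) \<le> (\<Sum>i<m. q ^ i)" using q by (intro sum_mono power_decreasing) auto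
    also have "\<dots> \<le> (\<Sum>i. q ^ i)" using q by (intro sum_le_suminf summable_geometric) auto
    also have "\<dots> = 1 / (1 - q)" using q by (intro suminf_geometric) auto
    finally show ?thesis .
  qed
  then have bnd: "\<bar>?X (k + m) - ?X k\<bar> \<le> B * q ^ k * (1 / (1 - q))" for m
    using B q by (intro order_trans[OF bound] mult_left_mono) auto
  have *: "\<bar>?X (m + k) - ?X k\<bar> \<le> B * q ^ k / (1 - q)" for m using bnd[of m] by (simp add: add.commute)
  have "(\<lambda>m. ?X (m + k)) \<longlonglongrightarrow> lim ?X"
    using conv by (intro LIMSEQ_ignore_initial_segment) (simp add: convergent_LIMSEQ_iff)
  then have "(\<lambda>m. \<bar>?X (m + k) - ?X k\<bar>) \<longlonglongrightarrow> \<bar>lim ?X - ?X k\<bar>" by (intro tendsto_intros)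
  then show "\<bar>lim ?X - ?X k\<bar> \<le> B * q ^ k / (1 - q)"
    by (rule LIMSEQ_le_const2) (use * in auto)
qed

text \<open>Points at distance at most 2^-k have equal or neighbouring roundings at level k.\<close>

lemma same_level:
  assumes "0 \<le> s" "s \<le> t" "t \<le> real T" "t - s \<le> 1 / 2 ^ k"
  shows "\<bar>x (dyadic_floor k t) - x (dyadic_floor k s)\<bar> \<le> B * q ^ k"
proof -
  define i j where "i = nat \<lfloor>2 ^ k * s\<rfloor>" and "j = nat \<lfloor>2 ^ k * t\<rfloor>"
  have "2 ^ k * s \<le> 2 ^ k * t" using assms by (intro mult_left_mono) auto
  moreover have "2 ^ k * t \<le> 2 ^ k * s + 1"
  proof -
    have "2 ^ k * (t - s) \<le> 2 ^ k * (1 / 2 ^ k)" using assms by (intro mult_left_mono) auto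
    then show ?thesis by (simp add: algebra_simps)
  qed
  ultimately have "\<lfloor>2 ^ k * t\<rfloor> = \<lfloor>2 ^ k * s\<rfloor> \<or> \<lfloor>2 ^ k * t\<rfloor> = \<lfloor>2 ^ k * s\<rfloor> + 1" by linarith
  moreover have "\<lfloor>2 ^ k * s\<rfloor> \<ge> 0" using assms by simp
  ultimately have "j = i \<or> j = Suc i" unfolding i_def j_def by linarith
  moreover have "j \<le> T * 2 ^ k" unfolding j_def by (rule floor_le) (use assms in auto)
  ultimately show ?thesis
    using inc[of i k] B q by (auto simp: dyadic_floor_def simp flip: i_def j_def)
qed

lemma lim_increment:
  assumes "0 \<le> s" "s \<le> t" "t \<le> real T" "t - s \<le> 1 / 2 ^ k"
  shows "\<bar>lim (\<lambda>k. x (dyadic_floor k t)) - lim (\<lambda>k. x (dyadic_floor k s))\<bar> \<le> B * (1 + 2 / (1 - q)) * q ^ k"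
proof -
  have "\<bar>lim (\<lambda>k. x (dyadic_floor k t)) - x (dyadic_floor k t)\<bar> \<le> B * q ^ k / (1 - q)"
    "\<bar>lim (\<lambda>k. x (dyadic_floor k s)) - x (dyadic_floor k s)\<bar> \<le> B * q ^ k / (1 - q)"
    by (rule level_converges; use assms in simp)+
  moreover note same_level[OF assms]
  ultimately have "\<bar>lim (\<lambda>k. x (dyadic_floor k t)) - lim (\<lambda>k. x (dyadic_floor k s))\<bar>
      \<le> B * q ^ k + 2 * (B * q ^ k / (1 - q))" by linarith
  then show ?thesis by (simp add: algebra_simps)
qed

lemma integer_increment: "j \<le> T \<Longrightarrow> \<bar>x (real j) - x 0\<bar> \<le> B * real j"
proof (induction j)
  case (Suc j)
  have "\<bar>x (real (Suc j)) - x (real j)\<bar> \<le> B" using inc[of j 0] Suc.prems by simp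
  with Suc show ?case by (simp add: algebra_simps)
qed simp

text \<open>Points closer than 1 are compared at the level matching their distance. For distance at
  least 1 the right side is bounded below, and unit steps from 0 give a uniform bound on
  [0, T].\<close>

lemma holder:
  "\<exists>C. \<forall>s\<in>{0..real T}. \<forall>t\<in>{0..real T}. \<bar>lim (\<lambda>k. x (dyadic_floor k t)) - lim (\<lambda>k. x (dyadic_floor k s))\<bar> \<le> C * \<bar>t - s\<bar> powr \<gamma>"
proof -
  define y where "y t = lim (\<lambda>k. x (dyadic_floor k t))" for t
  \<comment> \<open>The factor 2 powr \<gamma> pays for replacing the mesh 2^-k by the distance,
    which may be as small as about half of it.\<close>
  define C1 where "C1 = B * (1 + 2 / (1 - q)) * 2 powr \<gamma>"
  define C2 where "C2 = 2 * (B / (1 - q)) + 2 * (B * real T)"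
  have C: "C1 \<ge> 0" "C2 \<ge> 0" using B q by (auto simp: C1_def C2_def)
  have main: "\<bar>y t - y s\<bar> \<le> (C1 + C2) * (t - s) powr \<gamma>" if st: "0 \<le> s" "s < t" "t \<le> real T" for s t
  proof (cases "t - s \<ge> 1")
    case True
    have f: "dyadic_floor 0 r = real (nat \<lfloor>r\<rfloor>)" for r by (simp add: dyadic_floor_def)
    have "\<bar>y r - x 0\<bar> \<le> B / (1 - q) + B * real T" if "0 \<le> r" "r \<le> real T" for r
    proof -
      have "nat \<lfloor>r\<rfloor> \<le> T" using floor_le[of r 0] that by simp
      then have "\<bar>x (dyadic_floor 0 r) - x 0\<bar> \<le> B * real (nat \<lfloor>r\<rfloor>)" unfolding f by (rule integer_increment)
      also have "\<dots> \<le> B * real T" using B \<open>nat \<lfloor>r\<rfloor> \<le> T\<close> by (intro mult_left_mono) auto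
      finally show ?thesis using level_converges(2)[OF that, of 0] by (simp add: y_def)
    qed
    from this[of s] this[of t] have "\<bar>y t - y s\<bar> \<le> C2" using st by (simp add: C2_def)
    also have "\<dots> \<le> (C1 + C2) * 1" using C by simp
    also have "\<dots> \<le> (C1 + C2) * (t - s) powr \<gamma>"
      using C True \<gamma> by (intro mult_left_mono ge_one_powr_ge_zero) auto
    finally show ?thesis .
  next
    case False
    \<comment> \<open>The level with 2^-(k+1) < t - s <= 2^-k.\<close>
    define k where "k = nat \<lfloor>- log 2 (t - s)\<rfloor>"
    have "- log 2 (t - s) \<ge> 0" using False st by simp
    then have "real k = of_int \<lfloor>- log 2 (t - s)\<rfloor>" unfolding k_def by (subst of_nat_nat) auto
    then have k: "real k \<le> - log 2 (t - s)" "- log 2 (t - s) < real k + 1" by linarith+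
    have "t - s = 2 powr (log 2 (t - s))" using st by simp
    also have "\<dots> \<le> 2 powr (- real k)" using k by (intro powr_mono) auto
    also have "\<dots> = 1 / 2 ^ k" by (simp add: powr_minus_divide powr_realpow)
    finally have "\<bar>y t - y s\<bar> \<le> B * (1 + 2 / (1 - q)) * q ^ k"
      using st unfolding y_def by (intro lim_increment) auto
    also have "q ^ k = (2 powr - (real k + 1)) powr \<gamma> * 2 powr \<gamma>"
    proof -
      have "q ^ k = q powr real k" by (simp add: powr_realpow)
      also have "\<dots> = 2 powr (- (real k + 1) * \<gamma> + \<gamma>)" by (simp add: powr_powr algebra_simps)
      also have "\<dots> = (2 powr - (real k + 1)) powr \<gamma> * 2 powr \<gamma>" by (simp only: powr_add powr_powr)
      finally show ?thesis .
    qed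
    also have "B * (1 + 2 / (1 - q)) * ((2 powr - (real k + 1)) powr \<gamma> * 2 powr \<gamma>) = C1 * (2 powr - (real k + 1)) powr \<gamma>"
      by (simp add: C1_def)
    also have "\<dots> \<le> C1 * (t - s) powr \<gamma>"
    proof (intro mult_left_mono powr_mono2)
      have "2 powr - (real k + 1) \<le> 2 powr (log 2 (t - s))" using k by (intro powr_mono) auto
      then show "2 powr - (real k + 1) \<le> t - s" using st by simp
    qed (use C \<gamma> in auto)
    also have "\<dots> \<le> (C1 + C2) * (t - s) powr \<gamma>" using C by (intro mult_right_mono) auto
    finally show ?thesis .
  qed
  have "\<bar>y t - y s\<bar> \<le> (C1 + C2) * \<bar>t - s\<bar> powr \<gamma>" if "s \<in> {0..real T}" "t \<in> {0..real T}" for s t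
    using main[of s t] main[of t s] that by (cases s t rule: linorder_cases) (auto simp: abs_minus_commute)
  then show ?thesis unfolding y_def by blast
qed

end

section \<open>From moment bounds to dyadic increments and a version with Hoelder paths\<close>

context prob_space
begin

text \<open>All p-th powers of dyadic increments, weighted by 2^(k p \<gamma>), are summed into one
  variable S. Its expectation is bounded by a geometric series of ratio 2^(p \<gamma> - e) < 1, so S
  is almost surely finite and bounds every increment.\<close>

lemma AE_dyadic_increments:
  fixes X :: "real \<Rightarrow> 'a \<Rightarrow> real" and p :: nat and C e \<gamma> :: real
  assumes X[measurable]: "\<And>t. t \<ge> 0 \<Longrightarrow> X t \<in> borel_measurable M"
    and moment: "\<And>s t. s \<ge> 0 \<Longrightarrow> t \<ge> 0 \<Longrightarrow> (\<integral>\<^sup>+ \<omega>. ennreal (\<bar>X t \<omega> - X s \<omega>\<bar> ^ p) \<partial>M) \<le> ennreal (C * \<bar>t - s\<bar> powr (1 + e))"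
    and p: "p \<ge> 1" and C: "C \<ge> 0" and \<gamma>: "\<gamma> > 0" "real p * \<gamma> < e"
  shows "AE \<omega> in M. \<exists>B. dyadic_increments (\<lambda>t. X t \<omega>) T B \<gamma>"
proof -
  define \<Delta> where "\<Delta> k j \<omega> = \<bar>X (real (Suc j) / 2 ^ k) \<omega> - X (real j / 2 ^ k) \<omega>\<bar>" for k j \<omega>
  have [measurable]: "\<Delta> k j \<in> borel_measurable M" for k j unfolding \<Delta>_def by measurable
  define r where "r = 2 powr (real p * \<gamma> - e)"
  have r: "0 < r" "r < 1" using \<gamma> by (auto simp: r_def powr_less_one)
  define a where "a = 2 powr (real p * \<gamma>)"
  have a: "a > 0" by (simp add: a_def)
  define S where "S \<omega> = (\<Sum>k. \<Sum>j<T * 2 ^ k. ennreal (a ^ k * \<Delta> k j \<omega> ^ p))" for \<omega>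
  have level: "(\<Sum>j<T * 2 ^ k. \<integral>\<^sup>+ \<omega>. ennreal (a ^ k * \<Delta> k j \<omega> ^ p) \<partial>M) \<le> ennreal (C * real T * r ^ k)" for k
  proof -
    have "(\<integral>\<^sup>+ \<omega>. ennreal (a ^ k * \<Delta> k j \<omega> ^ p) \<partial>M) \<le> ennreal (a ^ k * (C * (1 / 2 ^ k) powr (1 + e)))" for j
    proof -
      have "(\<integral>\<^sup>+ \<omega>. ennreal (a ^ k * \<Delta> k j \<omega> ^ p) \<partial>M) = ennreal (a ^ k) * (\<integral>\<^sup>+ \<omega>. ennreal (\<Delta> k j \<omega> ^ p) \<partial>M)"
        using a by (subst nn_integral_cmult[symmetric]) (auto simp: ennreal_mult' intro!: nn_integral_cong)
      also have "\<dots> \<le> ennreal (a ^ k) * ennreal (C * \<bar>real (Suc j) / 2 ^ k - real j / 2 ^ k\<bar> powr (1 + e))"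
        unfolding \<Delta>_def by (intro mult_left_mono moment) auto
      also have "real (Suc j) / 2 ^ k - real j / 2 ^ k = 1 / 2 ^ k" by (simp add: diff_divide_distrib[symmetric])
      finally show ?thesis using a C by (simp add: ennreal_mult'')
    qed
    then have "(\<Sum>j<T * 2 ^ k. \<integral>\<^sup>+ \<omega>. ennreal (a ^ k * \<Delta> k j \<omega> ^ p) \<partial>M) \<le> (\<Sum>j<T * 2 ^ k. ennreal (a ^ k * (C * (1 / 2 ^ k) powr (1 + e))))"
      by (intro sum_mono)
    also have "\<dots> = ennreal (\<Sum>j<T * 2 ^ k. a ^ k * (C * (1 / 2 ^ k) powr (1 + e)))"
      using a C by (intro sum_ennreal) auto
    also have "(\<Sum>j<T * 2 ^ k. a ^ k * (C * (1 / 2 ^ k) powr (1 + e))) = C * real T * r ^ k"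
    proof -
      \<comment> \<open>Level k has T 2^k intervals: the 1 in the exponent 1 + e pays for their
        number, and e beats the weight 2^(p \<gamma>).\<close>
      have "2 ^ k * (a ^ k * (1 / 2 ^ k) powr (1 + e)) = r ^ k"
      proof -
        have "(1 / 2 ^ k) powr (1 + e) = 2 powr (- (real k * (1 + e)))"
          by (simp add: powr_divide powr_minus_divide powr_powr flip: powr_realpow)
        moreover have "a ^ k = 2 powr (real p * \<gamma> * real k)" "r ^ k = 2 powr ((real p * \<gamma> - e) * real k)"
          by (simp_all only: a_def r_def powr_powr[symmetric]) (simp_all add: powr_realpow)
        moreover have "(2::real) ^ k = 2 powr real k" by (simp add: powr_realpow)
        ultimately have "2 ^ k * (a ^ k * (1 / 2 ^ k) powr (1 + e)) = 2 powr (real k + (real p * \<gamma> * real k + - (real k * (1 + e))))"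
          by (simp only: powr_add)
        also have "real k + (real p * \<gamma> * real k + - (real k * (1 + e))) = (real p * \<gamma> - e) * real k" by (simp add: algebra_simps)
        finally show ?thesis using \<open>r ^ k = 2 powr ((real p * \<gamma> - e) * real k)\<close> by simp
      qed
      then have "C * real T * (2 ^ k * (a ^ k * (1 / 2 ^ k) powr (1 + e))) = C * real T * r ^ k" by simp
      then show ?thesis by (simp add: mult_ac)
    qed
    finally show ?thesis .
  qed
  have "(\<integral>\<^sup>+ \<omega>. S \<omega> \<partial>M) = (\<Sum>k. \<Sum>j<T * 2 ^ k. \<integral>\<^sup>+ \<omega>. ennreal (a ^ k * \<Delta> k j \<omega> ^ p) \<partial>M)"
    unfolding S_def by (subst nn_integral_suminf; (subst nn_integral_sum)?; simp)
  also have "\<dots> \<le> (\<Sum>k. ennreal (C * real T * r ^ k))"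
    by (intro suminf_le level) auto
  also have "\<dots> = ennreal (\<Sum>k. C * real T * r ^ k)"
    using r C by (intro suminf_ennreal2 summable_mult summable_geometric) auto
  also have "\<dots> < \<infinity>" by simp
  finally have "(\<integral>\<^sup>+ \<omega>. S \<omega> \<partial>M) \<noteq> \<infinity>" by simp
  then have "AE \<omega> in M. S \<omega> \<noteq> \<infinity>"
    by (intro nn_integral_noteq_infinite) (auto simp: S_def)
  then show ?thesis
  proof eventually_elim
    fix \<omega> assume fin: "S \<omega> \<noteq> \<infinity>"
    define s where "s = enn2real (S \<omega>)"
    have s: "S \<omega> = ennreal s" "s \<ge> 0" using fin by (auto simp: s_def less_top)
    \<comment> \<open>The bound b^p <= s implies b <= 1 + s since p >= 1; this avoids p-th
      roots.\<close>
    have "dyadic_increments (\<lambda>t. X t \<omega>) T (1 + s) \<gamma>"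
    proof
      fix k j assume j: "j < T * 2 ^ k"
      define b where "b = 2 powr (\<gamma> * real k) * \<Delta> k j \<omega>"
      have b: "b \<ge> 0" by (simp add: b_def \<Delta>_def)
      have "ennreal (a ^ k * \<Delta> k j \<omega> ^ p) \<le> (\<Sum>j<T * 2 ^ k. ennreal (a ^ k * \<Delta> k j \<omega> ^ p))"
        using j by (intro member_le_sum) auto
      also have "\<dots> \<le> S \<omega>"
        using sum_le_suminf[of "\<lambda>k. \<Sum>j<T * 2 ^ k. ennreal (a ^ k * \<Delta> k j \<omega> ^ p)" "{k}"] by (simp add: S_def)
      finally have "a ^ k * \<Delta> k j \<omega> ^ p \<le> s" using s by simp
      also have "a ^ k * \<Delta> k j \<omega> ^ p = b ^ p"
      proof -
        have "a ^ k = (2 powr (\<gamma> * real k)) ^ p"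
          by (simp add: a_def powr_powr mult_ac flip: powr_realpow)
        then show ?thesis by (simp add: b_def power_mult_distrib)
      qed
      finally have bp: "b ^ p \<le> s" .
      have "b \<le> 1 + s"
      proof (cases "b \<le> 1")
        case False
        then have "b ^ 1 \<le> b ^ p" using p by (intro power_increasing) auto
        then show ?thesis using bp by simp
      qed (use s in simp)
      then have "2 powr (- \<gamma> * real k) * b \<le> 2 powr (- \<gamma> * real k) * (1 + s)" by (intro mult_left_mono) auto
      also have "2 powr (- \<gamma> * real k) * b = \<Delta> k j \<omega>" by (simp add: b_def powr_minus mult.assoc[symmetric])
      also have "2 powr (- \<gamma> * real k) = (2 powr - \<gamma>) ^ k" by (simp add: powr_powr flip: powr_realpow)
      finally show "\<bar>X (real (Suc j) / 2 ^ k) \<omega> - X (real j / 2 ^ k) \<omega>\<bar> \<le> (1 + s) * (2 powr - \<gamma>) ^ k"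
        by (simp add: \<Delta>_def mult.commute)
    qed (use s \<gamma> in auto)
    then show "\<exists>B. dyadic_increments (\<lambda>t. X t \<omega>) T B \<gamma>" ..
  qed
qed

text \<open>The version is the limit of X along dyadic roundings outside one null set and 0 on it,
  so every path is Hoelder. It agrees with X t almost surely by Fatou's lemma and the moment
  bound.\<close>

theorem kolmogorov_chentsov:
  fixes X :: "real \<Rightarrow> 'a \<Rightarrow> real" and p :: nat and C e \<gamma> :: real
  assumes X[measurable]: "\<And>t. t \<ge> 0 \<Longrightarrow> X t \<in> borel_measurable M"
    and moment: "\<And>s t. s \<ge> 0 \<Longrightarrow> t \<ge> 0 \<Longrightarrow> (\<integral>\<^sup>+ \<omega>. ennreal (\<bar>X t \<omega> - X s \<omega>\<bar> ^ p) \<partial>M) \<le> ennreal (C * \<bar>t - s\<bar> powr (1 + e))"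
    and p: "p \<ge> 1" and C: "C \<ge> 0" and \<gamma>: "\<gamma> > 0" "real p * \<gamma> < e"
  shows "\<exists>Y. is_version M X Y \<and> (\<forall>\<omega>\<in>space M. holder_on_compacts \<gamma> (\<lambda>t. Y t \<omega>))"
proof -
  have "AE \<omega> in M. \<forall>T. \<exists>B. dyadic_increments (\<lambda>t. X t \<omega>) T B \<gamma>"
    unfolding AE_all_countable using AE_dyadic_increments[OF assms] by blast
  then obtain N where N: "N \<in> null_sets M"
    and good: "\<And>\<omega>. \<omega> \<in> space M \<Longrightarrow> \<omega> \<notin> N \<Longrightarrow> \<forall>T. \<exists>B. dyadic_increments (\<lambda>t. X t \<omega>) T B \<gamma>"
    by (auto elim!: AE_E3)
  \<comment> \<open>Cutting off the null set before the limit makes \<open>Z k t\<close> converge at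
    every point of the space, which yields measurability of \<open>Y t\<close>.\<close>
  define Z where "Z k t \<omega> = indicator (- N) \<omega> * X (dyadic_floor k t) \<omega>" for k t \<omega>
  define Y where "Y t \<omega> = lim (\<lambda>k. Z k t \<omega>)" for t \<omega>
  have [measurable]: "N \<in> sets M" using N by auto
  have Y_bad: "Y t \<omega> = 0" if "\<omega> \<in> N" for t \<omega> using that by (simp add: Y_def Z_def)
  have Y_good: "Y t \<omega> = lim (\<lambda>k. X (dyadic_floor k t) \<omega>)" if "\<omega> \<notin> N" for t \<omega> using that by (simp add: Y_def Z_def)
  have conv: "(\<lambda>k. Z k t \<omega>) \<longlonglongrightarrow> Y t \<omega>" if t: "t \<ge> 0" and \<omega>: "\<omega> \<in> space M" for t \<omega>
  proof (cases "\<omega> \<in> N")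
    case False
    obtain T :: nat where T: "t \<le> real T" using real_arch_simple by blast
    obtain B where "dyadic_increments (\<lambda>t. X t \<omega>) T B \<gamma>" using good[OF \<omega> False] by blast
    from dyadic_increments.level_converges(1)[OF this t T] show ?thesis
      using False by (simp add: Y_good Z_def convergent_LIMSEQ_iff)
  qed (simp add: Y_bad Z_def)
  have Zm[measurable]: "Z k t \<in> borel_measurable M" if "t \<ge> 0" for k t
  proof -
    have [measurable]: "X (dyadic_floor k t) \<in> borel_measurable M" using dyadic_floor_bounds(1)[OF that] by (rule X)
    show ?thesis unfolding Z_def by measurable
  qed
  have Ym[measurable]: "Y t \<in> borel_measurable M" if "t \<ge> 0" for t
    by (rule borel_measurable_LIMSEQ_real[of M "\<lambda>k. Z k t"]) (use that conv in auto)
  have version: "AE \<omega> in M. Y t \<omega> = X t \<omega>" if t: "t \<ge> 0" for t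
  proof -
    note [measurable] = X[OF t] Ym[OF t] Zm[OF t]
    have notN: "AE \<omega> in M. \<omega> \<notin> N" using N by (rule AE_not_in)
    have e: "e > 0" using p \<gamma> by (meson less_trans mult_pos_pos of_nat_0_less_iff less_le_trans zero_less_one)
    have "(\<integral>\<^sup>+ \<omega>. ennreal (\<bar>Y t \<omega> - X t \<omega>\<bar> ^ p) \<partial>M) = (\<integral>\<^sup>+ \<omega>. liminf (\<lambda>k. ennreal (\<bar>Z k t \<omega> - X t \<omega>\<bar> ^ p)) \<partial>M)"
    proof (rule nn_integral_cong)
      fix \<omega> assume "\<omega> \<in> space M"
      then have "(\<lambda>k. ennreal (\<bar>Z k t \<omega> - X t \<omega>\<bar> ^ p)) \<longlonglongrightarrow> ennreal (\<bar>Y t \<omega> - X t \<omega>\<bar> ^ p)"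
        by (intro tendsto_ennrealI tendsto_intros conv t)
      then show "ennreal (\<bar>Y t \<omega> - X t \<omega>\<bar> ^ p) = liminf (\<lambda>k. ennreal (\<bar>Z k t \<omega> - X t \<omega>\<bar> ^ p))"
        using lim_imp_Liminf[OF sequentially_bot] by metis
    qed
    also have "\<dots> \<le> liminf (\<lambda>k. \<integral>\<^sup>+ \<omega>. ennreal (\<bar>Z k t \<omega> - X t \<omega>\<bar> ^ p) \<partial>M)"
      by (rule nn_integral_liminf) measurable
    also have "\<dots> \<le> liminf (\<lambda>k. ennreal (C * (1 / 2 ^ k) powr (1 + e)))"
    proof (rule Liminf_mono, rule always_eventually, rule allI)
      fix k
      have "(\<integral>\<^sup>+ \<omega>. ennreal (\<bar>Z k t \<omega> - X t \<omega>\<bar> ^ p) \<partial>M) = (\<integral>\<^sup>+ \<omega>. ennreal (\<bar>X t \<omega> - X (dyadic_floor k t) \<omega>\<bar> ^ p) \<partial>M)"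
        by (rule nn_integral_cong_AE) (use notN in eventually_elim, simp add: Z_def abs_minus_commute)
      also have "\<dots> \<le> ennreal (C * \<bar>t - dyadic_floor k t\<bar> powr (1 + e))"
        by (intro moment t dyadic_floor_bounds)
      also have "\<dots> \<le> ennreal (C * (1 / 2 ^ k) powr (1 + e))"
        using C e dyadic_floor_bounds[OF t, of k] by (intro ennreal_leI mult_left_mono powr_mono2) auto
      finally show "(\<integral>\<^sup>+ \<omega>. ennreal (\<bar>Z k t \<omega> - X t \<omega>\<bar> ^ p) \<partial>M) \<le> ennreal (C * (1 / 2 ^ k) powr (1 + e))" .
    qed
    also have "\<dots> = 0"
    proof -
      have "(\<lambda>k. (1 / 2 ^ k :: real)) \<longlonglongrightarrow> 0" using LIMSEQ_realpow_zero[of "1/2::real"] by (simp add: power_one_over)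
      then have "(\<lambda>k. C * (1 / 2 ^ k) powr (1 + e)) \<longlonglongrightarrow> C * 0 powr (1 + e)"
        using e by (intro tendsto_mult tendsto_const tendsto_powr2[OF _ tendsto_const]) auto
      then have "(\<lambda>k. ennreal (C * (1 / 2 ^ k) powr (1 + e))) \<longlonglongrightarrow> ennreal 0"
        by (intro tendsto_ennrealI) simp
      from lim_imp_Liminf[OF sequentially_bot this] show ?thesis by simp
    qed
    finally have "(\<integral>\<^sup>+ \<omega>. ennreal (\<bar>Y t \<omega> - X t \<omega>\<bar> ^ p) \<partial>M) = 0" by simp
    then have "AE \<omega> in M. ennreal (\<bar>Y t \<omega> - X t \<omega>\<bar> ^ p) = 0" by (subst (asm) nn_integral_0_iff_AE) auto
    then show ?thesis using p by (auto elim!: eventually_mono)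
  qed
  have "holder_on_compacts \<gamma> (\<lambda>t. Y t \<omega>)" if \<omega>: "\<omega> \<in> space M" for \<omega>
    unfolding holder_on_compacts_def
  proof (intro allI impI)
    fix T :: real assume "T > 0"
    show "\<exists>D. \<forall>s\<in>{0..T}. \<forall>t\<in>{0..T}. \<bar>Y t \<omega> - Y s \<omega>\<bar> \<le> D * \<bar>t - s\<bar> powr \<gamma>"
    proof (cases "\<omega> \<in> N")
      case True then show ?thesis by (auto simp: Y_bad intro!: exI[of _ 0])
    next
      case False
      obtain n :: nat where n: "T \<le> real n" using real_arch_simple by blast
      obtain B where "dyadic_increments (\<lambda>t. X t \<omega>) n B \<gamma>" using good[OF \<omega> False] by blast
      from dyadic_increments.holder[OF this] obtain D where
        "\<forall>s\<in>{0..real n}. \<forall>t\<in>{0..real n}. \<bar>lim (\<lambda>k. X (dyadic_floor k t) \<omega>) - lim (\<lambda>k. X (dyadic_floor k s) \<omega>)\<bar> \<le> D * \<bar>t - s\<bar> powr \<gamma>"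
        by blast
      then show ?thesis using n False by (intro exI[of _ D]) (auto simp: Y_good)
    qed
  qed
  then show ?thesis using version Ym unfolding is_version_def by blast
qed

end

section \<open>The Mandelbrot--Van Ness kernel\<close>

lemma has_bochner_integral_powr_from_0:
  fixes q c :: real
  assumes q: "q > 0"
  shows "has_bochner_integral lborel (\<lambda>r. indicator {0..c} r * r powr (q - 1)) (max c 0 powr q / q)"
proof (cases "c \<ge> 0")
  case True
  have "((\<lambda>x. x powr (q - 1)) has_integral (c powr (q - 1 + 1) / (q - 1 + 1))) {0..c}"
    by (rule has_integral_powr_from_0) (use True q in auto)
  then have "((\<lambda>x. if x \<in> {0..c} then x powr (q - 1) else 0) has_integral (c powr q / q)) UNIV"
    by (simp only: has_integral_restrict_UNIV diff_add_cancel)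
  moreover have "(\<lambda>x. if x \<in> {0..c} then x powr (q - 1) else 0) = (\<lambda>x. indicator {0..c} x * x powr (q - 1))"
    by (auto simp: fun_eq_iff)
  ultimately have "(\<integral>\<^sup>+ x. ennreal (indicator {0..c} x * x powr (q - 1)) \<partial>lborel) = ennreal (c powr q / q)"
    by (intro nn_integral_has_integral_lborel) auto
  then show ?thesis using True q
    by (intro has_bochner_integral_nn_integral) auto
next
  case False
  then have "(\<lambda>r. indicator {0..c} r * r powr (q - 1)) = (\<lambda>r. 0)" by auto
  then show ?thesis using False q by (simp add: has_bochner_integral_zero)
qed

lemma has_bochner_integral_powr_shift:
  fixes q c y :: real
  assumes q: "q > 0"
  shows "has_bochner_integral lborel (\<lambda>u. indicator {y..c} u * (u - y) powr (q - 1)) (max (c - y) 0 powr q / q)"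
proof -
  have "has_bochner_integral lborel (\<lambda>u. indicator {0..c - y} (- y + 1 * u) * (- y + 1 * u) powr (q - 1)) ((max (c - y) 0 powr q / q) /\<^sub>R \<bar>1\<bar>)"
    using has_bochner_integral_powr_from_0[OF q, of "c - y"]
    by (subst lborel_has_bochner_integral_real_affine_iff[symmetric, of 1]) auto
  moreover have "(\<lambda>u. indicator {0..c - y} (- y + 1 * u) * (- y + 1 * u) powr (q - 1)) = (\<lambda>u. indicator {y..c} u * (u - y) powr (q - 1))"
    by (auto simp: indicator_def)
  ultimately show ?thesis by simp
qed

text \<open>Up to null sets the integrand is the difference of the cut-offs at t and at 0; the
  maxima make one formula valid for every y. It is used with q = H - 1/2 for \<open>frac_I\<close>
  and with q = H + 1/2 inside the derivative of \<open>frac_D\<close>.\<close>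

lemma frac_integral_indicator:
  fixes q t y :: real
  assumes q: "q > 0" and t: "t \<ge> 0"
  shows "(LINT u:{y<..}|lborel. indicat_real {0..<t} u * (u - y) powr (q - 1)) = (max (t - y) 0 powr q - max (- y) 0 powr q) / q"
proof -
  let ?f = "\<lambda>c u. indicator {y..c} u * (u - y) powr (q - 1)"
  have "(LINT u:{y<..}|lborel. indicat_real {0..<t} u * (u - y) powr (q - 1)) = (LINT u|lborel. ?f t u - ?f 0 u)"
    unfolding set_lebesgue_integral_def
  proof (rule integral_cong_AE)
    show "AE u in lborel. indicat_real {y<..} u *\<^sub>R (indicat_real {0..<t} u * (u - y) powr (q - 1)) = ?f t u - ?f 0 u"
      using AE_lborel_singleton[of y] AE_lborel_singleton[of 0] AE_lborel_singleton[of t]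
      by eventually_elim (use t in \<open>auto simp: indicator_def\<close>)
  qed auto
  also have "\<dots> = max (t - y) 0 powr q / q - max (0 - y) 0 powr q / q"
    by (rule has_bochner_integral_integral_eq)
       (intro has_bochner_integral_diff has_bochner_integral_powr_shift q)
  finally show ?thesis by (simp add: diff_divide_distrib)
qed

text \<open>It vanishes for \<open>z \<le> 0\<close>, since \<open>0 powr r = 0\<close> for every \<open>r\<close>, negative and zero included.\<close>
definition mvn_kernel :: "real \<Rightarrow> real \<Rightarrow> real" where
  "mvn_kernel H z = max z 0 powr (H - 1/2)"

lemma mvn_kernel_simps: "z > 0 \<Longrightarrow> mvn_kernel H z = z powr (H - 1/2)" "z \<le> 0 \<Longrightarrow> mvn_kernel H z = 0"
  by (simp_all add: mvn_kernel_def max_def)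

lemma mvn_kernel_measurable [measurable]: "mvn_kernel H \<in> borel_measurable borel"
  unfolding mvn_kernel_def by measurable

lemma mvn_kernel_scale: "c > 0 \<Longrightarrow> mvn_kernel H (c * z) = c powr (H - 1/2) * mvn_kernel H z"
  by (cases "z > 0") (simp_all add: mvn_kernel_simps powr_mult mult_pos_pos mult_nonneg_nonpos not_less)

text \<open>The moving-average kernel of fractional Brownian motion; the constant is the one that
  gives it norm 1 at t = 1.\<close>

definition fbm_kernel :: "real \<Rightarrow> real \<Rightarrow> real \<Rightarrow> real" where
  "fbm_kernel H t x = frac_K H / Gamma (H + 1/2) * (mvn_kernel H (t - x) - mvn_kernel H (- x))"

lemma fbm_kernel_measurable [measurable]: "fbm_kernel H t \<in> borel_measurable borel"
  unfolding fbm_kernel_def by measurable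

lemma DERIV_max_powr:
  fixes q z :: real
  assumes "z \<noteq> 0" "q > 0"
  shows "((\<lambda>z. max z 0 powr q) has_real_derivative q * max z 0 powr (q - 1)) (at z)"
proof (cases "z > 0")
  case True
  have "((\<lambda>z. z powr q) has_real_derivative q * z powr (q - 1)) (at z)"
    by (rule has_real_derivative_powr) (use True in auto)
  then have "((\<lambda>z. max z 0 powr q) has_real_derivative q * z powr (q - 1)) (at z)"
    by (rule has_field_derivative_transform_within_open[where S = "{0<..}"]) (use True in auto)
  then show ?thesis using True by simp
next
  case False
  have "((\<lambda>z::real. 0::real) has_real_derivative 0) (at z)" by simp
  then have "((\<lambda>z. max z 0 powr q) has_real_derivative 0) (at z)"
    by (rule has_field_derivative_transform_within_open[where S = "{..<0}"]) (use assms False in auto)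
  then show ?thesis using False by simp
qed

text \<open>For H < 1/2, differentiating the power H + 1/2 leaves H - 1/2; for H > 1/2, the 1/q from
  integration turns Gamma(q) into Gamma(q+1). The excluded points are the corners where the
  derivative may fail.\<close>

lemma frac_M_indicator:
  assumes H: "0 < H" "H < 1" and t: "t \<ge> 0" and x: "x \<noteq> 0" "x \<noteq> t"
  shows "frac_M H (indicat_real {0..<t}) x = fbm_kernel H t x"
proof -
  consider "H < 1/2" | "H = 1/2" | "H > 1/2" by linarith
  then show ?thesis
  proof cases
    case 1
    define q where "q = H + 1/2"
    have q: "q > 0" using H by (simp add: q_def)
    have e: "- (1/2 - H) = q - 1" by (simp add: q_def)
    have "((\<lambda>y. (max (t - y) 0 powr q - max (- y) 0 powr q) / q) has_real_derivative
       (q * max (t - x) 0 powr (q - 1) * (- 1) - q * max (- x) 0 powr (q - 1) * (- 1)) / q) (at x)"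
      using x q by (intro DERIV_cdivide DERIV_diff DERIV_chain2[OF DERIV_max_powr]) (auto intro!: derivative_eq_intros)
    from DERIV_imp_deriv[OF this] have dv: "deriv (\<lambda>y. (max (t - y) 0 powr q - max (- y) 0 powr q) / q) x =
        - (max (t - x) 0 powr (q - 1)) + max (- x) 0 powr (q - 1)"
      using q by (simp add: diff_divide_distrib)
    have e': "1 - (1/2 - H) = q" by (simp add: q_def)
    have "frac_D (1/2 - H) (indicat_real {0..<t}) x = 1 / Gamma q * (max (t - x) 0 powr (q - 1) - max (- x) 0 powr (q - 1))"
      unfolding frac_D_def e e' frac_integral_indicator[OF q t] dv by (simp add: algebra_simps)
    then show ?thesis using 1 by (simp add: frac_M_def fbm_kernel_def mvn_kernel_def q_def)
  next
    case 2
    have "indicat_real {0<..} s *\<^sub>R ((1 + s) powr (1/2 - 1/2) - s powr (1/2 - 1/2))\<^sup>2 = 0" for s :: real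
      by (simp add: indicator_def)
    \<comment> \<open>At H = 1/2 the integral vanishes, 1/(2H) is 1 and Gamma(1) = 1. The kernel
      with exponent 0 is an indicator because 0 powr 0 = 0.\<close>
    then have K: "frac_K (1/2) = 1" unfolding frac_K_def set_lebesgue_integral_def by (simp only:) simp
    have "indicat_real {0..<t} x = mvn_kernel (1/2) (t - x) - mvn_kernel (1/2) (- x)"
      using x t by (auto simp: mvn_kernel_def indicator_def max_def)
    then show ?thesis unfolding 2 by (simp add: frac_M_def fbm_kernel_def K)
  next
    case 3
    define q where "q = H - 1/2"
    have q: "q > 0" using 3 by (simp add: q_def)
    have "q \<notin> \<int>\<^sub>\<le>\<^sub>0" using q by (auto elim!: nonpos_Ints_cases)
    then have G: "Gamma (H + 1/2) = q * Gamma q" using Gamma_plus1[of q] by (simp add: q_def add.commute)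
    have "frac_I (H - 1/2) (indicat_real {0..<t}) x = 1 / Gamma (H + 1/2) * (max (t - x) 0 powr q - max (- x) 0 powr q)"
      unfolding frac_I_def q_def[symmetric] frac_integral_indicator[OF q t] G by simp
    then show ?thesis using 3 by (simp add: frac_M_def fbm_kernel_def mvn_kernel_def q_def)
  qed
qed

lemma AE_frac_M_indicator:
  assumes "0 < H" "H < 1" "t \<ge> 0"
  shows "AE x in lborel. frac_M H (indicat_real {0..<t}) x = fbm_kernel H t x"
  using AE_lborel_singleton[of 0] AE_lborel_singleton[of t]
  by eventually_elim (rule frac_M_indicator[OF assms])

lemma frac_K_nonzero:
  assumes "0 < H"
  shows "frac_K H > 0"
proof -
  have "(LINT s:{0<..}|lborel. ((1 + s) powr (H - 1/2) - s powr (H - 1/2))\<^sup>2) \<ge> 0"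
    unfolding set_lebesgue_integral_def by (intro integral_nonneg_AE) auto
  then have "(LINT s:{0<..}|lborel. ((1 + s) powr (H - 1/2) - s powr (H - 1/2))\<^sup>2) + 1 / (2 * H) > 0"
    using assms by (simp add: add_nonneg_pos)
  then show ?thesis using assms unfolding frac_K_def by (intro mult_pos_pos Gamma_real_pos) auto
qed

text \<open>On x < 0 the reflection x = -s gives the integral in \<open>frac_K\<close>; on (0, 1)
  the kernel is a multiple of (1-x)^(H - 1/2) and gives 1/(2H); beyond 1 it vanishes. Their sum is
  exactly what \<open>frac_K\<close> normalises.\<close>

lemma fbm_kernel_norm_1:
  assumes H: "0 < H" and int: "integrable lborel (\<lambda>x. (fbm_kernel H 1 x)\<^sup>2)"
  shows "(LINT x|lborel. (fbm_kernel H 1 x)\<^sup>2) = 1"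
proof -
  define J where "J = (LINT s:{0<..}|lborel. ((1 + s) powr (H - 1/2) - s powr (H - 1/2))\<^sup>2)"
  define c where "c = frac_K H / Gamma (H + 1/2)"
  define g where "g x = (mvn_kernel H (1 - x) - mvn_kernel H (- x))\<^sup>2" for x
  have G: "Gamma (H + 1/2) > 0" using H by (intro Gamma_real_pos) auto
  have c: "c \<noteq> 0" using frac_K_nonzero[OF H] G by (simp add: c_def)
  have J0: "J \<ge> 0" unfolding J_def set_lebesgue_integral_def by (intro integral_nonneg_AE) auto
  have fg: "(fbm_kernel H 1 x)\<^sup>2 = c\<^sup>2 * g x" for x
    by (simp add: fbm_kernel_def c_def g_def power_mult_distrib power_divide)
  have [measurable]: "g \<in> borel_measurable borel" unfolding g_def by measurable
  have gint: "integrable lborel g" using int c unfolding fg by simp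
  have "has_bochner_integral lborel (\<lambda>u. indicator {0..1} (1 + (- 1) * u) * (1 + (- 1) * u) powr (2 * H - 1)) ((max 1 0 powr (2 * H) / (2 * H)) /\<^sub>R \<bar>- 1\<bar>)"
    using has_bochner_integral_powr_from_0[of "2 * H" 1] H
    by (subst lborel_has_bochner_integral_real_affine_iff[symmetric, of "- 1"]) auto
  then have part: "has_bochner_integral lborel (\<lambda>u. indicator {0..1} (1 + (- 1) * u) * (1 + (- 1) * u) powr (2 * H - 1)) (1 / (2 * H))" (is "has_bochner_integral _ ?p _")
    by simp
  have gp: "AE x in lborel. g x = indicator {..<0} x * g x + ?p x"
    using AE_lborel_singleton[of 0] AE_lborel_singleton[of 1]
  proof eventually_elim
    case (elim x)
    have *: "((1 - x) powr (H - 1/2))\<^sup>2 = (1 - x) powr (2 * H - 1)" if "x < 1"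
      using that by (simp add: power2_eq_square powr_add[symmetric])
    show ?case using elim
      by (cases "x < 0"; cases "x < 1") (auto simp: indicator_def g_def mvn_kernel_simps *)
  qed
  have "(LINT x|lborel. g x) = (LINT x|lborel. indicator {..<0} x * g x + ?p x)"
    by (rule integral_cong_AE[OF _ _ gp]) auto
  also have "\<dots> = (LINT x|lborel. indicator {..<0} x * g x) + (LINT x|lborel. ?p x)"
    using integrable_mult_indicator[OF _ gint, of "{..<0}"] has_bochner_integral_integrable part
    by (intro Bochner_Integration.integral_add) (auto simp: has_bochner_integral_iff)
  also have "(LINT x|lborel. ?p x) = 1 / (2 * H)" by (rule has_bochner_integral_integral_eq[OF part])
  also have "(LINT x|lborel. indicator {..<0} x * g x) = J"
    unfolding J_def set_lebesgue_integral_def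
    by (subst lborel_integral_real_affine[where c = "- 1" and t = 0])
       (auto intro!: Bochner_Integration.integral_cong simp: indicator_def g_def mvn_kernel_simps)
  finally have "(LINT x|lborel. (fbm_kernel H 1 x)\<^sup>2) = c\<^sup>2 * (J + 1 / (2 * H))"
    unfolding fg by simp
  moreover have "c = (J + 1 / (2 * H)) powr (- 1/2)"
    using G by (simp add: c_def frac_K_def J_def)
  then have "c\<^sup>2 = (J + 1 / (2 * H)) powr (- 1)"
    by (simp add: power2_eq_square powr_add[symmetric])
  moreover have "J + 1 / (2 * H) > 0" using J0 H by (simp add: add_nonneg_pos)
  ultimately show ?thesis by (simp add: powr_minus_divide)
qed

section \<open>Scaling, translation and norms of the kernel\<close>

lemma fbm_kernel_scale: "c > 0 \<Longrightarrow> fbm_kernel H (c * t) (c * x) = c powr (H - 1/2) * fbm_kernel H t x"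
  using mvn_kernel_scale[of c H "t - x"] mvn_kernel_scale[of c H "- x"]
  by (simp add: fbm_kernel_def right_diff_distrib diff_divide_distrib mult_ac)

lemma fbm_kernel_shift: "fbm_kernel H (t + h) x - fbm_kernel H h x = fbm_kernel H t (x - h)"
proof -
  have e: "t + h - x = t - (x - h)" by simp
  show ?thesis unfolding fbm_kernel_def e minus_diff_eq right_diff_distrib by simp
qed

lemma fbm_kernel_0 [simp]: "fbm_kernel H 0 = (\<lambda>x. 0)"
  by (simp add: fbm_kernel_def fun_eq_iff)

text \<open>Substituting x -> c x yields a Jacobian c and a kernel factor c^(H - 1/2), which is
  squared: c * c^(2H-1) = c^(2H).\<close>

lemma fbm_kernel_self_similar_norm:
  assumes c: "c > 0"
  shows "(LINT x|lborel. (\<Sum>i\<in>I. u i * fbm_kernel H (c * t i) x)\<^sup>2) = (LINT x|lborel. (\<Sum>i\<in>I. u i * (c powr H * fbm_kernel H (t i) x))\<^sup>2)"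
proof -
  have "(LINT x|lborel. (\<Sum>i\<in>I. u i * fbm_kernel H (c * t i) x)\<^sup>2) = c * (LINT x|lborel. (\<Sum>i\<in>I. u i * fbm_kernel H (c * t i) (c * x))\<^sup>2)"
    using c by (subst lborel_integral_real_affine[where c = c and t = 0]) auto
  also have "\<dots> = (LINT x|lborel. c * (\<Sum>i\<in>I. u i * fbm_kernel H (c * t i) (c * x))\<^sup>2)" by simp
  also have "\<dots> = (LINT x|lborel. (\<Sum>i\<in>I. u i * (c powr H * fbm_kernel H (t i) x))\<^sup>2)"
  proof (intro Bochner_Integration.integral_cong refl)
    fix x
    have "c * (c powr (H - 1/2))\<^sup>2 = (c powr H)\<^sup>2"
    proof -
      have "c * (c powr (H - 1/2))\<^sup>2 = c powr 1 * (c powr (H - 1/2) * c powr (H - 1/2))" using c by (simp add: power2_eq_square)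
      also have "\<dots> = c powr H * c powr H" unfolding powr_add[symmetric] by simp
      finally show ?thesis by (simp add: power2_eq_square)
    qed
    moreover have "(\<Sum>i\<in>I. u i * fbm_kernel H (c * t i) (c * x)) = c powr (H - 1/2) * (\<Sum>i\<in>I. u i * fbm_kernel H (t i) x)"
      by (simp add: fbm_kernel_scale[OF c] sum_distrib_left mult_ac)
    moreover have "(\<Sum>i\<in>I. u i * (c powr H * fbm_kernel H (t i) x)) = c powr H * (\<Sum>i\<in>I. u i * fbm_kernel H (t i) x)"
      by (simp add: sum_distrib_left mult_ac)
    ultimately show "c * (\<Sum>i\<in>I. u i * fbm_kernel H (c * t i) (c * x))\<^sup>2 = (\<Sum>i\<in>I. u i * (c powr H * fbm_kernel H (t i) x))\<^sup>2"
      by (simp only: power_mult_distrib mult.assoc[symmetric])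
  qed
  finally show ?thesis .
qed

lemma fbm_kernel_stationary_norm:
  "(LINT x|lborel. (\<Sum>i\<in>I. u i * (fbm_kernel H (t i + h) x - fbm_kernel H h x))\<^sup>2) = (LINT x|lborel. (\<Sum>i\<in>I. u i * fbm_kernel H (t i) x)\<^sup>2)"
proof -
  have "(LINT x|lborel. (\<Sum>i\<in>I. u i * fbm_kernel H (t i) x)\<^sup>2) = (LINT x|lborel. (\<Sum>i\<in>I. u i * fbm_kernel H (t i) (- h + 1 * x))\<^sup>2)"
    by (subst lborel_integral_real_affine[where c = 1 and t = "- h"]) auto
  then show ?thesis unfolding fbm_kernel_shift by simp
qed

text \<open>Translation by s and scaling by t - s reduce the increment to the kernel at time
  1.\<close>

lemma fbm_kernel_increment_norm:
  assumes H: "0 < H" and int: "integrable lborel (\<lambda>x. (fbm_kernel H 1 x)\<^sup>2)"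
  shows "(LINT x|lborel. (fbm_kernel H t x - fbm_kernel H s x)\<^sup>2) = \<bar>t - s\<bar> powr (2 * H)"
proof -
  have main: "(LINT x|lborel. (fbm_kernel H t x - fbm_kernel H s x)\<^sup>2) = (t - s) powr (2 * H)" if "s < t" for s t
  proof -
    \<comment> \<open>A one-element index set makes the two norm lemmas for linear combinations
      applicable.\<close>
    have "(LINT x|lborel. (fbm_kernel H t x - fbm_kernel H s x)\<^sup>2) = (LINT x|lborel. (\<Sum>i\<in>{()}. 1 * (fbm_kernel H ((t - s) * 1 + s) x - fbm_kernel H s x))\<^sup>2)"
      by simp
    also have "\<dots> = (LINT x|lborel. (\<Sum>i\<in>{()}. 1 * fbm_kernel H ((t - s) * 1) x)\<^sup>2)"
      by (rule fbm_kernel_stationary_norm)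
    also have "\<dots> = (LINT x|lborel. (\<Sum>i\<in>{()}. 1 * ((t - s) powr H * fbm_kernel H 1 x))\<^sup>2)"
      by (rule fbm_kernel_self_similar_norm) (use that in auto)
    also have "\<dots> = (LINT x|lborel. (t - s) powr (2 * H) * (fbm_kernel H 1 x)\<^sup>2)"
      by (intro Bochner_Integration.integral_cong) (auto simp: power_mult_distrib power2_eq_square powr_add[symmetric])
    also have "\<dots> = (t - s) powr (2 * H)" using fbm_kernel_norm_1[OF H int] by simp
    finally show ?thesis .
  qed
  show ?thesis
  proof (cases s t rule: linorder_cases)
    case greater
    have "(LINT x|lborel. (fbm_kernel H t x - fbm_kernel H s x)\<^sup>2) = (LINT x|lborel. (fbm_kernel H s x - fbm_kernel H t x)\<^sup>2)"
      by (intro Bochner_Integration.integral_cong) (auto simp: power2_commute)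
    then show ?thesis using main[OF greater] greater by simp
  qed (use main H in auto)
qed

section \<open>Pairings with square-integrable functions\<close>

lemma integrable_square_lincomb:
  fixes f g :: "'a \<Rightarrow> real"
  assumes [measurable]: "f \<in> borel_measurable M" "g \<in> borel_measurable M"
    and "integrable M (\<lambda>x. (f x)\<^sup>2)" "integrable M (\<lambda>x. (g x)\<^sup>2)"
  shows "integrable M (\<lambda>x. (a * f x + b * g x)\<^sup>2)"
    and "(LINT x|M. (a * f x + b * g x)\<^sup>2) \<le> 2 * a\<^sup>2 * (LINT x|M. (f x)\<^sup>2) + 2 * b\<^sup>2 * (LINT x|M. (g x)\<^sup>2)"
proof -
  have le: "(a * f x + b * g x)\<^sup>2 \<le> 2 * a\<^sup>2 * (f x)\<^sup>2 + 2 * b\<^sup>2 * (g x)\<^sup>2" for x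
    using sum_squares_bound[of "a * f x" "b * g x"] by (simp add: power2_sum power_mult_distrib)
  have int: "integrable M (\<lambda>x. 2 * a\<^sup>2 * (f x)\<^sup>2 + 2 * b\<^sup>2 * (g x)\<^sup>2)" using assms by auto
  show 1: "integrable M (\<lambda>x. (a * f x + b * g x)\<^sup>2)"
  proof (rule Bochner_Integration.integrable_bound[OF int])
    show "AE x in M. norm ((a * f x + b * g x)\<^sup>2) \<le> norm (2 * a\<^sup>2 * (f x)\<^sup>2 + 2 * b\<^sup>2 * (g x)\<^sup>2)"
      using le by (intro AE_I2) (simp add: abs_of_nonneg)
  qed measurable
  have "(LINT x|M. (a * f x + b * g x)\<^sup>2) \<le> (LINT x|M. 2 * a\<^sup>2 * (f x)\<^sup>2 + 2 * b\<^sup>2 * (g x)\<^sup>2)"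
    by (intro integral_mono 1 int le)
  also have "\<dots> = 2 * a\<^sup>2 * (LINT x|M. (f x)\<^sup>2) + 2 * b\<^sup>2 * (LINT x|M. (g x)\<^sup>2)"
    using assms by simp
  finally show "(LINT x|M. (a * f x + b * g x)\<^sup>2) \<le> \<dots>" .
qed

lemma L2_tendsto_lincomb:
  assumes f: "L2_tendsto M f F" and g: "L2_tendsto M g G"
  shows "L2_tendsto M (\<lambda>n x. a * f n x + b * g n x) (\<lambda>x. a * F x + b * G x)"
proof -
  have f': "\<And>n. f n \<in> borel_measurable M" "\<And>n. integrable M (\<lambda>x. (f n x)\<^sup>2)" "F \<in> borel_measurable M"
    "integrable M (\<lambda>x. (F x)\<^sup>2)" "(\<lambda>n. LINT x|M. (f n x - F x)\<^sup>2) \<longlonglongrightarrow> 0"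
    using f by (auto simp: L2_tendsto_def)
  have g': "\<And>n. g n \<in> borel_measurable M" "\<And>n. integrable M (\<lambda>x. (g n x)\<^sup>2)" "G \<in> borel_measurable M"
    "integrable M (\<lambda>x. (G x)\<^sup>2)" "(\<lambda>n. LINT x|M. (g n x - G x)\<^sup>2) \<longlonglongrightarrow> 0"
    using g by (auto simp: L2_tendsto_def)
  note [measurable] = f'(1,3) g'(1,3)
  have df: "integrable M (\<lambda>x. (f n x - F x)\<^sup>2)" for n
    using integrable_square_lincomb(1)[OF f'(1)[of n] f'(3) f'(2)[of n] f'(4), of 1 "-1"] by simp
  have dg: "integrable M (\<lambda>x. (g n x - G x)\<^sup>2)" for n
    using integrable_square_lincomb(1)[OF g'(1)[of n] g'(3) g'(2)[of n] g'(4), of 1 "-1"] by simp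
  have "(\<lambda>n. LINT x|M. (a * (f n x - F x) + b * (g n x - G x))\<^sup>2) \<longlonglongrightarrow> 0"
  proof (rule tendsto_sandwich[OF _ _ tendsto_const])
    show "\<forall>\<^sub>F n in sequentially. 0 \<le> (LINT x|M. (a * (f n x - F x) + b * (g n x - G x))\<^sup>2)" by simp
    show "\<forall>\<^sub>F n in sequentially. (LINT x|M. (a * (f n x - F x) + b * (g n x - G x))\<^sup>2)
        \<le> 2 * a\<^sup>2 * (LINT x|M. (f n x - F x)\<^sup>2) + 2 * b\<^sup>2 * (LINT x|M. (g n x - G x)\<^sup>2)"
      by (intro always_eventually allI integrable_square_lincomb(2) df dg) measurable
    show "(\<lambda>n. 2 * a\<^sup>2 * (LINT x|M. (f n x - F x)\<^sup>2) + 2 * b\<^sup>2 * (LINT x|M. (g n x - G x)\<^sup>2)) \<longlonglongrightarrow> 0"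
      using tendsto_add[OF tendsto_mult_right_zero[OF f'(5), of "2 * a\<^sup>2"] tendsto_mult_right_zero[OF g'(5), of "2 * b\<^sup>2"]] by simp
  qed
  moreover have "a * (f n x - F x) + b * (g n x - G x) = a * f n x + b * g n x - (a * F x + b * G x)" for n x
    by (simp add: algebra_simps)
  moreover have "integrable M (\<lambda>x. (a * f n x + b * g n x)\<^sup>2)" for n
    by (intro integrable_square_lincomb(1) f' g')
  moreover have "integrable M (\<lambda>x. (a * F x + b * G x)\<^sup>2)"
    by (intro integrable_square_lincomb(1) f' g')
  ultimately show ?thesis unfolding L2_tendsto_def by simp
qed

text \<open>Young's inequality with a free parameter e gives |f^2 - F^2| <= e F^2 + (1 + 1/e) (f -
  F)^2 pointwise. First e is chosen small, then n large.\<close>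

lemma L2_tendsto_norm:
  assumes f: "L2_tendsto M f F"
  shows "(\<lambda>n. LINT x|M. (f n x)\<^sup>2) \<longlonglongrightarrow> (LINT x|M. (F x)\<^sup>2)"
proof -
  have f': "\<And>n. f n \<in> borel_measurable M" "\<And>n. integrable M (\<lambda>x. (f n x)\<^sup>2)" "F \<in> borel_measurable M"
    "integrable M (\<lambda>x. (F x)\<^sup>2)" "(\<lambda>n. LINT x|M. (f n x - F x)\<^sup>2) \<longlonglongrightarrow> 0"
    using f by (auto simp: L2_tendsto_def)
  note [measurable] = f'(1,3)
  define A where "A = (LINT x|M. (F x)\<^sup>2)"
  have A: "A \<ge> 0" by (simp add: A_def)
  define d where "d n = (LINT x|M. (f n x - F x)\<^sup>2)" for n
  have df: "integrable M (\<lambda>x. (f n x - F x)\<^sup>2)" for n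
    using integrable_square_lincomb(1)[OF f'(1)[of n] f'(3) f'(2)[of n] f'(4), of 1 "-1"] by simp
  have bound: "\<bar>(LINT x|M. (f n x)\<^sup>2) - A\<bar> \<le> e * A + (1 + 1 / e) * d n" if e: "e > 0" for n e
  proof -
    have "\<bar>(f n x)\<^sup>2 - (F x)\<^sup>2\<bar> \<le> e * (F x)\<^sup>2 + (1 + 1 / e) * (f n x - F x)\<^sup>2" for x
    proof -
      define h where "h = f n x - F x"
      have fx: "(f n x)\<^sup>2 - (F x)\<^sup>2 = 2 * F x * h + h\<^sup>2" by (simp add: h_def power2_eq_square algebra_simps)
      have "2 * \<bar>sqrt e * F x\<bar> * \<bar>h / sqrt e\<bar> \<le> (sqrt e * F x)\<^sup>2 + (h / sqrt e)\<^sup>2"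
        using sum_squares_bound[of "\<bar>sqrt e * F x\<bar>" "\<bar>h / sqrt e\<bar>"] unfolding power2_abs .
      also have "2 * \<bar>sqrt e * F x\<bar> * \<bar>h / sqrt e\<bar> = \<bar>2 * F x * h\<bar>" using e by (simp add: abs_mult)
      also have "(sqrt e * F x)\<^sup>2 + (h / sqrt e)\<^sup>2 = e * (F x)\<^sup>2 + 1 / e * h\<^sup>2"
        using e by (simp add: power_mult_distrib power_divide)
      finally have "\<bar>2 * F x * h\<bar> \<le> e * (F x)\<^sup>2 + 1 / e * h\<^sup>2" .
      moreover have "\<bar>2 * F x * h + h\<^sup>2\<bar> \<le> \<bar>2 * F x * h\<bar> + h\<^sup>2" using abs_triangle_ineq[of "2 * F x * h" "h\<^sup>2"] by simp
      ultimately show ?thesis unfolding fx h_def[symmetric] distrib_right by linarith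
    qed
    then have "(LINT x|M. \<bar>(f n x)\<^sup>2 - (F x)\<^sup>2\<bar>) \<le> (LINT x|M. e * (F x)\<^sup>2 + (1 + 1 / e) * (f n x - F x)\<^sup>2)"
      using f' df by (intro integral_mono) auto
    also have "\<dots> = e * A + (1 + 1 / e) * d n" using f' df by (simp add: A_def d_def)
    finally have "(LINT x|M. \<bar>(f n x)\<^sup>2 - (F x)\<^sup>2\<bar>) \<le> e * A + (1 + 1 / e) * d n" .
    moreover have "(LINT x|M. (f n x)\<^sup>2) - A = (LINT x|M. (f n x)\<^sup>2 - (F x)\<^sup>2)" using f' by (simp add: A_def)
    moreover have "\<bar>LINT x|M. (f n x)\<^sup>2 - (F x)\<^sup>2\<bar> \<le> (LINT x|M. \<bar>(f n x)\<^sup>2 - (F x)\<^sup>2\<bar>)" by (rule integral_abs_bound)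
    ultimately show ?thesis by linarith
  qed
  show ?thesis unfolding A_def[symmetric]
  proof (rule LIMSEQ_I)
    fix r :: real assume r: "r > 0"
    \<comment> \<open>A + 1 instead of A, as A may be 0; still e A <= r/2.\<close>
    define e where "e = r / (2 * (A + 1))"
    have e: "e > 0" using r A by (simp add: e_def)
    have eA: "e * A \<le> r / 2" using r A by (simp add: e_def field_simps)
    have "(\<lambda>n. (1 + 1 / e) * d n) \<longlonglongrightarrow> 0"
      using tendsto_mult_right_zero[OF f'(5), of "1 + 1 / e"] by (simp add: d_def)
    then have "\<forall>\<^sub>F n in sequentially. (1 + 1 / e) * d n < r / 2"
      by (rule order_tendstoD) (use r in simp)
    then obtain N where N: "\<And>n. n \<ge> N \<Longrightarrow> (1 + 1 / e) * d n < r / 2" unfolding eventually_sequentially by blast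
    show "\<exists>N. \<forall>n\<ge>N. norm ((LINT x|M. (f n x)\<^sup>2) - A) < r"
    proof (intro exI allI impI)
      fix n assume "n \<ge> N"
      show "norm ((LINT x|M. (f n x)\<^sup>2) - A) < r" using bound[OF e, of n] eA N[OF \<open>n \<ge> N\<close>] unfolding real_norm_def by linarith
    qed
  qed
qed

lemma L2_tendsto_AE_cong:
  assumes "L2_tendsto M f F" "AE x in M. F x = G x" "G \<in> borel_measurable M"
  shows "L2_tendsto M f G"
proof -
  have [measurable]: "F \<in> borel_measurable M" "\<And>n. f n \<in> borel_measurable M" using assms(1) by (auto simp: L2_tendsto_def)
  note [measurable] = assms(3)
  have "integrable M (\<lambda>x. (G x)\<^sup>2) \<longleftrightarrow> integrable M (\<lambda>x. (F x)\<^sup>2)"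
    by (rule integrable_cong_AE) (use assms(2) in auto)
  moreover have "(LINT x|M. (f n x - G x)\<^sup>2) = (LINT x|M. (f n x - F x)\<^sup>2)" for n
    by (rule integral_cong_AE) (use assms(2) in auto)
  ultimately show ?thesis using assms unfolding L2_tendsto_def by simp
qed

lemma cmod_iexp_diff_le: "cmod (iexp a - iexp b) \<le> \<bar>a - b\<bar>"
proof -
  have "iexp a - iexp b = iexp b * (iexp (a - b) - 1)"
    by (simp add: right_diff_distrib exp_add[symmetric] algebra_simps)
  then have "cmod (iexp a - iexp b) = cmod (iexp (a - b) - 1)" by (simp add: norm_mult)
  also have "\<dots> \<le> \<bar>a - b\<bar>" using iexp_approx1[of "a - b" 0] by simp
  finally show ?thesis .
qed

text \<open>The exponential is 1-Lipschitz, and the mean of |Y n - Z| is at most the root of its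
  second moment because a variance is non-negative.\<close>

lemma (in prob_space) L2_tendsto_char:
  assumes Y: "L2_tendsto M Y Z"
  shows "(\<lambda>n. LINT \<omega>|M. iexp (Y n \<omega>)) \<longlonglongrightarrow> (LINT \<omega>|M. iexp (Z \<omega>))"
proof -
  have f': "\<And>n. Y n \<in> borel_measurable M" "\<And>n. integrable M (\<lambda>x. (Y n x)\<^sup>2)" "Z \<in> borel_measurable M"
    "integrable M (\<lambda>x. (Z x)\<^sup>2)" "(\<lambda>n. LINT x|M. (Y n x - Z x)\<^sup>2) \<longlonglongrightarrow> 0"
    using Y by (auto simp: L2_tendsto_def)
  note [measurable] = f'(1,3)
  have bd: "cmod ((LINT \<omega>|M. iexp (Y n \<omega>)) - (LINT \<omega>|M. iexp (Z \<omega>))) \<le> sqrt (LINT x|M. (Y n x - Z x)\<^sup>2)" for n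
  proof -
    define D where "D \<omega> = \<bar>Y n \<omega> - Z \<omega>\<bar>" for \<omega>
    have [measurable]: "D \<in> borel_measurable M" unfolding D_def by measurable
    have D2: "integrable M (\<lambda>\<omega>. (D \<omega>)\<^sup>2)"
      using integrable_square_lincomb(1)[OF f'(1)[of n] f'(3) f'(2)[of n] f'(4), of 1 "-1"] by (simp add: D_def)
    have D: "integrable M D" by (rule square_integrable_imp_integrable) (use D2 in auto)
    have int: "integrable M (\<lambda>\<omega>. iexp (V \<omega>))" if [measurable]: "V \<in> borel_measurable M" for V :: "_ \<Rightarrow> real"
      by (rule integrable_const_bound[of _ 1]) auto
    have "(LINT \<omega>|M. iexp (Y n \<omega>)) - (LINT \<omega>|M. iexp (Z \<omega>)) = (LINT \<omega>|M. iexp (Y n \<omega>) - iexp (Z \<omega>))"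
      using int[of "Y n"] int[of Z] by simp
    also have "cmod \<dots> \<le> (LINT \<omega>|M. cmod (iexp (Y n \<omega>) - iexp (Z \<omega>)))" by (rule integral_norm_bound)
    also have "\<dots> \<le> (LINT \<omega>|M. D \<omega>)"
      using int[of "Y n"] int[of Z] D[unfolded D_def[abs_def]] by (intro integral_mono) (auto simp: D_def cmod_iexp_diff_le)
    also have "\<dots> \<le> sqrt (LINT \<omega>|M. (D \<omega>)\<^sup>2)"
    proof (rule real_le_rsqrt)
      have "0 \<le> variance D" by (rule variance_positive)
      then show "(expectation D)\<^sup>2 \<le> (LINT \<omega>|M. (D \<omega>)\<^sup>2)" using variance_eq[OF D D2] by simp
    qed
    finally show ?thesis by (simp add: D_def)
  qed
  have "(\<lambda>n. sqrt (LINT x|M. (Y n x - Z x)\<^sup>2)) \<longlonglongrightarrow> 0" using tendsto_real_sqrt[OF f'(5)] by simp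
  then have "(\<lambda>n. (LINT \<omega>|M. iexp (Y n \<omega>)) - (LINT \<omega>|M. iexp (Z \<omega>))) \<longlonglongrightarrow> 0"
    by (rule Lim_null_comparison[OF always_eventually[OF allI[OF bd]]])
  then show ?thesis by (simp add: LIM_zero_iff)
qed

section \<open>Linear structure of the Schwartz space and of its dual\<close>

lemma schwartz_deriv_lincomb:
  assumes "f \<in> schwartz" "g \<in> schwartz"
  shows "(deriv ^^ j) (\<lambda>x. a * f x + b * g x) = (\<lambda>x. a * (deriv ^^ j) f x + b * (deriv ^^ j) g x)"
proof (induction j)
  case (Suc j)
  have d: "((deriv ^^ j) f has_field_derivative deriv ((deriv ^^ j) f) x) (at x)"
    "((deriv ^^ j) g has_field_derivative deriv ((deriv ^^ j) g) x) (at x)" for x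
    using assms by (auto simp: schwartz_def intro: field_differentiable_derivI)
  have "deriv (\<lambda>x. a * (deriv ^^ j) f x + b * (deriv ^^ j) g x) x = a * deriv ((deriv ^^ j) f) x + b * deriv ((deriv ^^ j) g) x" for x
    by (intro DERIV_imp_deriv DERIV_add DERIV_cmult d)
  then show ?case by (simp add: Suc.IH)
qed simp

lemma schwartz_lincomb:
  assumes "f \<in> schwartz" "g \<in> schwartz"
  shows "(\<lambda>x. a * f x + b * g x) \<in> schwartz"
  unfolding schwartz_def
proof (intro CollectI conjI allI)
  fix j x
  show "(deriv ^^ j) (\<lambda>x. a * f x + b * g x) field_differentiable at x"
    unfolding schwartz_deriv_lincomb[OF assms] using assms
    by (intro field_differentiable_add field_differentiable_mult field_differentiable_const) (auto simp: schwartz_def)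
next
  fix k j
  have "bounded (range (\<lambda>x. x ^ k * (deriv ^^ j) f x))" "bounded (range (\<lambda>x. x ^ k * (deriv ^^ j) g x))"
    using assms by (auto simp: schwartz_def)
  then obtain C D where C: "\<And>x. \<bar>x ^ k * (deriv ^^ j) f x\<bar> \<le> C" and D: "\<And>x. \<bar>x ^ k * (deriv ^^ j) g x\<bar> \<le> D"
    unfolding bounded_iff by auto
  show "bounded (range (\<lambda>x. x ^ k * (deriv ^^ j) (\<lambda>x. a * f x + b * g x) x))"
    unfolding bounded_iff schwartz_deriv_lincomb[OF assms]
  proof (intro exI ballI)
    fix y assume "y \<in> range (\<lambda>x. x ^ k * (a * (deriv ^^ j) f x + b * (deriv ^^ j) g x))"
    then obtain x where y: "y = a * (x ^ k * (deriv ^^ j) f x) + b * (x ^ k * (deriv ^^ j) g x)"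
      by (auto simp: algebra_simps)
    have "\<bar>y\<bar> \<le> \<bar>a\<bar> * \<bar>x ^ k * (deriv ^^ j) f x\<bar> + \<bar>b\<bar> * \<bar>x ^ k * (deriv ^^ j) g x\<bar>"
      unfolding y by (metis abs_mult abs_triangle_ineq)
    also have "\<dots> \<le> \<bar>a\<bar> * C + \<bar>b\<bar> * D" by (intro add_mono mult_left_mono C D) auto
    finally show "norm y \<le> \<bar>a\<bar> * C + \<bar>b\<bar> * D" by simp
  qed
qed

lemma tempered_lincomb:
  assumes "\<omega> \<in> tempered" "f \<in> schwartz" "g \<in> schwartz"
  shows "\<omega> (\<lambda>x. a * f x + b * g x) = a * \<omega> f + b * \<omega> g"
proof -
  have s: "(\<lambda>x. r * h x) \<in> schwartz" if "h \<in> schwartz" for r h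
    using schwartz_lincomb[OF that that, of r 0] by simp
  have "\<omega> (\<lambda>x. a * f x + b * g x) = \<omega> (\<lambda>x. a * f x) + \<omega> (\<lambda>x. b * g x)"
  proof -
    have "\<forall>\<phi>\<in>schwartz. \<forall>\<psi>\<in>schwartz. \<omega> (\<lambda>x. \<phi> x + \<psi> x) = \<omega> \<phi> + \<omega> \<psi>"
      using assms(1) by (simp add: tempered_def)
    from bspec[OF bspec[OF this s[OF assms(2)]] s[OF assms(3)]] show ?thesis .
  qed
  also have "\<dots> = a * \<omega> f + b * \<omega> g" using assms by (auto simp: tempered_def)
  finally show ?thesis .
qed

section \<open>Pairings when the characteristic functional depends on the norm only\<close>

lemma is_pairing_measurable: "is_pairing M f Y \<Longrightarrow> Y \<in> borel_measurable M"
  unfolding is_pairing_def L2_tendsto_def by blast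

lemma is_pairing_cong:
  assumes "is_pairing M f Y" "AE x in lborel. f x = g x" "g \<in> borel_measurable lborel"
  shows "is_pairing M g Y"
  using assms L2_tendsto_AE_cong unfolding is_pairing_def by blast

text \<open>Isolates what the laws of pairings require of the Fox-H measure. The pairing with
  \<open>f0\<close> of positive norm guarantees a test function that does not vanish almost
  everywhere.\<close>

locale radial_char_measure = prob_space M for M :: "((real \<Rightarrow> real) \<Rightarrow> real) measure" +
  fixes \<Phi> :: "real \<Rightarrow> complex" and f0 :: "real \<Rightarrow> real" and Y0 :: "((real \<Rightarrow> real) \<Rightarrow> real) \<Rightarrow> real"
  assumes sets_M: "sets M = sets cylinder_space"
    and char_M: "\<And>\<phi>. \<phi> \<in> schwartz \<Longrightarrow> (LINT \<omega>|M. iexp (\<omega> \<phi>)) = \<Phi> (LINT x|lborel. (\<phi> x)\<^sup>2)"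
    and f0: "is_pairing M f0 Y0" "(LINT x|lborel. (f0 x)\<^sup>2) > 0"
begin

lemma space_M: "space M = tempered"
proof -
  have "space M = space cylinder_space" using sets_M by (rule sets_eq_imp_space_eq)
  also have "\<dots> = tempered" unfolding cylinder_space_def by (rule space_measure_of) auto
  finally show ?thesis .
qed

lemma is_pairing_lincomb:
  assumes "is_pairing M f Y" "is_pairing M g Z"
  shows "is_pairing M (\<lambda>x. a * f x + b * g x) (\<lambda>\<omega>. a * Y \<omega> + b * Z \<omega>)"
proof -
  obtain \<phi> where \<phi>: "\<And>n. \<phi> n \<in> schwartz" "L2_tendsto lborel \<phi> f" "L2_tendsto M (\<lambda>n \<omega>. \<omega> (\<phi> n)) Y"
    using assms(1) unfolding is_pairing_def by blast
  obtain \<psi> where \<psi>: "\<And>n. \<psi> n \<in> schwartz" "L2_tendsto lborel \<psi> g" "L2_tendsto M (\<lambda>n \<omega>. \<omega> (\<psi> n)) Z"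
    using assms(2) unfolding is_pairing_def by blast
  have eq: "\<omega> (\<lambda>x. a * \<phi> n x + b * \<psi> n x) = a * \<omega> (\<phi> n) + b * \<omega> (\<psi> n)" if "\<omega> \<in> space M" for n \<omega>
    using that \<phi>(1) \<psi>(1) by (intro tempered_lincomb) (auto simp: space_M)
  \<comment> \<open>Linearity in the test function is known only for tempered functionals, so the
    two sequences are identified on \<open>space M\<close> only.\<close>
  have "L2_tendsto M (\<lambda>n \<omega>. \<omega> (\<lambda>x. a * \<phi> n x + b * \<psi> n x)) (\<lambda>\<omega>. a * Y \<omega> + b * Z \<omega>) \<longleftrightarrow>
     L2_tendsto M (\<lambda>n \<omega>. a * \<omega> (\<phi> n) + b * \<omega> (\<psi> n)) (\<lambda>\<omega>. a * Y \<omega> + b * Z \<omega>)"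
    unfolding L2_tendsto_def using eq
    by (simp cong: measurable_cong Bochner_Integration.integrable_cong Bochner_Integration.integral_cong)
  then show ?thesis
    unfolding is_pairing_def using L2_tendsto_lincomb[OF \<phi>(2) \<psi>(2)] L2_tendsto_lincomb[OF \<phi>(3) \<psi>(3)] \<phi>(1) \<psi>(1)
    by (intro exI[of _ "\<lambda>n x. a * \<phi> n x + b * \<psi> n x"]) (auto intro: schwartz_lincomb)
qed

lemma is_pairing_sum:
  assumes "finite I" "\<And>i. i \<in> I \<Longrightarrow> is_pairing M (f i) (Y i)"
  shows "is_pairing M (\<lambda>x. \<Sum>i\<in>I. u i * f i x) (\<lambda>\<omega>. \<Sum>i\<in>I. u i * Y i \<omega>)"
  using assms
proof (induction I)
  case empty
  \<comment> \<open>The zero function is paired with 0 as the trivial combination of the one pairing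
    at hand.\<close>
  show ?case using is_pairing_lincomb[OF f0(1) f0(1), of 0 0] by simp
next
  case (insert k I)
  then have "is_pairing M (\<lambda>x. u k * f k x + 1 * (\<Sum>i\<in>I. u i * f i x)) (\<lambda>\<omega>. u k * Y k \<omega> + 1 * (\<Sum>i\<in>I. u i * Y i \<omega>))"
    by (intro is_pairing_lincomb) auto
  with insert.hyps show ?case by simp
qed

lemma char_scaled:
  assumes "\<phi> \<in> schwartz"
  shows "(LINT \<omega>|M. iexp (u * \<omega> \<phi>)) = \<Phi> (u\<^sup>2 * (LINT x|lborel. (\<phi> x)\<^sup>2))"
proof -
  have s: "(\<lambda>x. u * \<phi> x) \<in> schwartz" using schwartz_lincomb[OF assms assms, of u 0] by simp
  have "(LINT \<omega>|M. iexp (u * \<omega> \<phi>)) = (LINT \<omega>|M. iexp (\<omega> (\<lambda>x. u * \<phi> x)))"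
    using tempered_lincomb[OF _ assms assms, of _ u 0]
    by (intro Bochner_Integration.integral_cong) (auto simp: space_M)
  also have "\<dots> = \<Phi> (u\<^sup>2 * (LINT x|lborel. (\<phi> x)\<^sup>2))" by (simp add: char_M[OF s] power_mult_distrib)
  finally show ?thesis .
qed

text \<open>The norms of Schwartz approximants of \<open>f0\<close> converge to a positive number,
  so one of them is positive; dividing its pairing by the norm gives Z.\<close>

lemma radial_variable:
  obtains Z where "Z \<in> borel_measurable M" "\<And>u. (LINT \<omega>|M. iexp (u * Z \<omega>)) = \<Phi> (u\<^sup>2)"
proof -
  obtain \<phi> where \<phi>: "\<And>n. \<phi> n \<in> schwartz" "L2_tendsto lborel \<phi> f0" "L2_tendsto M (\<lambda>n \<omega>. \<omega> (\<phi> n)) Y0"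
    using f0(1) unfolding is_pairing_def by blast
  have "\<forall>\<^sub>F n in sequentially. (LINT x|lborel. (\<phi> n x)\<^sup>2) > 0"
    by (rule order_tendstoD(1)[OF L2_tendsto_norm[OF \<phi>(2)] f0(2)])
  then obtain n where n: "(LINT x|lborel. (\<phi> n x)\<^sup>2) > 0" by (auto simp: eventually_sequentially)
  define v where "v = (LINT x|lborel. (\<phi> n x)\<^sup>2)"
  have v: "v > 0" using n by (simp add: v_def)
  have [measurable]: "(\<lambda>\<omega>. \<omega> (\<phi> n)) \<in> borel_measurable M" using \<phi>(3) by (simp add: L2_tendsto_def)
  show thesis
  proof (rule that[of "\<lambda>\<omega>. \<omega> (\<phi> n) / sqrt v"])
    fix u
    have "(LINT \<omega>|M. iexp (u * (\<omega> (\<phi> n) / sqrt v))) = (LINT \<omega>|M. iexp ((u / sqrt v) * \<omega> (\<phi> n)))" by simp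
    also have "\<dots> = \<Phi> ((u / sqrt v)\<^sup>2 * v)" unfolding v_def by (rule char_scaled[OF \<phi>(1)])
    also have "(u / sqrt v)\<^sup>2 * v = u\<^sup>2" using v by (simp add: power_divide)
    finally show "(LINT \<omega>|M. iexp (u * (\<omega> (\<phi> n) / sqrt v))) = \<Phi> (u\<^sup>2)" .
  qed measurable
qed

lemma char_distr:
  assumes [measurable]: "Y \<in> borel_measurable M"
  shows "char (distr M borel Y) u = (LINT \<omega>|M. iexp (u * Y \<omega>))"
  unfolding char_def by (subst integral_distr) auto

text \<open>\<Phi>(r) is the characteristic function of Z at sqrt r, so continuity is inherited from
  characteristic functions and needs no analysis of the Wright function.\<close>

lemma continuous_radial: "continuous_on {0..} \<Phi>"
proof -
  obtain Z where Z: "Z \<in> borel_measurable M" "\<And>u. (LINT \<omega>|M. iexp (u * Z \<omega>)) = \<Phi> (u\<^sup>2)"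
    using radial_variable by blast
  interpret N: real_distribution "distr M borel Z" by (rule real_distribution_distr[OF Z(1)])
  have "continuous_on {0..} (\<lambda>r. char (distr M borel Z) (sqrt r))"
    by (rule continuous_on_compose2[of UNIV])
       (auto intro!: continuous_at_imp_continuous_on N.isCont_char continuous_intros)
  then show ?thesis
  proof (rule continuous_on_eq)
    fix r :: real assume "r \<in> {0..}"
    then show "char (distr M borel Z) (sqrt r) = \<Phi> r"
      using char_distr[OF Z(1), of "sqrt r"] Z(2)[of "sqrt r"] by simp
  qed
qed

text \<open>Both sides pass to the limit along Schwartz approximants: norms by
  \<open>L2_tendsto_norm\<close> and continuity of \<Phi>, expectations by
  \<open>L2_tendsto_char\<close>.\<close>

lemma char_pairing:
  assumes "is_pairing M f Y"
  shows "(LINT \<omega>|M. iexp (Y \<omega>)) = \<Phi> (LINT x|lborel. (f x)\<^sup>2)"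
proof -
  obtain \<phi> where \<phi>: "\<And>n. \<phi> n \<in> schwartz" "L2_tendsto lborel \<phi> f" "L2_tendsto M (\<lambda>n \<omega>. \<omega> (\<phi> n)) Y"
    using assms unfolding is_pairing_def by blast
  have "(\<lambda>n. \<Phi> (LINT x|lborel. (\<phi> n x)\<^sup>2)) \<longlonglongrightarrow> \<Phi> (LINT x|lborel. (f x)\<^sup>2)"
    by (rule continuous_on_tendsto_compose[OF continuous_radial L2_tendsto_norm[OF \<phi>(2)]]) auto
  moreover have "(\<lambda>n. \<Phi> (LINT x|lborel. (\<phi> n x)\<^sup>2)) \<longlonglongrightarrow> (LINT \<omega>|M. iexp (Y \<omega>))"
    using L2_tendsto_char[OF \<phi>(3)] by (simp add: char_M \<phi>(1))
  ultimately show ?thesis by (rule LIMSEQ_unique[rotated])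
qed

lemma distr_pairing:
  assumes Y: "is_pairing M f Y" and Z: "Z \<in> borel_measurable M" "\<And>u. (LINT \<omega>|M. iexp (u * Z \<omega>)) = \<Phi> (u\<^sup>2)"
  shows "distr M borel Y = distr M borel (\<lambda>\<omega>. sqrt (LINT x|lborel. (f x)\<^sup>2) * Z \<omega>)"
proof -
  let ?s = "sqrt (LINT x|lborel. (f x)\<^sup>2)"
  note [measurable] = Z(1) is_pairing_measurable[OF Y]
  have "char (distr M borel Y) u = char (distr M borel (\<lambda>\<omega>. ?s * Z \<omega>)) u" for u
  proof -
    have "char (distr M borel Y) u = \<Phi> (LINT x|lborel. (u * f x)\<^sup>2)"
      using char_pairing[OF is_pairing_lincomb[OF Y Y, of u 0]] by (simp add: char_distr)
    also have "(LINT x|lborel. (u * f x)\<^sup>2) = (u * ?s)\<^sup>2" by (simp add: power_mult_distrib)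
    also have "\<Phi> ((u * ?s)\<^sup>2) = char (distr M borel (\<lambda>\<omega>. ?s * Z \<omega>)) u"
      by (simp add: char_distr Z(2)[symmetric] mult.assoc)
    finally show ?thesis .
  qed
  then show ?thesis by (intro Levy_uniqueness real_distribution_distr) auto
qed

end

section \<open>The generalized Fox-H process\<close>

lemma fox_K_pos:
  assumes "\<And>i. i \<in> {1..p} \<Longrightarrow> a i + \<alpha> i > 0" "\<And>j. j \<in> {1..m} \<Longrightarrow> b j + \<beta> j > 0"
  shows "fox_K m p a \<alpha> b \<beta> > 0"
  unfolding fox_K_def using assms by (intro divide_pos_pos prod_pos ballI Gamma_real_pos) auto

lemma (in radial_char_measure) is_pairing_diff:
  assumes "is_pairing M f Y" "is_pairing M g Z"
  shows "is_pairing M (\<lambda>x. f x - g x) (\<lambda>\<omega>. Y \<omega> - Z \<omega>)"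
  using is_pairing_lincomb[OF assms, of 1 "-1"] by simp

text \<open>Linear combinations of pairings are pairings, so joint characteristic functions are
  determined by the norms of combinations of the kernels.\<close>

lemma (in radial_char_measure) same_fddI:
  assumes X: "\<And>t. t \<ge> 0 \<Longrightarrow> is_pairing M (f t) (X t)" and Y: "\<And>t. t \<ge> 0 \<Longrightarrow> is_pairing M (g t) (Y t)"
    and norm: "\<And>I u. finite I \<Longrightarrow> I \<subseteq> {0..} \<Longrightarrow> (LINT x|lborel. (\<Sum>t\<in>I. u t * f t x)\<^sup>2) = (LINT x|lborel. (\<Sum>t\<in>I. u t * g t x)\<^sup>2)"
  shows "same_fdd M X Y"
  unfolding same_fdd_def
proof (intro allI impI, elim conjE)
  fix I :: "real set" assume I: "finite I" "I \<subseteq> {0..}"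
  show "distr M (PiM I (\<lambda>_. borel)) (\<lambda>\<omega>. \<lambda>t\<in>I. X t \<omega>) = distr M (PiM I (\<lambda>_. borel)) (\<lambda>\<omega>. \<lambda>t\<in>I. Y t \<omega>)"
  proof (rule distr_PiM_eq_of_char[OF I(1)])
    show "X t \<in> borel_measurable M" "Y t \<in> borel_measurable M" if "t \<in> I" for t
      using that I X Y is_pairing_measurable by (meson atLeast_iff subsetD)+
    show "(LINT \<omega>|M. iexp (\<Sum>t\<in>I. u t * X t \<omega>)) = (LINT \<omega>|M. iexp (\<Sum>t\<in>I. u t * Y t \<omega>))" for u
    proof -
      have "is_pairing M (\<lambda>x. \<Sum>t\<in>I. u t * f t x) (\<lambda>\<omega>. \<Sum>t\<in>I. u t * X t \<omega>)"
        "is_pairing M (\<lambda>x. \<Sum>t\<in>I. u t * g t x) (\<lambda>\<omega>. \<Sum>t\<in>I. u t * Y t \<omega>)"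
        using I X Y by (auto intro!: is_pairing_sum)
      then show ?thesis by (simp only: char_pairing norm[OF I])
    qed
  qed
qed

theorem proposition3p6:
  fixes m p :: nat
    and a \<alpha> b \<beta> :: "nat \<Rightarrow> real"
    and g0 c H :: real
    and M :: "((real \<Rightarrow> real) \<Rightarrow> real) measure"
    and X :: "real \<Rightarrow> ((real \<Rightarrow> real) \<Rightarrow> real) \<Rightarrow> real"
  defines "K \<equiv> fox_K m p a \<alpha> b \<beta>"
    and "\<Psi> \<equiv> gen_wright m p a \<alpha> b \<beta> c"
    and "astar \<equiv> (\<Sum>j=1..m. \<beta> j) - (\<Sum>i=1..p. \<alpha> i)"
    and "\<mu> \<equiv> (\<Sum>j=1..m. b j) - (\<Sum>i=1..p. a i) + (real p - real m) / 2"
  assumes A: "\<And>i. i \<in> {1..p} \<Longrightarrow> \<alpha> i > 0 \<and> a i + \<alpha> i > 0"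
    and B: "\<And>j. j \<in> {1..m} \<Longrightarrow> \<beta> j > 0 \<and> b j + \<beta> j > 0"
    and astar: "astar > 0 \<or> (astar = 0 \<and> \<mu> < -1)"
    and g0: "\<And>j. j \<in> {1..m} \<Longrightarrow> g0 > - b j / \<beta> j"
    and fox_nonneg: "\<And>\<tau>. \<tau> > 0 \<Longrightarrow> fox_H m p a \<alpha> b \<beta> g0 \<tau> \<in> \<real>\<^sub>\<ge>\<^sub>0"
    and c: "c > 0" "\<And>j. j \<in> {1..m} \<Longrightarrow> c < (b j + \<beta> j) / \<beta> j"
    and H: "0 < H" "H < 1"
    and M: "is_fox_H_measure m p a \<alpha> b \<beta> c M"
    and X: "is_fox_H_process M H X"
  shows
    "(\<forall>t\<ge>0. \<forall>s\<ge>0. \<forall>u::real.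
        (LINT \<omega>|M. iexp (u * (X t \<omega> - X s \<omega>))) =
        \<Psi> (- (u\<^sup>2 / 2) * \<bar>t - s\<bar> powr (2 * H)) / of_real K) \<and>
     (self_similar M H X \<and> stationary_increments M X) \<and>
     (\<forall>n::nat. n \<ge> 1 \<longrightarrow>
        (\<exists>C1>0. \<forall>t\<ge>0. \<forall>s\<ge>0.
           integrable M (\<lambda>\<omega>. \<bar>X t \<omega> - X s \<omega>\<bar> ^ (2 * n)) \<and>
           (LINT \<omega>|M. \<bar>X t \<omega> - X s \<omega>\<bar> ^ (2 * n)) = C1 * \<bar>t - s\<bar> powr (2 * real n * H))) \<and>
     (\<forall>n::nat. n \<ge> 1 \<longrightarrow> 2 * real n * H > 1 \<longrightarrow>
        (\<forall>\<gamma>. 0 < \<gamma> \<and> \<gamma> < H - 1 / (2 * real n) \<longrightarrow>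
           (\<exists>Y. is_version M X Y \<and>
                (\<forall>\<omega>\<in>space M. holder_on_compacts \<gamma> (\<lambda>t. Y t \<omega>)))))"
proof -
  define \<Phi> where "\<Phi> r = \<Psi> (- (1/2) * r) / of_real K" for r
  have K: "K > 0" unfolding K_def by (rule fox_K_pos) (use A B in auto)
  from M interpret prob_space M by (simp add: is_fox_H_measure_def)
  \<comment> \<open>A pairing depends only on the class of f in L2, so the operator may be replaced
    by the explicit kernel.\<close>
  have pair: "is_pairing M (fbm_kernel H t) (X t)" if "t \<ge> 0" for t
  proof (rule is_pairing_cong[OF _ AE_frac_M_indicator[OF H that]])
    show "is_pairing M (frac_M H (indicat_real {0..<t})) (X t)"
      using X that by (simp add: is_fox_H_process_def)
  qed simp
  have int1: "integrable lborel (\<lambda>x. (fbm_kernel H 1 x)\<^sup>2)"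
    using pair[of 1] by (auto simp: is_pairing_def L2_tendsto_def)
  interpret radial_char_measure M \<Phi> "fbm_kernel H 1" "X 1"
  proof
    show "sets M = sets cylinder_space" using M by (simp add: is_fox_H_measure_def)
    show "(LINT \<omega>|M. iexp (\<omega> \<phi>)) = \<Phi> (LINT x|lborel. (\<phi> x)\<^sup>2)" if "\<phi> \<in> schwartz" for \<phi>
      using M that by (simp add: is_fox_H_measure_def \<Phi>_def \<Psi>_def K_def power2_eq_square)
    show "is_pairing M (fbm_kernel H 1) (X 1)" by (rule pair) simp
    show "(LINT x|lborel. (fbm_kernel H 1 x)\<^sup>2) > 0" using fbm_kernel_norm_1[OF H(1) int1] by simp
  qed
  note increment_norm = fbm_kernel_increment_norm[OF H(1) int1]
  obtain Z where Z[measurable]: "Z \<in> borel_measurable M" and Z_char: "\<And>u. (LINT \<omega>|M. iexp (u * Z \<omega>)) = \<Phi> (u\<^sup>2)"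
    using radial_variable by blast

  have part1: "(LINT \<omega>|M. iexp (u * (X t \<omega> - X s \<omega>))) = \<Psi> (- (u\<^sup>2 / 2) * \<bar>t - s\<bar> powr (2 * H)) / of_real K"
    if "t \<ge> 0" "s \<ge> 0" for t s u
  proof -
    \<comment> \<open>The argument u is moved into the paired function, since
      \<open>char_pairing\<close> is stated at frequency 1.\<close>
    have "(LINT \<omega>|M. iexp (u * X t \<omega> + (- u) * X s \<omega>)) = \<Phi> (LINT x|lborel. (u * fbm_kernel H t x + (- u) * fbm_kernel H s x)\<^sup>2)"
      by (intro char_pairing is_pairing_lincomb pair that)
    also have "(LINT x|lborel. (u * fbm_kernel H t x + (- u) * fbm_kernel H s x)\<^sup>2) = (LINT x|lborel. u\<^sup>2 * (fbm_kernel H t x - fbm_kernel H s x)\<^sup>2)"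
      by (intro Bochner_Integration.integral_cong refl) (simp add: power_mult_distrib[symmetric] right_diff_distrib)
    also have "\<dots> = u\<^sup>2 * \<bar>t - s\<bar> powr (2 * H)" by (simp add: increment_norm)
    finally show ?thesis by (simp add: \<Phi>_def right_diff_distrib)
  qed

  have part2a: "self_similar M H X"
    unfolding self_similar_def
  proof (intro allI impI)
    fix r :: real assume r: "r > 0"
    show "same_fdd M (\<lambda>t. X (r * t)) (\<lambda>t \<omega>. r powr H * X t \<omega>)"
    proof (rule same_fddI)
      show "is_pairing M (fbm_kernel H (r * t)) (X (r * t))" if "t \<ge> 0" for t
        using r that by (intro pair) auto
      show "is_pairing M (\<lambda>x. r powr H * fbm_kernel H t x) (\<lambda>\<omega>. r powr H * X t \<omega>)" if "t \<ge> 0" for t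
        using is_pairing_lincomb[OF pair[OF that] pair[OF that], of "r powr H" 0] by simp
    qed (rule fbm_kernel_self_similar_norm[OF r])
  qed

  have part2b: "stationary_increments M X"
    unfolding stationary_increments_def
  proof (intro allI impI)
    fix h :: real assume h: "h \<ge> 0"
    show "same_fdd M (\<lambda>t \<omega>. X (t + h) \<omega> - X h \<omega>) (\<lambda>t \<omega>. X t \<omega> - X 0 \<omega>)"
    proof (rule same_fddI)
      show "is_pairing M (\<lambda>x. fbm_kernel H (t + h) x - fbm_kernel H h x) (\<lambda>\<omega>. X (t + h) \<omega> - X h \<omega>)" if "t \<ge> 0" for t
        using h that by (intro is_pairing_diff pair) auto
      show "is_pairing M (fbm_kernel H t) (\<lambda>\<omega>. X t \<omega> - X 0 \<omega>)" if "t \<ge> 0" for t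
        using is_pairing_diff[OF pair[OF that] pair[of 0]] by simp
    qed (rule fbm_kernel_stationary_norm)
  qed

  \<comment> \<open>Otherwise \<Phi> is constantly 1, so \<Psi>(-x) = K for all x > 0, against
    \<Psi>(-x) = O(x^(-c)) with c > 0 and K > 0. This makes \<open>C n\<close> strictly
    positive.\<close>
  have Z_not_0: "\<not> (AE \<omega> in M. Z \<omega> = 0)"
  proof
    assume "AE \<omega> in M. Z \<omega> = 0"
    then have "(LINT \<omega>|M. iexp (u * Z \<omega>)) = (LINT \<omega>|M. 1)" for u
      by (intro integral_cong_AE) auto
    then have one: "\<Phi> (u\<^sup>2) = 1" for u using Z_char[of u] by (simp add: prob_space)
    obtain D where D: "\<And>x. x > 0 \<Longrightarrow> cmod (\<Psi> (- x)) \<le> D * x powr (- c)"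
      using gen_wright_bound[of m p a \<alpha> b \<beta> c] unfolding \<Psi>_def by blast
    have "K \<le> D * x powr (- c)" if "x > 0" for x
    proof -
      have "\<Phi> ((sqrt (2 * x))\<^sup>2) = \<Psi> (- x) / of_real K" using that by (simp add: \<Phi>_def)
      then have "\<Psi> (- x) = of_real K" using one[of "sqrt (2 * x)"] K by simp
      then show ?thesis using D[OF that] K by simp
    qed
    then have "\<forall>\<^sub>F x in at_top. K \<le> D * x powr (- c)"
      by (rule eventually_mono[OF eventually_gt_at_top[of 0]])
    moreover have "((\<lambda>x. D * x powr (- c)) \<longlongrightarrow> D * 0) at_top"
      using c(1) by (intro tendsto_mult tendsto_const tendsto_neg_powr filterlim_ident) auto
    ultimately have "K \<le> D * 0"
      by (intro tendsto_lowerbound[of "\<lambda>x. D * x powr (- c)" "D * 0" at_top K]) auto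
    then show False using K by simp
  qed

  have Z_int: "integrable M (\<lambda>\<omega>. Z \<omega> ^ (2 * n))" for n
  proof -
    have astar': "(\<Sum>i=1..p. \<alpha> i) \<le> (\<Sum>j=1..m. \<beta> j)" using astar unfolding astar_def by linarith
    obtain q D where q: "\<And>x. x > 0 \<Longrightarrow> cmod (\<Psi> (- x) - (\<Sum>k\<le>n. q k * of_real x ^ k)) \<le> D * x powr (real n + 1/2)"
      using gen_wright_expansion[where p = p and \<alpha> = \<alpha> and m = m and \<beta> = \<beta> and c = c and b = b and n = n and a = a] A B astar' c unfolding \<Psi>_def by blast
    show ?thesis
    proof (rule integrable_even_moment[OF Z, where q = "\<lambda>k. Re (q k) / (K * 2 ^ k)" and D = "D * (1/2) powr (real n + 1/2) / K"])
      fix v :: real assume v: "v > 0"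
      \<comment> \<open>Since \<Phi>(v^2) = \<Psi>(-v^2/2) / K, powers of x become even powers of v
        and the remainder x^(n + 1/2) becomes a multiple of v^(2n+1), as
        \<open>integrable_even_moment\<close> requires.\<close>
      define x where "x = v\<^sup>2 / 2"
      have x: "x > 0" using v by (simp add: x_def)
      have "integrable M (\<lambda>\<omega>. iexp (v * Z \<omega>))" by (rule integrable_const_bound[of _ 1]) auto
      from integral_Re[OF this] have "expectation (\<lambda>\<omega>. cos (v * Z \<omega>)) = Re (\<Phi> (v\<^sup>2))"
        unfolding Z_char by (simp add: Re_exp)
      also have "\<dots> = Re (\<Psi> (- x)) / K" by (simp add: \<Phi>_def x_def)
      finally have E: "expectation (\<lambda>\<omega>. cos (v * Z \<omega>)) = Re (\<Psi> (- x)) / K" .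
      have S: "(\<Sum>k\<le>n. Re (q k) / (K * 2 ^ k) * v ^ (2 * k)) = Re (\<Sum>k\<le>n. q k * of_real x ^ k) / K"
        unfolding Re_sum sum_divide_distrib
        by (intro sum.cong refl) (simp add: x_def power_divide power_mult flip: of_real_power)
      have "\<bar>Re (\<Psi> (- x)) / K - Re (\<Sum>k\<le>n. q k * of_real x ^ k) / K\<bar> = \<bar>Re (\<Psi> (- x) - (\<Sum>k\<le>n. q k * of_real x ^ k))\<bar> / K"
        using K by (simp add: diff_divide_distrib[symmetric] del: Re_sum)
      also have "\<dots> \<le> (D * x powr (real n + 1/2)) / K"
        by (rule divide_right_mono[OF order_trans[OF abs_Re_le_cmod q[OF x]]]) (use K in simp)
      also have "x powr (real n + 1/2) = v ^ (2 * n + 1) * (1/2) powr (real n + 1/2)"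
      proof -
        have "v\<^sup>2 powr (real n + 1/2) = (v powr 2) powr (real n + 1/2)" using v by (simp add: powr_numeral)
        also have "\<dots> = v powr real (2 * n + 1)" unfolding powr_powr by (simp add: algebra_simps)
        also have "\<dots> = v ^ (2 * n + 1)" using v by (rule powr_realpow)
        finally have *: "v\<^sup>2 powr (real n + 1/2) = v ^ (2 * n + 1)" .
        have "x = v\<^sup>2 * (1/2)" by (simp add: x_def)
        then have "x powr (real n + 1/2) = v\<^sup>2 powr (real n + 1/2) * (1/2) powr (real n + 1/2)"
          by (simp only: powr_mult)
        then show ?thesis unfolding * .
      qed
      finally show "\<bar>expectation (\<lambda>\<omega>. cos (v * Z \<omega>)) - (\<Sum>k\<le>n. Re (q k) / (K * 2 ^ k) * v ^ (2 * k))\<bar>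
          \<le> D * (1/2) powr (real n + 1/2) / K * v ^ (2 * n + 1)"
        unfolding E S by (simp add: mult_ac)
    qed
  qed

  define C where "C n = expectation (\<lambda>\<omega>. Z \<omega> ^ (2 * n))" for n
  have C_pos: "C n > 0" if "n \<ge> 1" for n
  proof -
    have "C n \<ge> 0" unfolding C_def by (intro integral_nonneg_AE) auto
    moreover have "C n \<noteq> 0"
    proof
      assume "C n = 0"
      then have "AE \<omega> in M. Z \<omega> ^ (2 * n) = 0"
        using integral_nonneg_eq_0_iff_AE[OF Z_int[of n]] unfolding C_def by simp
      then have "AE \<omega> in M. Z \<omega> = 0" by eventually_elim simp
      then show False using Z_not_0 by simp
    qed
    ultimately show ?thesis by simp
  qed
  have part3: "integrable M (\<lambda>\<omega>. \<bar>X t \<omega> - X s \<omega>\<bar> ^ (2 * n))"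
    "(LINT \<omega>|M. \<bar>X t \<omega> - X s \<omega>\<bar> ^ (2 * n)) = C n * \<bar>t - s\<bar> powr (2 * real n * H)"
    if n: "n \<ge> 1" and ts: "t \<ge> 0" "s \<ge> 0" for n t s
  proof -
    define r where "r = \<bar>t - s\<bar> powr H"
    have r2: "sqrt (\<bar>t - s\<bar> powr (2 * H)) = r"
    proof -
      have "\<bar>t - s\<bar> powr (2 * H) = r\<^sup>2" by (simp add: r_def power2_eq_square powr_add[symmetric])
      then show ?thesis by (simp add: r_def)
    qed
    have rn: "r ^ (2 * n) = \<bar>t - s\<bar> powr (2 * real n * H)"
    \<comment> \<open>For t = s both sides are 0: the power because n >= 1, the \<open>powr\<close>
      by the convention at base 0.\<close>
    proof (cases "t = s")
      case False
      then have "r ^ (2 * n) = r powr real (2 * n)" by (intro powr_realpow[symmetric]) (simp add: r_def)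
      then show ?thesis by (simp add: r_def powr_powr mult_ac)
    qed (use n in \<open>simp add: r_def\<close>)
    have diff: "is_pairing M (\<lambda>x. fbm_kernel H t x - fbm_kernel H s x) (\<lambda>\<omega>. X t \<omega> - X s \<omega>)"
      by (intro is_pairing_diff pair ts)
    note [measurable] = is_pairing_measurable[OF diff]
    have law: "distr M borel (\<lambda>\<omega>. X t \<omega> - X s \<omega>) = distr M borel (\<lambda>\<omega>. r * Z \<omega>)"
      using distr_pairing[OF diff Z Z_char] unfolding increment_norm r2 .
    have pow: "\<bar>r * Z \<omega>\<bar> ^ (2 * n) = r ^ (2 * n) * Z \<omega> ^ (2 * n)" for \<omega>
      by (simp add: power_mult abs_mult power_mult_distrib)
    have m: "(\<lambda>y::real. \<bar>y\<bar> ^ (2 * n)) \<in> borel_measurable borel" by measurable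
    have "integrable M (\<lambda>\<omega>. \<bar>X t \<omega> - X s \<omega>\<bar> ^ (2 * n)) \<longleftrightarrow> integrable (distr M borel (\<lambda>\<omega>. X t \<omega> - X s \<omega>)) (\<lambda>y. \<bar>y\<bar> ^ (2 * n))"
      by (rule integrable_distr_eq[symmetric]) (use m in auto)
    also have "\<dots> \<longleftrightarrow> integrable M (\<lambda>\<omega>. \<bar>r * Z \<omega>\<bar> ^ (2 * n))"
      unfolding law by (rule integrable_distr_eq) (use m in auto)
    finally show "integrable M (\<lambda>\<omega>. \<bar>X t \<omega> - X s \<omega>\<bar> ^ (2 * n))"
      unfolding pow using Z_int[of n] by simp
    have "(LINT \<omega>|M. \<bar>X t \<omega> - X s \<omega>\<bar> ^ (2 * n)) = (LINT y|distr M borel (\<lambda>\<omega>. X t \<omega> - X s \<omega>). \<bar>y\<bar> ^ (2 * n))"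
      by (rule integral_distr[symmetric]) (use m in auto)
    also have "\<dots> = (LINT \<omega>|M. \<bar>r * Z \<omega>\<bar> ^ (2 * n))"
      unfolding law by (rule integral_distr) (use m in auto)
    also have "\<dots> = C n * \<bar>t - s\<bar> powr (2 * real n * H)" unfolding pow by (simp add: C_def rn)
    finally show "(LINT \<omega>|M. \<bar>X t \<omega> - X s \<omega>\<bar> ^ (2 * n)) = C n * \<bar>t - s\<bar> powr (2 * real n * H)" .
  qed

  have part4: "\<exists>Y. is_version M X Y \<and> (\<forall>\<omega>\<in>space M. holder_on_compacts \<gamma> (\<lambda>t. Y t \<omega>))"
    if n: "n \<ge> 1" and \<gamma>: "0 < \<gamma>" "\<gamma> < H - 1 / (2 * real n)" for n \<gamma>
  \<comment> \<open>The choice of e gives 1 + e = 2nH, and 2n \<gamma> < e is exactly \<gamma> < H -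
    1/(2n).\<close>
  proof (rule kolmogorov_chentsov[where p = "2 * n" and C = "C n" and e = "2 * real n * H - 1"])
    show "X t \<in> borel_measurable M" if "t \<ge> 0" for t by (rule is_pairing_measurable[OF pair[OF that]])
    show "(\<integral>\<^sup>+ \<omega>. ennreal (\<bar>X t \<omega> - X s \<omega>\<bar> ^ (2 * n)) \<partial>M) \<le> ennreal (C n * \<bar>t - s\<bar> powr (1 + (2 * real n * H - 1)))"
      if "s \<ge> 0" "t \<ge> 0" for s t
      using nn_integral_eq_integral[OF part3(1)[OF n that(2,1)]] part3(2)[OF n that(2,1)] by simp
    have "real (2 * n) * \<gamma> < real (2 * n) * (H - 1 / (2 * real n))" using n \<gamma> by (intro mult_strict_left_mono) auto
    then show "real (2 * n) * \<gamma> < 2 * real n * H - 1" using n by (simp add: right_diff_distrib)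
  qed (use n \<gamma> C_pos[OF n] in auto)

  show ?thesis
  proof (intro conjI allI impI)
    fix n :: nat assume n: "n \<ge> 1"
    show "\<exists>C1>0. \<forall>t\<ge>0. \<forall>s\<ge>0.
       integrable M (\<lambda>\<omega>. \<bar>X t \<omega> - X s \<omega>\<bar> ^ (2 * n)) \<and>
       (LINT \<omega>|M. \<bar>X t \<omega> - X s \<omega>\<bar> ^ (2 * n)) = C1 * \<bar>t - s\<bar> powr (2 * real n * H)"
      using C_pos[OF n] part3[OF n] by (intro exI[of _ "C n"]) simp
  next
    fix n :: nat and \<gamma> :: real assume "n \<ge> 1" "0 < \<gamma> \<and> \<gamma> < H - 1 / (2 * real n)"
    then show "\<exists>Y. is_version M X Y \<and> (\<forall>\<omega>\<in>space M. holder_on_compacts \<gamma> (\<lambda>t. Y t \<omega>))"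
      using part4[of n \<gamma>] by simp
  qed (rule part1 part2a part2b; assumption)+
qed

end
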